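(* Let $d\in\mathbb{N}$, $L\in\{2,3,\ldots\}$, and let $\mathcal{J}:[0,\infty)\times E\to[0,\infty)$ be a proper family of kernels on the hierarchical lattice $\mathbb{H}^d_L$, with critical value $\lambda_c=\lambda_c(\mathcal{J})$. \begin{enumerate} \item If $\mathcal{J}\gg n^{-2d}\log\log n$ and $\lambda_c<\infty$, then $\mathbb{P}_{\mathcal{J}(\lambda_c)}(|K_0|=\infty)=0$. \item If $\mathcal{J}\ll n^{-2d}\log\log n$, then $\lambda_c=\infty$. \item If $\mathcal{J}\approx n^{-2d}\log\log n$ and $\lambda_c<\infty$, then $\mathbb{P}_{\mathcal{J}(\lambda_c)}(|K_0|=\infty)>0$. \end{enumerate}
   Context: The hierarchical lattice $\mathbb{H}^d_L$ is the abelian group $\bigoplus_{i=1}^\infty(\mathbb{Z}/L\mathbb{Z})^d$ with the ultrametric $\|x-y\|=L^{\max\{i:x_i\neq y_i\}}$ for $x\neq y$. For $n\ge 0$, the ball of radius $L^n$ around $x$ is the $n$-block $\Lambda_n(x)$, and $\Lambda_n=\Lambda_n(0)$. The edge set is $E=\{\{x,y\}:x\neq y\}$, and $|e|=\|x-y\|$ for $e=\{x,y\}$. For a kernel $J:E\to[0,\infty)$, $\mathbb{P}_J$ is the law of the random graph on $\mathbb{H}^d_L$ in which each edge $e$ is open independently with probability $1-\exp(-J(e))$; $K_0$ is the open cluster of the origin. We write $J(x,y)=\mathbb{1}(x\neq y)J(\{x,y\})$. A kernel is isometry-invariant if $J(e)=J(f)$ whenever $|e|=|f|$; integrable if $\sum_{e\ni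 0}J(e)<\infty$; regular if there is $C<\infty$ such that $\sum_{x\notin\Lambda_n}J(0,x)\le C\sum_{x\in\Lambda_{n+1}\setminus\Lambda_n}J(0,x)$ for all sufficiently large $n$. For a family $\mathcal{J}:[0,\infty)\times E\to[0,\infty)$ write $\mathbb{P}_{\mathcal{J}(\lambda)}$ for $\mathbb{P}_{\mathcal{J}(\lambda,\cdot)}$. The family is monotone if $\mathcal{J}(\lambda,e)$ is non-decreasing in $\lambda$ for each $e$; continuous if for each $\lambda^\star>0$ the functions $\lambda\mapsto\sup_e \mathcal{J}(\lambda,e)/\mathcal{J}(\lambda^\star,e)$ and $\lambda\mapsto\sup_e\mathcal{J}(\lambda^\star,e)/\mathcal{J}(\lambda,e)$ are finite-valued and continuous on $(0,\infty)$; non-percolative at $0$ if $\sum_{e\ni 0}\mathcal{J}(\lambda,e)<1$ for all sufficiently small $\lambda\ge0$. It is proper if it is monotone, continuous, non-percolative at $0$, and $\mathcal{J}(\lambda,\cdot)$ is isometry-invariant, integrable and regular for every $\lambda>0$. $\lambda_c(\mathcal{J})=\inf\{\lambda\ge0:\mathbb{P}_{\mathcal{J}(\lambda)}(|K_0|=\infty)>0\}$. For $f:\mathbb{N}\to[0,\infty)$: $\mathcal{J}\approx f$ means $0<\liminf_{|e|\to\infty}\mathcal{J}(\lambda,e)/f(|e|)\le\limsup_{|e|\to\infty}\mathcal{J}(\lambda,e)/f(|e|)<\infty$ for every $\lambda>0$; $\mathcal{J}\ll f$ means $\limsup_{|e|\to\infty}\mathcal{J}(\lambda,e)/f(|e|)=0$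 for every $\lambda>0$; $\mathcal{J}\gg f$ means $\liminf_{|e|\to\infty}\mathcal{J}(\lambda,e)/f(|e|)=\infty$ for every $\lambda>0$. *)

theory Defs
  imports "HOL-Probability.Probability"
begin

text \<open>Vertices of the hierarchical lattice: a vertex x is encoded as a function
  x :: nat => nat => nat, where x i is the i-th component (i >= 1) of
  the direct sum, itself an element of (Z/LZ)^d encoded as a function
  j |-> x i j with values in {0..<L} and zero for j >= d.  The unused index
  i = 0 is forced to be zero, and only finitely many components are non-zero.\<close>

type_synonym hvert = "nat \<Rightarrow> nat \<Rightarrow> nat"

definition hier :: "nat \<Rightarrow> nat \<Rightarrow> hvert set" where
  "hier d L = {x. (\<forall>i j. x i j < L) \<and> (\<forall>i j. d \<le> j \<longrightarrow> x i j = 0)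
      \<and> x 0 = (\<lambda>_. 0) \<and> finite {i. x i \<noteq> (\<lambda>_. 0)}}"

definition horigin :: hvert where
  "horigin = (\<lambda>_ _. 0)"

definition hnorm :: "nat \<Rightarrow> hvert \<Rightarrow> hvert \<Rightarrow> nat" where
  "hnorm L x y = (if x = y then 0 else L ^ Max {i. x i \<noteq> y i})"

definition hblock :: "nat \<Rightarrow> nat \<Rightarrow> nat \<Rightarrow> hvert set" where
  "hblock d L n = {x \<in> hier d L. hnorm L horigin x \<le> L ^ n}"

definition hedges :: "nat \<Rightarrow> nat \<Rightarrow> hvert set set" where
  "hedges d L = {{x, y} | x y. x \<in> hier d L \<and> y \<in> hier d L \<and> x \<noteq> y}"

definition elen :: "nat \<Rightarrow> hvert set \<Rightarrow> nat" where
  "elen L e = Max ((\<lambda>(x, y). hnorm L x y) ` (e \<times> e))"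

definition kpair :: "(hvert set \<Rightarrow> real) \<Rightarrow> hvert \<Rightarrow> hvert \<Rightarrow> real" where
  "kpair J x y = (if x \<noteq> y then J {x, y} else 0)"

definition isometry_invariant :: "nat \<Rightarrow> nat \<Rightarrow> (hvert set \<Rightarrow> real) \<Rightarrow> bool" where
  "isometry_invariant d L J \<longleftrightarrow>
     (\<forall>e \<in> hedges d L. \<forall>f \<in> hedges d L. elen L e = elen L f \<longrightarrow> J e = J f)"

definition kintegrable :: "nat \<Rightarrow> nat \<Rightarrow> (hvert set \<Rightarrow> real) \<Rightarrow> bool" where
  "kintegrable d L J \<longleftrightarrow> J summable_on {e \<in> hedges d L. horigin \<in> e}"

definition kregular :: "nat \<Rightarrow> nat \<Rightarrow> (hvert set \<Rightarrow> real) \<Rightarrow> bool" where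
  "kregular d L J \<longleftrightarrow> (\<exists>C::real. \<exists>N. \<forall>n \<ge> N.
     (\<Sum>\<^sub>\<infinity>x \<in> hier d L - hblock d L n. kpair J horigin x)
       \<le> C * (\<Sum>\<^sub>\<infinity>x \<in> hblock d L (Suc n) - hblock d L n. kpair J horigin x))"

definition perc_law :: "nat \<Rightarrow> nat \<Rightarrow> (hvert set \<Rightarrow> real) \<Rightarrow> (hvert set \<Rightarrow> bool) measure" where
  "perc_law d L J =
     (\<Pi>\<^sub>M e \<in> hedges d L. measure_pmf (bernoulli_pmf (1 - exp (- J e))))"

definition open_rel :: "nat \<Rightarrow> nat \<Rightarrow> (hvert set \<Rightarrow> bool) \<Rightarrow> (hvert \<times> hvert) set" where
  "open_rel d L \<omega> = {(x, y). {x, y} \<in> hedges d L \<and> \<omega> {x, y}}"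

definition cluster :: "nat \<Rightarrow> nat \<Rightarrow> (hvert set \<Rightarrow> bool) \<Rightarrow> hvert \<Rightarrow> hvert set" where
  "cluster d L \<omega> x = {y. (x, y) \<in> (open_rel d L \<omega>)\<^sup>*}"

definition theta :: "nat \<Rightarrow> nat \<Rightarrow> (hvert set \<Rightarrow> real) \<Rightarrow> real" where
  "theta d L J = measure (perc_law d L J)
     {\<omega> \<in> space (perc_law d L J). infinite (cluster d L \<omega> horigin)}"

type_synonym kfamily = "real \<Rightarrow> hvert set \<Rightarrow> real"

definition kratio :: "kfamily \<Rightarrow> real \<Rightarrow> real \<Rightarrow> hvert set \<Rightarrow> ereal" where
  "kratio \<J> a b e = (if \<J> b e = 0 then (if \<J> a e = 0 then 0 else \<infinity>)
                      else ereal (\<J> a e / \<J> b e))"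

definition ratio_sup :: "nat \<Rightarrow> nat \<Rightarrow> kfamily \<Rightarrow> real \<Rightarrow> real \<Rightarrow> ereal" where
  "ratio_sup d L \<J> a b = (SUP e \<in> hedges d L. kratio \<J> a b e)"

definition fam_monotone :: "nat \<Rightarrow> nat \<Rightarrow> kfamily \<Rightarrow> bool" where
  "fam_monotone d L \<J> \<longleftrightarrow> (\<forall>e \<in> hedges d L. mono_on {0..} (\<lambda>t. \<J> t e))"

definition fam_continuous :: "nat \<Rightarrow> nat \<Rightarrow> kfamily \<Rightarrow> bool" where
  "fam_continuous d L \<J> \<longleftrightarrow> (\<forall>ls > 0.
      (\<forall>t > 0. \<bar>ratio_sup d L \<J> t ls\<bar> \<noteq> \<infinity> \<and> \<bar>ratio_sup d L \<J> ls t\<bar> \<noteq> \<infinity>)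
    \<and> continuous_on {0<..} (\<lambda>t. real_of_ereal (ratio_sup d L \<J> t ls))
    \<and> continuous_on {0<..} (\<lambda>t. real_of_ereal (ratio_sup d L \<J> ls t)))"

definition fam_nonperc0 :: "nat \<Rightarrow> nat \<Rightarrow> kfamily \<Rightarrow> bool" where
  "fam_nonperc0 d L \<J> \<longleftrightarrow> (\<exists>\<delta> > 0. \<forall>t. 0 \<le> t \<and> t < \<delta> \<longrightarrow>
      (\<Sum>\<^sub>\<infinity>e \<in> {e \<in> hedges d L. horigin \<in> e}. \<J> t e) < 1)"

definition proper_family :: "nat \<Rightarrow> nat \<Rightarrow> kfamily \<Rightarrow> bool" where
  "proper_family d L \<J> \<longleftrightarrow>
     (\<forall>t \<ge> 0. \<forall>e \<in> hedges d L. 0 \<le> \<J> t e)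
   \<and> fam_monotone d L \<J> \<and> fam_continuous d L \<J> \<and> fam_nonperc0 d L \<J>
   \<and> (\<forall>t > 0. isometry_invariant d L (\<J> t) \<and> kintegrable d L (\<J> t)
                \<and> kregular d L (\<J> t))"

text \<open>Critical value (in the extended reals; Inf of the empty set is infinity).\<close>
definition lambda_c :: "nat \<Rightarrow> nat \<Rightarrow> kfamily \<Rightarrow> ereal" where
  "lambda_c d L \<J> = Inf (ereal ` {t. 0 \<le> t \<and> theta d L (\<J> t) > 0})"

definition long_edges :: "nat \<Rightarrow> nat \<Rightarrow> hvert set filter" where
  "long_edges d L = filtercomap (elen L) at_top \<sqinter> principal (hedges d L)"

definition fam_ratio :: "nat \<Rightarrow> kfamily \<Rightarrow> (real \<Rightarrow> real) \<Rightarrow> real \<Rightarrow> hvert set \<Rightarrow> ereal" where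
  "fam_ratio L \<J> f t e = ereal (\<J> t e / f (real (elen L e)))"

definition fam_asymp :: "nat \<Rightarrow> nat \<Rightarrow> kfamily \<Rightarrow> (real \<Rightarrow> real) \<Rightarrow> bool" where
  "fam_asymp d L \<J> f \<longleftrightarrow> (\<forall>t > 0.
      0 < Liminf (long_edges d L) (fam_ratio L \<J> f t)
    \<and> Limsup (long_edges d L) (fam_ratio L \<J> f t) < \<infinity>)"

definition fam_small :: "nat \<Rightarrow> nat \<Rightarrow> kfamily \<Rightarrow> (real \<Rightarrow> real) \<Rightarrow> bool" where
  "fam_small d L \<J> f \<longleftrightarrow> (\<forall>t > 0. Limsup (long_edges d L) (fam_ratio L \<J> f t) = 0)"

definition fam_large :: "nat \<Rightarrow> nat \<Rightarrow> kfamily \<Rightarrow> (real \<Rightarrow> real) \<Rightarrow> bool" where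
  "fam_large d L \<J> f \<longleftrightarrow> (\<forall>t > 0. Liminf (long_edges d L) (fam_ratio L \<J> f t) = \<infinity>)"

definition crit_fun :: "nat \<Rightarrow> real \<Rightarrow> real" where
  "crit_fun d n = n powr (- 2 * real d) * ln (ln n)"

end

theory Submission
  imports Defs
begin

text \<open>A block of side \<open>L ^ n\<close> has \<open>q ^ n\<close> vertices, \<open>q = L ^ d\<close>, and for the critical kernel the expected
  number of edges leaving it is of order \<open>ln n\<close>; everything is decided by comparing events of
  probability \<open>n powr (- c)\<close> with a divergent or convergent sum over scales.

  If the kernel is at most \<open>C\<close> times critical and a vertex has a cluster of more than \<open>s\<close> vertices with
  probability at most \<open>\<delta>\<close>, consider the annuli between the blocks of scales \<open>k\<^sup>2\<close>. By Jensen's inequality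
  there is no open edge between large clusters of two consecutive annuli with probability at least
  \<open>k powr (- 8 * C * \<delta>\<^sup>2)\<close>. These events are independent along even \<open>k\<close>, so infinitely many of them occur when
  \<open>8 * C * \<delta>\<^sup>2 \<le> 1\<close>, and up to summable errors each of them confines the cluster of the origin. For small
  kernels this excludes percolation (\<open>s = 0\<close>, \<open>\<delta> = 1\<close>). For critical kernels it shows that the percolation
  probability cannot be small and positive; as the distribution of the cluster size is upper semicontinuous
  in the kernel, percolation at the critical point follows.

  For large kernels, percolation at a parameter is shown to survive a slight decrease of the kernel.
  Exploring the cluster of the origin in a block gives a mean-field inequality for \<open>\<theta>\<close>, which makes the
  random graph formed by the clusters of a block supercritical. Cluster sizes satisfy a van den
  Berg-Kesten type covariance bound, so unless a block contains a giant cluster of positive density the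
  number of vertices connected to a ghost concentrates, and this contradicts supercriticality. Once giant
  clusters appear with positive probability, they merge: the mean of the densities over \<open>q\<close> independent
  subblocks has its variance divided by \<open>q\<close>, and the probability that two giant clusters are not joined is
  summable over the scales. The start of this recursion only involves finitely many edges and is stable
  under small changes of the kernel.\<close>

section \<open>Finite Bernoulli percolation\<close>

text \<open>Two clusters of density \<open>a\<close> in blocks of scale \<open>n\<close> face each
  other across about \<open>a\<^sup>2 * q ^ (2 * n)\<close> pairs of vertices of weight
  \<open>K * ln n / q ^ (2 * n)\<close>, so they stay unjoined with probability about
  \<open>n powr (- a\<^sup>2 * K)\<close>. The density \<open>a\<close> comes from a qualitative
  argument and cannot be chosen; the recursion of giant clusters therefore asks for arbitrarily
  large \<open>K\<close>, that is, for a kernel much larger than critical. For a critical kernel the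
  constant is fixed and only the density is at disposal: the same exponent makes percolation of
  small density cut itself off, which forces the density to jump. On the large side the obstacle is
  that \<open>theta > 0\<close> says nothing direct about one block, since large clusters could
  arise only from connections through bigger blocks. The mean-field inequality and its strict
  concavity exclude this. Probabilities are finite weighted sums over the open edge sets of a block.
  Events of the infinite graph are reduced to them once, by two monotone limits, and continuity in
  the kernel becomes continuity of finite sums.\<close>

definition bexp :: "('e \<Rightarrow> real) \<Rightarrow> 'e set \<Rightarrow> ('e set \<Rightarrow> real) \<Rightarrow> real" where
  "bexp J E F = (\<Sum>A\<in>Pow E. (\<Prod>e\<in>E. if e \<in> A then 1 - exp (- J e) else exp (- J e)) * F A)"

lemma bexp_empty [simp]: "bexp J {} F = F {}"
  by (simp add: bexp_def)

lemma bexp_cong: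
  assumes "\<And>A. A \<subseteq> E \<Longrightarrow> F A = G A"
  shows "bexp J E F = bexp J E G"
  unfolding bexp_def by (rule sum.cong) (use assms in auto)

lemma bexp_cong_weight:
  assumes "\<And>e. e \<in> E \<Longrightarrow> J e = J' e" and "\<And>A. A \<subseteq> E \<Longrightarrow> F A = G A"
  shows "bexp J E F = bexp J' E G"
  unfolding bexp_def using assms by (intro sum.cong arg_cong2[where f="(*)"] prod.cong) auto

lemma bexp_insert:
  assumes "finite E" "e \<notin> E"
  shows "bexp J (insert e E) F
    = (1 - exp (- J e)) * bexp J E (\<lambda>A. F (insert e A)) + exp (- J e) * bexp J E F"
proof -
  let ?w = "\<lambda>E A. \<Prod>e\<in>E. if e \<in> A then 1 - exp (- J e) else exp (- J e)"
  have inj: "inj_on (insert e) (Pow E)"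
    using assms(2) by (auto simp: inj_on_def)
  have "Pow E \<inter> insert e ` Pow E = {}"
    using assms(2) by auto
  then have "bexp J (insert e E) F =
      (\<Sum>A\<in>Pow E. ?w (insert e E) A * F A) + (\<Sum>A\<in>Pow E. ?w (insert e E) (insert e A) * F (insert e A))"
    unfolding bexp_def Pow_insert using assms(1) inj
    by (subst sum.union_disjoint) (auto simp: sum.reindex)
  moreover have "?w (insert e E) A = exp (- J e) * ?w E A" if "A \<in> Pow E" for A
    using that assms by (subst prod.insert) auto
  moreover have "?w (insert e E) (insert e A) = (1 - exp (- J e)) * ?w E A" if "A \<in> Pow E" for A
  proof -
    have "(\<Prod>x\<in>E. if x \<in> insert e A then 1 - exp (- J x) else exp (- J x)) = ?w E A"
      using assms(2) by (intro prod.cong) auto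
    then show ?thesis using assms by (subst prod.insert) auto
  qed
  ultimately show ?thesis
    unfolding bexp_def by (simp add: sum_distrib_left mult_ac)
qed

lemma bexp_const [simp]: "finite E \<Longrightarrow> bexp J E (\<lambda>_. c) = c"
  by (induction E rule: finite_induct) (auto simp: bexp_insert algebra_simps)

lemma bexp_add: "bexp J E (\<lambda>A. F A + G A) = bexp J E F + bexp J E G"
  by (simp add: bexp_def algebra_simps sum.distrib)

lemma bexp_diff: "bexp J E (\<lambda>A. F A - G A) = bexp J E F - bexp J E G"
  by (simp add: bexp_def algebra_simps sum_subtractf)

lemma bexp_cmult: "bexp J E (\<lambda>A. c * F A) = c * bexp J E F"
  unfolding bexp_def sum_distrib_left by (intro sum.cong refl mult.left_commute)

lemma bexp_cmult_right: "bexp J E (\<lambda>A. F A * c) = bexp J E F * c"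
  using bexp_cmult[of J E c F] by (simp add: mult.commute)

lemma bexp_divide: "bexp J E (\<lambda>A. F A / c) = bexp J E F / c"
  by (simp add: bexp_def sum_divide_distrib)

lemma bexp_sum: "bexp J E (\<lambda>A. \<Sum>i\<in>I. F i A) = (\<Sum>i\<in>I. bexp J E (F i))"
  unfolding bexp_def sum_distrib_left by (rule sum.swap)

lemma bexp_mono:
  assumes "\<And>e. e \<in> E \<Longrightarrow> 0 \<le> J e" and "\<And>A. A \<subseteq> E \<Longrightarrow> F A \<le> G A"
  shows "bexp J E F \<le> bexp J E G"
  unfolding bexp_def using assms by (intro sum_mono mult_left_mono prod_nonneg) auto

lemma bexp_nonneg:
  assumes "\<And>e. e \<in> E \<Longrightarrow> 0 \<le> J e" and "\<And>A. A \<subseteq> E \<Longrightarrow> 0 \<le> F A"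
  shows "0 \<le> bexp J E F"
  unfolding bexp_def using assms by (intro sum_nonneg mult_nonneg_nonneg prod_nonneg) auto

lemma bexp_le_const:
  assumes "finite E" "\<And>e. e \<in> E \<Longrightarrow> 0 \<le> J e" and "\<And>A. A \<subseteq> E \<Longrightarrow> F A \<le> c"
  shows "bexp J E F \<le> c"
  using bexp_mono[of E J F "\<lambda>_. c"] assms by simp

lemma bexp_union:
  assumes "finite E" "finite E'" "E \<inter> E' = {}"
  shows "bexp J (E \<union> E') F = bexp J E (\<lambda>A. bexp J E' (\<lambda>B. F (A \<union> B)))"
  using assms
proof (induction E arbitrary: F rule: finite_induct)
  case (insert e E)
  then have "bexp J (insert e (E \<union> E')) F
      = (1 - exp (- J e)) * bexp J (E \<union> E') (\<lambda>A. F (insert e A)) + exp (- J e) * bexp J (E \<union> E') F"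
    by (intro bexp_insert) auto
  with insert show ?case by (simp add: bexp_insert)
qed simp

lemma bexp_local:
  assumes "finite E" "D \<subseteq> E" and "\<And>A. A \<subseteq> E \<Longrightarrow> F A = F (A \<inter> D)"
  shows "bexp J E F = bexp J D F"
proof -
  have fin: "finite D" "finite (E - D)" and E: "E = D \<union> (E - D)"
    using assms by (auto intro: finite_subset)
  have "bexp J E F = bexp J D (\<lambda>A. bexp J (E - D) (\<lambda>B. F (A \<union> B)))"
    using bexp_union[OF fin, of J F] E by auto
  also have "\<dots> = bexp J D (\<lambda>A. bexp J (E - D) (\<lambda>B. F A))"
  proof (intro bexp_cong)
    fix A B assume "A \<subseteq> D" "B \<subseteq> E - D"
    then have "A \<union> B \<subseteq> E" "(A \<union> B) \<inter> D = A" "A \<inter> D = A" "A \<subseteq> E" using assms(2) by auto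
    then show "F (A \<union> B) = F A" using assms(3)[of "A \<union> B"] by simp
  qed
  finally show ?thesis using fin by simp
qed

lemma bexp_indep:
  assumes "finite E" "D \<subseteq> E" "D' \<subseteq> E" "D \<inter> D' = {}"
    and F: "\<And>A. A \<subseteq> E \<Longrightarrow> F A = F (A \<inter> D)" and G: "\<And>A. A \<subseteq> E \<Longrightarrow> G A = G (A \<inter> D')"
  shows "bexp J E (\<lambda>A. F A * G A) = bexp J E F * bexp J E G"
proof -
  have fin: "finite D" "finite (E - D)" and E: "E = D \<union> (E - D)"
    using assms by (auto intro: finite_subset)
  have "bexp J E (\<lambda>A. F A * G A) = bexp J D (\<lambda>A. bexp J (E - D) (\<lambda>B. F (A \<union> B) * G (A \<union> B)))"
    using bexp_union[OF fin, of J "\<lambda>A. F A * G A"] E by auto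
  also have "\<dots> = bexp J D (\<lambda>A. bexp J (E - D) (\<lambda>B. F A * G B))"
  proof (intro bexp_cong)
    fix A B assume AB: "A \<subseteq> D" "B \<subseteq> E - D"
    then have "A \<union> B \<subseteq> E" "(A \<union> B) \<inter> D = A" "A \<inter> D = A" "A \<subseteq> E" "B \<subseteq> E"
      "(A \<union> B) \<inter> D' = B \<inter> D'" using assms(2-4) by auto
    then show "F (A \<union> B) * G (A \<union> B) = F A * G B"
      using F[of "A \<union> B"] G[of "A \<union> B"] G[of B] by simp
  qed
  also have "\<dots> = bexp J D F * bexp J (E - D) G"
    by (simp add: bexp_cmult bexp_cmult_right)
  also have "bexp J D F = bexp J E F"
    using bexp_local[OF assms(1,2)] F by metis
  also have "bexp J (E - D) G = bexp J E G"
  proof (rule bexp_local[symmetric])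
    show "G A = G (A \<inter> (E - D))" if "A \<subseteq> E" for A
    proof -
      have "A \<inter> (E - D) \<inter> D' = A \<inter> D'" using that assms(3,4) by auto
      moreover have "A \<inter> (E - D) \<subseteq> E" by auto
      ultimately show ?thesis using G[of "A \<inter> (E - D)"] G[of A] that by simp
    qed
  qed (use assms in auto)
  finally show ?thesis .
qed

lemma bexp_no_open:
  assumes "finite E" "C \<subseteq> E"
  shows "bexp J E (\<lambda>A. of_bool (A \<inter> C = {})) = exp (- (\<Sum>e\<in>C. J e))"
proof -
  have "finite C" using assms finite_subset by auto
  have "bexp J E (\<lambda>A. of_bool (A \<inter> C = {})) = bexp J C (\<lambda>A. of_bool (A \<inter> C = {}))"
    using assms by (intro bexp_local) (auto simp: Int_assoc)
  also have "\<dots> = exp (- (\<Sum>e\<in>C. J e))"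
  proof -
    have "bexp J C (\<lambda>A. of_bool (A \<inter> D = {})) = exp (- (\<Sum>e\<in>C. J e))" if "C \<subseteq> D" for D
      using \<open>finite C\<close> that
    proof (induction C rule: finite_induct)
      case (insert e C)
      have "bexp J C (\<lambda>A. of_bool (insert e A \<inter> D = {})) = bexp J C (\<lambda>A. 0)"
        using insert by (intro bexp_cong) auto
      with insert show ?case by (simp add: bexp_insert flip: exp_add)
    qed simp
    then show ?thesis by simp
  qed
  finally show ?thesis .
qed

text \<open>\<open>R\<close> is the part of the configuration already revealed and \<open>Z\<close>
  a set of edges computed from it. Given \<open>R\<close>, the edges of \<open>C\<close> are still
  independent, so the event that those in \<open>Z\<close> are closed may be replaced by its
  conditional probability. This is how fresh edges are integrated out below.\<close>

lemma bexp_no_open_cond: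
  assumes "finite R" "finite C" "R \<inter> C = {}"
  shows "bexp J (R \<union> C) (\<lambda>A. F (A \<inter> R) * of_bool (A \<inter> C \<inter> Z (A \<inter> R) = {}))
    = bexp J (R \<union> C) (\<lambda>A. F (A \<inter> R) * exp (- (\<Sum>e\<in>C \<inter> Z (A \<inter> R). J e)))"
proof -
  have "bexp J (R \<union> C) (\<lambda>A. F (A \<inter> R) * of_bool (A \<inter> C \<inter> Z (A \<inter> R) = {}))
      = bexp J R (\<lambda>A. bexp J C (\<lambda>B. F A * of_bool (B \<inter> (C \<inter> Z A) = {})))"
    unfolding bexp_union[OF assms]
  proof (intro bexp_cong)
    fix A B assume "A \<subseteq> R" "B \<subseteq> C"
    then have "(A \<union> B) \<inter> R = A" "(A \<union> B) \<inter> C \<inter> Z A = B \<inter> (C \<inter> Z A)" using assms(3) by auto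
    then show "F ((A \<union> B) \<inter> R) * of_bool ((A \<union> B) \<inter> C \<inter> Z ((A \<union> B) \<inter> R) = {}) =
         F A * of_bool (B \<inter> (C \<inter> Z A) = {})" by simp
  qed
  also have "\<dots> = bexp J R (\<lambda>A. F A * exp (- (\<Sum>e\<in>C \<inter> Z A. J e)))"
    using assms(2) by (simp add: bexp_cmult bexp_no_open)
  also have "\<dots> = bexp J R (\<lambda>A. F (A \<inter> R) * exp (- (\<Sum>e\<in>C \<inter> Z (A \<inter> R). J e)))"
    by (intro bexp_cong) (simp add: Int_absorb2)
  also have "\<dots> = bexp J (R \<union> C) (\<lambda>A. F (A \<inter> R) * exp (- (\<Sum>e\<in>C \<inter> Z (A \<inter> R). J e)))"
    using assms by (intro bexp_local[symmetric]) (auto simp: Int_assoc)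
  finally show ?thesis .
qed

lemma bexp_jensen_exp:
  assumes "finite E" "\<And>e. e \<in> E \<Longrightarrow> 0 \<le> J e"
  shows "exp (- bexp J E F) \<le> bexp J E (\<lambda>A. exp (- F A))"
proof -
  let ?m = "bexp J E F"
  \<comment> \<open>The tangent to \<open>exp (- x)\<close> at the mean lies below the curve and
    integrates to its value at the mean.\<close>
  have "exp (- ?m) = bexp J E (\<lambda>A. exp (- ?m) * (1 + ?m - F A))"
    using assms(1) by (simp add: bexp_cmult bexp_diff)
  also have "\<dots> \<le> bexp J E (\<lambda>A. exp (- F A))"
  proof (intro bexp_mono assms)
    fix A
    have "1 + ?m - F A \<le> exp (?m - F A)"
      using exp_ge_add_one_self[of "?m - F A"] by (simp add: algebra_simps)
    then have "exp (- ?m) * (1 + ?m - F A) \<le> exp (- ?m) * exp (?m - F A)"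
      by (intro mult_left_mono) auto
    also have "\<dots> = exp (- F A)" by (simp flip: exp_add)
    finally show "exp (- ?m) * (1 + ?m - F A) \<le> exp (- F A)" .
  qed
  finally show ?thesis .
qed

lemma bexp_open [simp]:
  assumes "finite E" "e \<in> E"
  shows "bexp J E (\<lambda>A. of_bool (e \<in> A)) = 1 - exp (- J e)"
proof -
  have "bexp J E (\<lambda>A. of_bool (e \<in> A)) = bexp J E (\<lambda>A. 1 - of_bool (A \<inter> {e} = {}))"
    by (intro bexp_cong) auto
  then show ?thesis using assms bexp_no_open[of E "{e}" J] by (simp add: bexp_diff)
qed

lemma bexp_open_le:
  assumes "finite E" "e \<in> E"
  shows "bexp J E (\<lambda>A. of_bool (e \<in> A)) \<le> J e"
  using assms exp_ge_add_one_self[of "- J e"] by simp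

text \<open>Induction over the edges takes the place of a monotone coupling: a larger weight shifts
  mass from the value with the edge closed to the value with it open, which is at least as large for
  increasing \<open>F\<close>.\<close>

lemma bexp_mono_weight:
  assumes "finite E" "\<And>e. e \<in> E \<Longrightarrow> 0 \<le> J e" "\<And>e. e \<in> E \<Longrightarrow> J e \<le> J' e"
    and "\<And>A B. A \<subseteq> B \<Longrightarrow> B \<subseteq> E \<Longrightarrow> F A \<le> F B"
  shows "bexp J E F \<le> bexp J' E F"
  using assms
proof (induction E arbitrary: F rule: finite_induct)
  case (insert e E)
  let ?a = "bexp J E (\<lambda>A. F (insert e A))" and ?b = "bexp J E F"
  have 1: "?a \<le> bexp J' E (\<lambda>A. F (insert e A))"
  proof (rule insert.IH)
    show "F (insert e A) \<le> F (insert e B)" if "A \<subseteq> B" "B \<subseteq> E" for A B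
      using that by (intro insert.prems(3)) auto
  qed (use insert.prems in auto)
  have 2: "?b \<le> bexp J' E F"
  proof (rule insert.IH)
    show "F A \<le> F B" if "A \<subseteq> B" "B \<subseteq> E" for A B
      using that by (intro insert.prems(3)) auto
  qed (use insert.prems in auto)
  have 3: "?b \<le> ?a"
    by (rule bexp_mono) (use insert.prems in \<open>auto intro!: insert.prems(3)\<close>)
  have 4: "exp (- J' e) \<le> exp (- J e)" "exp (- J' e) \<le> 1"
    using insert.prems(1)[of e] insert.prems(2)[of e] by auto
  have "(1 - exp (- J e)) * ?a + exp (- J e) * ?b \<le> (1 - exp (- J' e)) * ?a + exp (- J' e) * ?b"
    using mult_nonneg_nonneg[of "exp (- J e) - exp (- J' e)" "?a - ?b"] 3 4 by (simp add: algebra_simps)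
  also have "\<dots> \<le> (1 - exp (- J' e)) * bexp J' E (\<lambda>A. F (insert e A)) + exp (- J' e) * bexp J' E F"
    using 1 2 4 by (intro add_mono mult_left_mono) auto
  finally show ?case using insert.hyps by (simp add: bexp_insert)
qed simp

lemma bexp_image:
  assumes "inj_on f E"
  shows "bexp J (f ` E) F = bexp (J \<circ> f) E (\<lambda>A. F (f ` A))"
proof -
  have inj: "inj_on (image f) (Pow E)" using assms by (rule inj_on_image_Pow)
  have "bexp J (f ` E) F = (\<Sum>A\<in>Pow E. (\<Prod>e\<in>f ` E. if e \<in> f ` A then 1 - exp (- J e) else exp (- J e)) * F (f ` A))"
    unfolding bexp_def image_Pow_surj[OF refl, symmetric] by (simp add: sum.reindex[OF inj])
  also have "\<dots> = bexp (J \<circ> f) E (\<lambda>A. F (f ` A))"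
    unfolding bexp_def
    by (intro sum.cong refl arg_cong2[where f="(*)"])
      (use assms in \<open>auto simp: prod.reindex inj_on_image_mem_iff intro!: prod.cong\<close>)
  finally show ?thesis .
qed

lemma tendsto_bexp:
  assumes "finite E" "\<And>e. e \<in> E \<Longrightarrow> ((\<lambda>t. J t e) \<longlongrightarrow> J0 e) X"
  shows "((\<lambda>t. bexp (J t) E F) \<longlongrightarrow> bexp J0 E F) X"
  unfolding bexp_def
proof (intro tendsto_sum tendsto_mult tendsto_prod tendsto_const)
  fix A e assume "e \<in> E"
  then show "((\<lambda>t. if e \<in> A then 1 - exp (- J t e) else exp (- J t e)) \<longlongrightarrow>
          (if e \<in> A then 1 - exp (- J0 e) else exp (- J0 e))) X"
    using assms(2) by (cases "e \<in> A") (auto intro!: tendsto_intros)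
qed

lemma bexp_cauchy_schwarz:
  assumes "finite E" "\<And>e. e \<in> E \<Longrightarrow> 0 \<le> J e"
  shows "(bexp J E F)\<^sup>2 \<le> bexp J E (\<lambda>A. (F A)\<^sup>2)"
proof -
  let ?m = "bexp J E F"
  have "0 \<le> bexp J E (\<lambda>A. (F A - ?m)\<^sup>2)"
    using assms by (intro bexp_nonneg) auto
  also have "\<dots> = bexp J E (\<lambda>A. (F A)\<^sup>2 + ?m\<^sup>2 - 2 * ?m * F A)"
    by (intro bexp_cong) (simp add: power2_diff mult_ac)
  also have "\<dots> = bexp J E (\<lambda>A. (F A)\<^sup>2) - ?m\<^sup>2"
    using assms(1) by (simp add: bexp_diff bexp_add bexp_cmult power2_eq_square)
  finally show ?thesis by simp
qed

section \<open>Clusters in finite graphs\<close>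

definition edges :: "'v set \<Rightarrow> 'v set set" where
  "edges V = {{x, y} | x y. x \<in> V \<and> y \<in> V \<and> x \<noteq> y}"

definition adj :: "'v set set \<Rightarrow> 'v set \<Rightarrow> ('v \<times> 'v) set" where
  "adj A V = {(x, y). x \<in> V \<and> y \<in> V \<and> x \<noteq> y \<and> {x, y} \<in> A}"

definition cl :: "'v set set \<Rightarrow> 'v set \<Rightarrow> 'v \<Rightarrow> 'v set" where
  "cl A V x = {y. (x, y) \<in> (adj A V)\<^sup>*}"

definition touch :: "'v set \<Rightarrow> 'v set \<Rightarrow> 'v set set" where
  "touch V S = {e \<in> edges V. e \<inter> S \<noteq> {}}"

definition cut :: "'v set \<Rightarrow> 'v set \<Rightarrow> 'v set set" where
  "cut S T = {{x, y} | x y. x \<in> S \<and> y \<in> T}"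

lemma finite_edges [simp, intro]: "finite V \<Longrightarrow> finite (edges V)"
  by (rule finite_subset[of _ "Pow V"]) (auto simp: edges_def)

lemma edges_mono: "V \<subseteq> W \<Longrightarrow> edges V \<subseteq> edges W"
  unfolding edges_def by blast

lemma edges_iff [simp]: "{x, y} \<in> edges V \<longleftrightarrow> x \<in> V \<and> y \<in> V \<and> x \<noteq> y"
  by (auto simp: edges_def doubleton_eq_iff)

lemma cl_self [simp]: "x \<in> cl A V x"
  by (simp add: cl_def)

lemma sym_adj: "sym (adj A V)"
  by (auto simp: adj_def sym_def insert_commute)

lemma cl_sym: "y \<in> cl A V x \<longleftrightarrow> x \<in> cl A V y"
  using sym_adj[of A V] by (auto simp: cl_def dest: sym_rtrancl[THEN symD])

lemma cl_trans: "y \<in> cl A V x \<Longrightarrow> z \<in> cl A V y \<Longrightarrow> z \<in> cl A V x"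
  by (auto simp: cl_def)

lemma cl_eq: "y \<in> cl A V x \<Longrightarrow> cl A V y = cl A V x"
proof -
  assume y: "y \<in> cl A V x"
  then have x: "x \<in> cl A V y" by (simp add: cl_sym)
  show ?thesis using cl_trans[OF y] cl_trans[OF x] by (intro equalityI subsetI)
qed

lemma cl_step: "y \<in> cl A V x \<Longrightarrow> y \<in> V \<Longrightarrow> z \<in> V \<Longrightarrow> y \<noteq> z \<Longrightarrow> {y, z} \<in> A \<Longrightarrow> z \<in> cl A V x"
  unfolding cl_def by (auto simp: adj_def intro: rtrancl_into_rtrancl)

text \<open>Upper bounds on clusters are obtained by exhibiting an invariant set, up to the
  separating set in \<open>cl_confined\<close>.\<close>

lemma cl_closed:
  assumes "x \<in> U"
    and "\<And>u v. u \<in> U \<Longrightarrow> u \<in> V \<Longrightarrow> v \<in> V \<Longrightarrow> u \<noteq> v \<Longrightarrow> {u, v} \<in> A \<Longrightarrow> v \<in> U"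
  shows "cl A V x \<subseteq> U"
proof
  fix y assume "y \<in> cl A V x"
  then have "(x, y) \<in> (adj A V)\<^sup>*" by (simp add: cl_def)
  then show "y \<in> U"
    by induction (use assms in \<open>auto simp: adj_def\<close>)
qed

lemma cl_subset: "x \<in> V \<Longrightarrow> cl A V x \<subseteq> V"
  by (rule cl_closed)

lemma cl_outside: "x \<notin> V \<Longrightarrow> cl A V x = {x}"
  using cl_closed[of x "{x}" V A] by auto

lemma finite_cl [simp, intro]: "finite V \<Longrightarrow> finite (cl A V x)"
  by (cases "x \<in> V") (auto simp: cl_outside intro: finite_subset[OF cl_subset])

lemma cl_mono: "A \<inter> edges V \<subseteq> B \<Longrightarrow> V \<subseteq> W \<Longrightarrow> cl A V x \<subseteq> cl B W x"
proof -
  assume "A \<inter> edges V \<subseteq> B" "V \<subseteq> W"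
  then have "adj A V \<subseteq> adj B W" by (auto simp: adj_def)
  then show ?thesis using rtrancl_mono unfolding cl_def by blast
qed

lemma cl_cong: "A \<inter> edges V = B \<inter> edges V \<Longrightarrow> cl A V x = cl B V x"
  by (intro equalityI cl_mono) auto

lemma cl_local: "edges V \<subseteq> E \<Longrightarrow> cl (A \<inter> E) V x = cl A V x"
  by (rule cl_cong) auto

lemma cl_card_pos: "finite V \<Longrightarrow> 0 < card (cl A V x)"
  using cl_self[of x A V] by (metis card_gt_0_iff empty_iff finite_cl)

lemma cl_image:
  assumes "inj_on f V" "x \<in> V" "A \<subseteq> edges V"
  shows "cl (image f ` A) (f ` V) (f x) = f ` cl A V x"
proof
  have mem: "{u, v} \<in> A" if "u \<in> V" "v \<in> V" "{f u, f v} \<in> image f ` A" for u v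
  proof -
    from that(3) obtain e where e: "e \<in> A" "f ` e = f ` {u, v}" by auto
    moreover have "e \<subseteq> V" using e assms(3) by (auto simp: edges_def)
    ultimately have "e = {u, v}"
      using that(1,2) assms(1) by (metis empty_subsetI inj_on_image_eq_iff insert_subset)
    then show ?thesis using e by simp
  qed
  show "cl (image f ` A) (f ` V) (f x) \<subseteq> f ` cl A V x"
  proof (rule cl_closed)
    fix u v assume "u \<in> f ` cl A V x" "v \<in> f ` V" "u \<noteq> v" "{u, v} \<in> image f ` A"
    then obtain u' v' where *: "u = f u'" "v = f v'" "u' \<in> cl A V x" "v' \<in> V" by auto
    then have "u' \<in> V" using cl_subset[OF assms(2), of A] by auto
    then have "{u', v'} \<in> A"
      using *(1,2,4) \<open>{u, v} \<in> image f ` A\<close> by (intro mem) simp_all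
    then have "v' \<in> cl A V x"
      using cl_step[OF *(3) \<open>u' \<in> V\<close> *(4)] \<open>u \<noteq> v\<close> *(1,2) by fastforce
    then show "v \<in> f ` cl A V x" using * by simp
  qed simp
  have "cl A V x \<subseteq> {y. f y \<in> cl (image f ` A) (f ` V) (f x)}"
  proof (rule cl_closed; simp)
    fix u v assume *: "f u \<in> cl (image f ` A) (f ` V) (f x)" "u \<in> V" "v \<in> V" "u \<noteq> v" "{u, v} \<in> A"
    then have "f u \<noteq> f v" using assms(1) by (auto simp: inj_on_def)
    moreover have "f ` {u, v} \<in> image f ` A" using *(5) by (rule imageI)
    ultimately show "f v \<in> cl (image f ` A) (f ` V) (f x)"
      using cl_step[OF *(1), of "f v"] *(2,3) by simp
  qed
  then show "f ` cl A V x \<subseteq> cl (image f ` A) (f ` V) (f x)" by auto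
qed

lemma edges_image: "inj_on f V \<Longrightarrow> edges (f ` V) = image f ` edges V"
proof
  assume inj: "inj_on f V"
  show "edges (f ` V) \<subseteq> image f ` edges V"
  proof
    fix e assume "e \<in> edges (f ` V)"
    then obtain x y where "x \<in> V" "y \<in> V" "f x \<noteq> f y" "e = f ` {x, y}" by (auto simp: edges_def)
    then show "e \<in> image f ` edges V" by (intro image_eqI[of _ _ "{x, y}"]) auto
  qed
  show "image f ` edges V \<subseteq> edges (f ` V)"
    using inj by (auto simp: edges_def inj_on_def)
qed

lemma inj_on_image_edges: "inj_on f V \<Longrightarrow> inj_on (image f) (edges V)"
  by (rule inj_on_subset[OF inj_on_image_Pow]) (auto simp: edges_def)

lemma bexp_image_edges:
  assumes "inj_on f V"
  shows "bexp J (edges (f ` V)) F = bexp (\<lambda>e. J (f ` e)) (edges V) (\<lambda>A. F (image f ` A))"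
  using bexp_image[OF inj_on_image_edges[OF assms]] edges_image[OF assms] by (simp add: comp_def)

lemma card_cl_sum:
  "finite V \<Longrightarrow> x \<in> V \<Longrightarrow> real (card (cl A V x)) = (\<Sum>y\<in>V. of_bool (y \<in> cl A V x))"
  using cl_subset[of x V A] by (simp add: Int_absorb1)

text \<open>Exploring a cluster inspects only edges with an endpoint in it. The event that the
  cluster is \<open>S\<close> thus says nothing about the edges off \<open>S\<close>, which is the
  source of independence in all exploration arguments.\<close>

lemma cl_eq_iff_touch:
  assumes "x \<in> S"
  shows "cl A W x = S \<longleftrightarrow> cl (A \<inter> touch W S) W x = S"
proof
  assume S: "cl A W x = S"
  have "cl A W x \<subseteq> S \<inter> cl (A \<inter> touch W S) W x"
  proof (rule cl_closed)
    fix u v assume *: "u \<in> S \<inter> cl (A \<inter> touch W S) W x" "u \<in> W" "v \<in> W" "u \<noteq> v" "{u, v} \<in> A"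
    then have "v \<in> cl A W x" using S by - (rule cl_step[of u], auto)
    moreover have "v \<in> cl (A \<inter> touch W S) W x"
      using * by - (rule cl_step[of u], auto simp: touch_def)
    ultimately show "v \<in> S \<inter> cl (A \<inter> touch W S) W x" using S by simp
  qed (use assms in auto)
  moreover have "cl (A \<inter> touch W S) W x \<subseteq> cl A W x" by (rule cl_mono) auto
  ultimately show "cl (A \<inter> touch W S) W x = S" using S by auto
next
  assume S: "cl (A \<inter> touch W S) W x = S"
  have "cl A W x \<subseteq> S"
  proof (rule cl_closed)
    fix u v assume *: "u \<in> S" "u \<in> W" "v \<in> W" "u \<noteq> v" "{u, v} \<in> A"
    then have "v \<in> cl (A \<inter> touch W S) W x"
      using S by - (rule cl_step[of u], auto simp: touch_def)
    then show "v \<in> S" using S by simp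
  qed (use assms in auto)
  moreover have "cl (A \<inter> touch W S) W x \<subseteq> cl A W x" by (rule cl_mono) auto
  ultimately show "cl A W x = S" using S by auto
qed

text \<open>A path from \<open>x\<close> to \<open>g\<close> has a last vertex in \<open>S\<close>
  and runs in \<open>V - S\<close> from there on. The edge by which it leaves cannot end in
  \<open>W\<close>, as \<open>S\<close> is a full cluster of \<open>W\<close>.\<close>

lemma cl_off:
  assumes "x \<in> W" "W \<subseteq> V" "S = cl A W x" "g \<in> V - S"
  shows "g \<in> cl A V x \<longleftrightarrow> (\<exists>u\<in>S. \<exists>y\<in>V - W. {u, y} \<in> A \<and> g \<in> cl A (V - S) y)"
proof
  assume "\<exists>u\<in>S. \<exists>y\<in>V - W. {u, y} \<in> A \<and> g \<in> cl A (V - S) y"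
  then obtain u y where *: "u \<in> S" "y \<in> V - W" "{u, y} \<in> A" "g \<in> cl A (V - S) y" by auto
  have "S \<subseteq> W" using assms(3) cl_subset[OF assms(1), of A] by simp
  have "u \<in> cl A V x" using * assms cl_mono[of A W A V x] by auto
  then have "y \<in> cl A V x" using * \<open>S \<subseteq> W\<close> assms by - (rule cl_step[of u], auto)
  moreover have "g \<in> cl A V y" using *(4) cl_mono[of A "V - S" A V y] by auto
  ultimately show "g \<in> cl A V x" by (rule cl_trans)
next
  assume g: "g \<in> cl A V x"
  let ?U = "S \<union> {z. \<exists>u\<in>S. \<exists>y\<in>V - W. {u, y} \<in> A \<and> z \<in> cl A (V - S) y}"
  have SW: "S \<subseteq> W" using assms(3) cl_subset[OF assms(1), of A] by simp
  have "cl A V x \<subseteq> ?U"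
  proof (rule cl_closed)
    fix u v assume *: "u \<in> ?U" "u \<in> V" "v \<in> V" "u \<noteq> v" "{u, v} \<in> A"
    show "v \<in> ?U"
    proof (cases "v \<in> S")
      case v: False
      show ?thesis
      proof (cases "u \<in> S")
        case True
        have "v \<notin> W"
        proof
          assume "v \<in> W"
          then have "v \<in> cl A W x" using * True SW assms(3) by - (rule cl_step[of u], auto)
          then show False using v assms(3) by simp
        qed
        moreover have "v \<in> cl A (V - S) v" by simp
        ultimately show ?thesis using * True by blast
      next
        case False
        then obtain s y where sy: "s \<in> S" "y \<in> V - W" "{s, y} \<in> A" "u \<in> cl A (V - S) y" using * by auto
        then have "v \<in> cl A (V - S) y" using * v False by - (rule cl_step[of u], auto)
        then show ?thesis using sy by auto
      qed
    qed auto
  qed (use assms in auto)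
  then show "\<exists>u\<in>S. \<exists>y\<in>V - W. {u, y} \<in> A \<and> g \<in> cl A (V - S) y" using g assms(4) by auto
qed

text \<open>The three groups in the order of exploration: \<open>touch W S\<close> decides that the
  cluster is \<open>S\<close>, \<open>edges (V - S)\<close> decides what is connected off
  \<open>S\<close>, and \<open>cut S (V - W)\<close> is still fresh after both.\<close>

lemma edges_split:
  assumes "S \<subseteq> W" "W \<subseteq> V"
  shows "edges V = (touch W S \<union> edges (V - S)) \<union> cut S (V - W)"
    and "(touch W S \<union> edges (V - S)) \<inter> cut S (V - W) = {}"
    and "touch W S \<inter> edges (V - S) = {}"
proof -
  show "edges V = (touch W S \<union> edges (V - S)) \<union> cut S (V - W)"
  proof (intro equalityI subsetI)
    fix e assume "e \<in> edges V"
    then obtain x y where e: "e = {x, y}" "x \<in> V" "y \<in> V" "x \<noteq> y" by (auto simp: edges_def)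
    consider "x \<notin> S" "y \<notin> S" | "x \<in> W" "y \<in> W" "x \<in> S \<or> y \<in> S" | "x \<in> S" "y \<notin> W" | "y \<in> S" "x \<notin> W"
      using assms by auto
    then show "e \<in> (touch W S \<union> edges (V - S)) \<union> cut S (V - W)"
    proof cases
      case 3
      then have "e \<in> cut S (V - W)" using e unfolding cut_def by blast
      then show ?thesis by simp
    next
      case 4
      then have "e \<in> cut S (V - W)" using e insert_commute[of x y "{}"] unfolding cut_def by blast
      then show ?thesis by simp
    qed (use e in \<open>auto simp: touch_def\<close>)
  next
    fix e assume "e \<in> (touch W S \<union> edges (V - S)) \<union> cut S (V - W)"
    moreover have "cut S (V - W) \<subseteq> edges V" using assms unfolding cut_def edges_def by blast
    ultimately show "e \<in> edges V" using assms edges_mono[of W V] edges_mono[of "V - S" V]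
      by (auto simp: touch_def)
  qed
  show "(touch W S \<union> edges (V - S)) \<inter> cut S (V - W) = {}"
    using assms by (auto simp: touch_def cut_def)
  show "touch W S \<inter> edges (V - S) = {}"
    by (auto simp: touch_def edges_def)
qed

lemma touch_edges_disjoint: "touch V S \<inter> edges (V - S) = {}" "touch V S \<subseteq> edges V" 
  by (auto simp: touch_def edges_def)

lemma finite_touch [simp, intro]: "finite V \<Longrightarrow> finite (touch V S)"
  by (rule finite_subset[OF touch_edges_disjoint(2)]) auto

lemma finite_cut [simp, intro]: "finite S \<Longrightarrow> finite T \<Longrightarrow> finite (cut S T)"
proof -
  have "cut S T = (\<lambda>(x, y). {x, y}) ` (S \<times> T)" by (auto simp: cut_def)
  then show "finite S \<Longrightarrow> finite T \<Longrightarrow> finite (cut S T)" by simp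
qed

lemma sum_cut:
  assumes "finite S" "finite T" "S \<inter> T = {}"
  shows "(\<Sum>e\<in>cut S T. f e) = (\<Sum>x\<in>S. \<Sum>y\<in>T. f {x, y})"
proof -
  have eq: "cut S T = (\<lambda>(x, y). {x, y}) ` (S \<times> T)" by (auto simp: cut_def)
  have inj: "inj_on (\<lambda>(x, y). {x, y}) (S \<times> T)"
    using assms(3) by (auto simp: inj_on_def doubleton_eq_iff)
  show ?thesis
    unfolding eq sum.reindex[OF inj] using assms by (simp add: sum.cartesian_product comp_def case_prod_unfold)
qed

section \<open>Exploration of a cluster and its connection to an external vertex\<close>

lemma bexp_cl_split:
  assumes "finite W" "x \<in> W"
  shows "bexp J E F = (\<Sum>S\<in>Pow W. bexp J E (\<lambda>A. of_bool (cl A W x = S) * F A))"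
proof -
  have "F A = (\<Sum>S\<in>Pow W. of_bool (cl A W x = S) * F A)" for A
  proof -
    have "(\<Sum>S\<in>Pow W. of_bool (cl A W x = S) * F A) = (\<Sum>S\<in>Pow W. if cl A W x = S then F A else 0)"
      by (intro sum.cong) auto
    then show ?thesis using cl_subset[OF assms(2), of A] assms(1) by simp
  qed
  then show ?thesis by (subst bexp_sum[symmetric]) auto
qed

text \<open>Reveal the cluster of \<open>x\<close> in \<open>W\<close>, then the cluster of
  \<open>g\<close> off it. The edges from the former to \<open>V - W\<close> are fresh, and
  \<open>x\<close> is disconnected from \<open>g\<close> exactly if no open one among them ends in
  the latter.\<close>

lemma bexp_disconnect:
  assumes V: "finite V" "W \<subseteq> V" and x: "x \<in> W" and g: "g \<in> V - W"
  shows "bexp J (edges V) (\<lambda>A. of_bool (g \<notin> cl A V x)) = bexp J (edges V) (\<lambda>A.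
    exp (- (\<Sum>u\<in>cl A W x. \<Sum>y\<in>(V - W) \<inter> cl A (V - cl A W x) g. J {u, y})))"
proof -
  have W: "finite W" using V finite_subset by auto
  let ?F = "\<lambda>A. of_bool (g \<notin> cl A V x) :: real"
  let ?G = "\<lambda>A. exp (- (\<Sum>u\<in>cl A W x. \<Sum>y\<in>(V - W) \<inter> cl A (V - cl A W x) g. J {u, y}))"
  have "bexp J (edges V) (\<lambda>A. of_bool (cl A W x = S) * ?F A)
      = bexp J (edges V) (\<lambda>A. of_bool (cl A W x = S) * ?G A)" if "S \<in> Pow W" for S
  proof (cases "x \<in> S")
    case False
    then have "cl A W x \<noteq> S" for A using cl_self[of x A W] by auto
    then show ?thesis by simp
  next
    case xS: True
    have S: "S \<subseteq> W" "finite S" using that W finite_subset by auto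
    define R where "R = touch W S \<union> edges (V - S)"
    define C where "C = cut S (V - W)"
    define Z where "Z = (\<lambda>A. cut S ((V - W) \<inter> cl A (V - S) g))"
    have E: "edges V = R \<union> C" and RC: "R \<inter> C = {}"
      unfolding R_def C_def using edges_split(1,2)[OF S(1) V(2)] by auto
    have fin: "finite R" "finite C" unfolding R_def C_def using V W S by auto
    have F: "cl (A \<inter> R) W x = S \<longleftrightarrow> cl A W x = S" for A
    proof -
      have "A \<inter> R \<inter> touch W S = A \<inter> touch W S" unfolding R_def by auto
      then show ?thesis
        using cl_eq_iff_touch[OF xS, of A W] cl_eq_iff_touch[OF xS, of "A \<inter> R" W] by simp
    qed
    have Z: "Z (A \<inter> R) = Z A" for A
      unfolding Z_def R_def by (subst cl_local) auto
    have CZ: "C \<inter> Z A = Z A" for A unfolding C_def Z_def cut_def by auto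
    have 1: "of_bool (cl A W x = S) * ?F A
        = of_bool (cl (A \<inter> R) W x = S) * of_bool (A \<inter> C \<inter> Z (A \<inter> R) = {})" for A
    proof (cases "cl A W x = S")
      case True
      have "g \<in> cl A V x \<longleftrightarrow> (\<exists>u\<in>S. \<exists>y\<in>V - W. {u, y} \<in> A \<and> g \<in> cl A (V - S) y)"
        using True x V(2) g S by (intro cl_off[of x W]) auto
      also have "\<dots> \<longleftrightarrow> A \<inter> Z A \<noteq> {}"
        unfolding Z_def cut_def cl_sym[of g] by blast
      finally show ?thesis using True by (simp add: F Z CZ Int_assoc)
    qed (simp add: F)
    have "bexp J (edges V) (\<lambda>A. of_bool (cl A W x = S) * ?F A)
      = bexp J (edges V) (\<lambda>A. of_bool (cl (A \<inter> R) W x = S) * exp (- (\<Sum>e\<in>C \<inter> Z (A \<inter> R). J e)))"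
      unfolding 1 E by (rule bexp_no_open_cond[OF fin RC])
    also have "\<dots> = bexp J (edges V) (\<lambda>A. of_bool (cl A W x = S) * ?G A)"
    proof (intro bexp_cong)
      fix A
      have "(\<Sum>e\<in>Z A. J e) = (\<Sum>u\<in>S. \<Sum>y\<in>(V - W) \<inter> cl A (V - S) g. J {u, y})"
        unfolding Z_def using V S by (intro sum_cut) auto
      then show "of_bool (cl (A \<inter> R) W x = S) * exp (- (\<Sum>e\<in>C \<inter> Z (A \<inter> R). J e))
        = of_bool (cl A W x = S) * ?G A"
        by (cases "cl A W x = S") (simp_all add: F Z CZ)
    qed
    finally show ?thesis .
  qed
  then show ?thesis
    by (simp add: bexp_cl_split[OF W x, of J _ ?F] bexp_cl_split[OF W x, of J _ ?G])
qed

lemma bexp_explore: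
  assumes "finite V" "W \<subseteq> V" "x \<in> S" "S \<subseteq> W" and F: "\<And>A. F A = F (A \<inter> edges (V - S))"
  shows "bexp J (edges V) (\<lambda>A. of_bool (cl A W x = S) * F A)
    = bexp J (edges V) (\<lambda>A. of_bool (cl A W x = S)) * bexp J (edges V) F"
proof (rule bexp_indep)
  show "touch W S \<inter> edges (V - S) = {}" "touch W S \<subseteq> edges V" "edges (V - S) \<subseteq> edges V"
    using edges_split[OF assms(4,2)] by auto
qed (use assms cl_eq_iff_touch[OF assms(3)] in auto)

text \<open>Jensen's inequality moves the average over the cluster of \<open>g\<close> into the
  exponent, and deleting the explored set only lowers connection probabilities. The outcome is a
  mean-field inequality in which every endpoint \<open>y\<close> counts with a bound on its
  unconditional connection probability.\<close>

lemma bexp_disconnect_ge: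
  assumes V: "finite V" "W \<subseteq> V" and x: "x \<in> W" and g: "g \<in> V - W"
    and J: "\<And>e. e \<in> edges V \<Longrightarrow> 0 \<le> J e"
    and p: "\<And>y. y \<in> V - W \<Longrightarrow> bexp J (edges V) (\<lambda>A. of_bool (g \<in> cl A V y)) \<le> p y"
  shows "bexp J (edges V) (\<lambda>A. exp (- (\<Sum>u\<in>cl A W x. \<Sum>y\<in>V - W. J {u, y} * p y)))
    \<le> bexp J (edges V) (\<lambda>A. of_bool (g \<notin> cl A V x))"
proof -
  have W: "finite W" using V finite_subset by auto
  let ?F = "\<lambda>S A. \<Sum>u\<in>S. \<Sum>y\<in>(V - W) \<inter> cl A (V - S) g. J {u, y}"
  let ?c = "\<lambda>S. \<Sum>u\<in>S. \<Sum>y\<in>V - W. J {u, y} * p y"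
  have "bexp J (edges V) (\<lambda>A. of_bool (cl A W x = S) * exp (- ?c (cl A W x)))
      \<le> bexp J (edges V) (\<lambda>A. of_bool (cl A W x = S) * exp (- ?F (cl A W x) A))" if "S \<in> Pow W" for S
  proof (cases "x \<in> S")
    case False
    then have "cl A W x \<noteq> S" for A using cl_self[of x A W] by auto
    then show ?thesis by simp
  next
    case xS: True
    have S: "S \<subseteq> W" "finite S" using that W finite_subset by auto
    have J': "0 \<le> J {u, y}" if "u \<in> S" "y \<in> V - W" for u y
      using that S V by (intro J) auto
    have Feq: "?F S A = (\<Sum>u\<in>S. \<Sum>y\<in>V - W. J {u, y} * of_bool (g \<in> cl A (V - S) y))" for A
      using V by (intro sum.cong refl sum.mono_neutral_cong_left) (auto simp: cl_sym[of g])
    have "bexp J (edges V) (?F S) \<le> ?c S"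
      unfolding Feq bexp_sum bexp_cmult
    proof (intro sum_mono mult_left_mono J')
      fix y assume y: "y \<in> V - W"
      have "bexp J (edges V) (\<lambda>A. of_bool (g \<in> cl A (V - S) y)) \<le> bexp J (edges V) (\<lambda>A. of_bool (g \<in> cl A V y))"
        using J cl_mono[of A "V - S" A V y for A] by (intro bexp_mono) auto
      then show "bexp J (edges V) (\<lambda>A. of_bool (g \<in> cl A (V - S) y)) \<le> p y"
        using p[OF y] by simp
    qed
    then have le: "exp (- ?c S) \<le> bexp J (edges V) (\<lambda>A. exp (- ?F S A))"
      using bexp_jensen_exp[of "edges V" J "?F S"] V J by (smt (verit) exp_le_cancel_iff finite_edges)
    have "bexp J (edges V) (\<lambda>A. of_bool (cl A W x = S) * exp (- ?c (cl A W x)))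
      = bexp J (edges V) (\<lambda>A. of_bool (cl A W x = S) * exp (- ?c S))"
      by (intro bexp_cong) auto
    also have "\<dots> = bexp J (edges V) (\<lambda>A. of_bool (cl A W x = S)) * exp (- ?c S)"
      by (rule bexp_cmult_right)
    also have "\<dots> \<le> bexp J (edges V) (\<lambda>A. of_bool (cl A W x = S)) * bexp J (edges V) (\<lambda>A. exp (- ?F S A))"
      using J by (intro mult_left_mono le bexp_nonneg) auto
    also have "\<dots> = bexp J (edges V) (\<lambda>A. of_bool (cl A W x = S) * exp (- ?F S A))"
      using V xS S by (intro bexp_explore[symmetric]) (auto simp: cl_local)
    also have "\<dots> = bexp J (edges V) (\<lambda>A. of_bool (cl A W x = S) * exp (- ?F (cl A W x) A))"
      by (intro bexp_cong) auto
    finally show ?thesis .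
  qed
  then have "(\<Sum>S\<in>Pow W. bexp J (edges V) (\<lambda>A. of_bool (cl A W x = S) * exp (- ?c (cl A W x))))
    \<le> (\<Sum>S\<in>Pow W. bexp J (edges V) (\<lambda>A. of_bool (cl A W x = S) * exp (- ?F (cl A W x) A)))"
    by (rule sum_mono)
  then show ?thesis
    unfolding bexp_disconnect[OF V x g] by (simp add: bexp_cl_split[OF W x, symmetric])
qed

text \<open>With \<open>W = B\<close> the only fresh edges lead to \<open>g\<close>, so the
  connection to \<open>g\<close> reads off the Laplace transform of the cluster size.\<close>

lemma bexp_ghost:
  assumes "finite B" "g \<notin> B" "x \<in> B" and h: "\<And>u. u \<in> B \<Longrightarrow> J {u, g} = h"
  shows "bexp J (edges (insert g B)) (\<lambda>A. of_bool (g \<notin> cl A (insert g B) x))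
    = bexp J (edges B) (\<lambda>A. exp (- h * card (cl A B x)))"
proof -
  have "bexp J (edges (insert g B)) (\<lambda>A. of_bool (g \<notin> cl A (insert g B) x))
    = bexp J (edges (insert g B)) (\<lambda>A. exp (- h * card (cl A B x)))"
  proof (subst bexp_disconnect[where W=B], goal_cases)
    case 5
    have "(insert g B - B) \<inter> cl A (insert g B - cl A B x) g = {g}" for A
      using assms(2) by auto
    moreover have "(\<Sum>u\<in>cl A B x. J {u, g}) = h * card (cl A B x)" for A
      using h cl_subset[OF assms(3), of A] by (subst sum.cong[OF refl, of _ _ "\<lambda>_. h"]) auto
    ultimately show ?case by simp
  qed (use assms in auto)
  also have "\<dots> = bexp J (edges B) (\<lambda>A. exp (- h * card (cl A B x)))"
    using assms by (intro bexp_local) (auto simp: cl_local edges_mono subset_insertI)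
  finally show ?thesis .
qed

text \<open>The connection of \<open>y\<close> to \<open>g\<close> may be taken inside the cluster
  of \<open>y\<close> in \<open>B\<close>, followed by one edge to \<open>g\<close>; that cluster is
  disjoint from the cluster of \<open>x\<close>.\<close>

lemma cl_ghost_off:
  assumes "x \<in> B" "y \<in> B" "g \<notin> B" "g \<in> cl A (insert g B) y" "y \<notin> cl A B x"
  shows "g \<in> cl A (insert g B - cl A B x) y"
proof -
  let ?S = "cl A B y"
  have "cl A B x \<inter> ?S = {}"
    using assms(5) cl_eq cl_self by (metis disjoint_iff)
  have S: "?S \<subseteq> B" using cl_subset[OF assms(2)] .
  have "\<exists>u\<in>?S. \<exists>z\<in>insert g B - B. {u, z} \<in> A \<and> g \<in> cl A (insert g B - ?S) z"
    using assms S by (subst cl_off[symmetric, of y B]) auto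
  then obtain u where u: "u \<in> ?S" "{u, g} \<in> A" using assms(3) by auto
  have sub: "cl A B y \<subseteq> cl A (B - cl A B x) y"
  proof -
    have "cl A B y \<subseteq> cl A B y \<inter> cl A (B - cl A B x) y"
    proof (rule cl_closed, goal_cases)
      case (2 u v)
      have v: "v \<in> cl A B y" using 2 cl_step[of u A B y v] by auto
      have "u \<notin> cl A B x" "v \<notin> cl A B x"
        using 2 v \<open>cl A B x \<inter> ?S = {}\<close> by auto
      then show ?case using v 2 cl_step[of u A "B - cl A B x" y v] by auto
    qed auto
    then show ?thesis by auto
  qed
  then have "u \<in> cl A (insert g B - cl A B x) y"
    using u(1) cl_mono[of A "B - cl A B x" A "insert g B - cl A B x" y] by auto
  moreover have "u \<notin> cl A B x" "u \<in> B" "u \<noteq> g" "g \<notin> cl A B x"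
    using u S \<open>cl A B x \<inter> ?S = {}\<close> assms(3) cl_subset[OF assms(1), of A] by auto
  ultimately show ?thesis
    using u(2) by - (rule cl_step[of u], auto)
qed

text \<open>If \<open>x\<close> and \<open>y\<close> lie in different clusters of \<open>B\<close>,
  their connections to \<open>g\<close> use disjoint edges: those touching the cluster of
  \<open>x\<close> and those off it. Given that cluster the two events are independent, and the
  restriction to the remaining vertices only lowers the probability of the second.\<close>

lemma bexp_ghost_cov:
  assumes B: "finite B" "g \<notin> B" "x \<in> B" "y \<in> B" and V: "V = insert g B"
    and J: "\<And>e. e \<in> edges V \<Longrightarrow> 0 \<le> J e"
  shows "bexp J (edges V) (\<lambda>A. of_bool (g \<in> cl A V x) * of_bool (g \<in> cl A V y))
    \<le> bexp J (edges V) (\<lambda>A. of_bool (y \<in> cl A B x))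
      + bexp J (edges V) (\<lambda>A. of_bool (g \<in> cl A V x)) * bexp J (edges V) (\<lambda>A. of_bool (g \<in> cl A V y))"
proof -
  have fV: "finite V" "B \<subseteq> V" using B V by auto
  let ?Q = "bexp J (edges V) (\<lambda>A. of_bool (g \<in> cl A V y))"
  let ?H = "\<lambda>S A. of_bool (y \<notin> S \<and> g \<in> cl A (V - S) y) :: real"
  have "bexp J (edges V) (\<lambda>A. of_bool (g \<in> cl A V x) * of_bool (g \<in> cl A V y))
    \<le> bexp J (edges V) (\<lambda>A. of_bool (y \<in> cl A B x) + of_bool (g \<in> cl A V x) * ?H (cl A B x) A)"
    using cl_ghost_off[OF B(3,4,2)] V J by (intro bexp_mono) auto
  also have "\<dots> = bexp J (edges V) (\<lambda>A. of_bool (y \<in> cl A B x))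
      + bexp J (edges V) (\<lambda>A. of_bool (g \<in> cl A V x) * ?H (cl A B x) A)"
    by (rule bexp_add)
  also have "bexp J (edges V) (\<lambda>A. of_bool (g \<in> cl A V x) * ?H (cl A B x) A)
    \<le> bexp J (edges V) (\<lambda>A. of_bool (g \<in> cl A V x)) * ?Q"
    unfolding bexp_cl_split[OF B(1,3), of J _ "\<lambda>A. of_bool (g \<in> cl A V x) * ?H (cl A B x) A"]
      bexp_cl_split[OF B(1,3), of J _ "\<lambda>A. of_bool (g \<in> cl A V x)"] sum_distrib_right
  proof (rule sum_mono)
    fix S assume "S \<in> Pow B"
    show "bexp J (edges V) (\<lambda>A. of_bool (cl A B x = S) * (of_bool (g \<in> cl A V x) * ?H (cl A B x) A))
      \<le> bexp J (edges V) (\<lambda>A. of_bool (cl A B x = S) * of_bool (g \<in> cl A V x)) * ?Q"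
    proof (cases "x \<in> S")
      case False
      then have "cl A B x \<noteq> S" for A using cl_self[of x A B] by auto
      then show ?thesis using fV by simp
    next
      case xS: True
      have S: "S \<subseteq> B" "finite S" using \<open>S \<in> Pow B\<close> B finite_subset by auto
      let ?F = "\<lambda>A. of_bool (cl A B x = S) * of_bool (\<exists>u\<in>S. {u, g} \<in> A) :: real"
      have F: "of_bool (cl A B x = S) * of_bool (g \<in> cl A V x) = ?F A" for A
      proof (cases "cl A B x = S")
        case True
        have "g \<in> cl A V x \<longleftrightarrow> (\<exists>u\<in>S. \<exists>z\<in>V - B. {u, z} \<in> A \<and> g \<in> cl A (V - S) z)"
          using True B V S by (intro cl_off[of x B]) auto
        also have "\<dots> \<longleftrightarrow> (\<exists>u\<in>S. {u, g} \<in> A)"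
        proof -
          have "V - B = {g}" using B V by auto
          then show ?thesis by simp
        qed
        finally show ?thesis using True by simp
      qed simp
      have "bexp J (edges V) (\<lambda>A. of_bool (cl A B x = S) * (of_bool (g \<in> cl A V x) * ?H (cl A B x) A))
        = bexp J (edges V) (\<lambda>A. ?F A * ?H S A)"
        unfolding F[symmetric] by (intro bexp_cong) auto
      also have "\<dots> = bexp J (edges V) ?F * bexp J (edges V) (?H S)"
      proof (rule bexp_indep)
        show "?F A = ?F (A \<inter> touch V S)" for A
        proof -
          have "A \<inter> touch V S \<inter> touch B S = A \<inter> touch B S"
            unfolding touch_def using edges_mono[OF fV(2)] by auto
          then have "cl A B x = S \<longleftrightarrow> cl (A \<inter> touch V S) B x = S"
            using cl_eq_iff_touch[OF xS] by metis
          moreover have "{u, g} \<in> touch V S" if "u \<in> S" for u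
            using that S B V by (auto simp: touch_def)
          ultimately show ?thesis by auto
        qed
        show "?H S A = ?H S (A \<inter> edges (V - S))" for A by (simp add: cl_local)
      qed (use fV touch_edges_disjoint[of V S] edges_mono[of "V - S" V] in auto)
      also have "\<dots> \<le> bexp J (edges V) ?F * ?Q"
      proof (intro mult_left_mono bexp_nonneg bexp_mono J)
        show "?H S A \<le> of_bool (g \<in> cl A V y)" for A
          using cl_mono[of A "V - S" A V y] by auto
      qed auto
      finally show ?thesis unfolding F .
    qed
  qed
  finally show ?thesis by simp
qed

text \<open>The vertices connected to \<open>g\<close> off the cluster \<open>C\<close> of \<open>x\<close> in \<open>W\<close> comprise all
  vertices connected to \<open>g\<close> except those in the cluster of \<open>x\<close> in \<open>B\<close>; their weighted number
  concentrates by the second moment bound, and \<open>x\<close> is connected to \<open>g\<close> as soon as \<open>C\<close> has an open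
  edge to one of them.\<close>
lemma bexp_gelation:
  assumes B: "finite B" "g \<notin> B" and W: "W \<subseteq> B" "x \<in> W" and V: "V = insert g B"
    and J: "\<And>e. e \<in> edges V \<Longrightarrow> 0 \<le> J e"
    and a: "\<And>u y. u \<in> W \<Longrightarrow> y \<in> B - W \<Longrightarrow> J {u, y} = a y" "\<And>y. y \<in> B - W \<Longrightarrow> 0 \<le> a y \<and> a y \<le> b"
    and p: "\<And>y. y \<in> B \<Longrightarrow> bexp J (edges V) (\<lambda>A. of_bool (g \<in> cl A V y)) = p"
    and T: "T = (\<Sum>y\<in>B - W. a y)" and "0 \<le> b" "0 < \<delta>"
  shows "bexp J (edges W) (\<lambda>A. 1 - exp (- (T * p - 2 * \<delta>) * card (cl A W x)))
    \<le> p + b\<^sup>2 * (\<Sum>y\<in>B. bexp J (edges B) (\<lambda>A. card (cl A B y))) / \<delta>\<^sup>2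
        + b * bexp J (edges B) (\<lambda>A. card (cl A B x)) / \<delta>"
proof -
  have fin: "finite V" "B \<subseteq> V" "W \<subseteq> V" "finite W" "x \<in> B" "g \<in> V - W"
    using B W V finite_subset by auto
  let ?E = "bexp J (edges V)"
  define X where "X = (\<Sum>y\<in>B. bexp J (edges B) (\<lambda>A. card (cl A B y)))"
  define Y where "Y = (\<lambda>A. \<Sum>y\<in>B - W. a y * of_bool (g \<in> cl A V y))"
  define N where "N = (\<lambda>A. b * card (cl A B x))"
  define Z where "Z = (\<lambda>A. \<Sum>u\<in>cl A W x. \<Sum>y\<in>(V - W) \<inter> cl A (V - cl A W x) g. J {u, y})"
  have EB: "?E (\<lambda>A. f (cl A B y)) = bexp J (edges B) (\<lambda>A. f (cl A B y))" for f y
    using fin by (intro bexp_local) (auto simp: cl_local edges_mono)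
  have EW: "?E (\<lambda>A. f (cl A W y)) = bexp J (edges W) (\<lambda>A. f (cl A W y))" for f y
    using fin by (intro bexp_local) (auto simp: cl_local edges_mono)
  have EY: "?E Y = T * p"
  proof -
    have "?E Y = (\<Sum>y\<in>B - W. a y * p)"
      unfolding Y_def bexp_sum bexp_cmult using p by (intro sum.cong) auto
    then show ?thesis by (simp add: T sum_distrib_right)
  qed
  have EY2: "?E (\<lambda>A. (Y A)\<^sup>2) \<le> b\<^sup>2 * X + (T * p)\<^sup>2"
  proof -
    have "?E (\<lambda>A. (Y A)\<^sup>2) = ?E (\<lambda>A. \<Sum>y\<in>B - W. \<Sum>z\<in>B - W. (a y * a z) *
        (of_bool (g \<in> cl A V y) * of_bool (g \<in> cl A V z)))"
      unfolding Y_def power2_eq_square sum_product by (simp add: mult_ac)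
    also have "\<dots> = (\<Sum>y\<in>B - W. \<Sum>z\<in>B - W. (a y * a z) *
        ?E (\<lambda>A. of_bool (g \<in> cl A V y) * of_bool (g \<in> cl A V z)))"
      unfolding bexp_sum bexp_cmult ..
    also have "\<dots> \<le> (\<Sum>y\<in>B - W. \<Sum>z\<in>B - W. (a y * a z) * (?E (\<lambda>A. of_bool (z \<in> cl A B y)) + p * p))"
    proof (intro sum_mono mult_left_mono)
      fix y z assume yz: "y \<in> B - W" "z \<in> B - W"
      show "?E (\<lambda>A. of_bool (g \<in> cl A V y) * of_bool (g \<in> cl A V z)) \<le> ?E (\<lambda>A. of_bool (z \<in> cl A B y)) + p * p"
        using bexp_ghost_cov[OF B, of y z V J] yz V J p by auto
    qed (use a in auto)
    also have "\<dots> = (\<Sum>y\<in>B - W. \<Sum>z\<in>B - W. (a y * a z) * ?E (\<lambda>A. of_bool (z \<in> cl A B y))) + (T * p)\<^sup>2"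
    proof -
      have "(\<Sum>y\<in>B - W. \<Sum>z\<in>B - W. (a y * a z) * (p * p)) = (T * p)\<^sup>2"
        unfolding sum_distrib_right[symmetric] sum_product[symmetric] T[symmetric]
        by (simp add: power2_eq_square)
      then show ?thesis by (simp only: distrib_left sum.distrib)
    qed
    also have "(\<Sum>y\<in>B - W. \<Sum>z\<in>B - W. (a y * a z) * ?E (\<lambda>A. of_bool (z \<in> cl A B y)))
       \<le> (\<Sum>y\<in>B. \<Sum>z\<in>B. b\<^sup>2 * ?E (\<lambda>A. of_bool (z \<in> cl A B y)))"
    proof -
      have *: "0 \<le> ?E (\<lambda>A. of_bool (z \<in> cl A B y))" for y z using J by (intro bexp_nonneg) auto
      have "(\<Sum>y\<in>B - W. \<Sum>z\<in>B - W. (a y * a z) * ?E (\<lambda>A. of_bool (z \<in> cl A B y)))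
         \<le> (\<Sum>y\<in>B - W. \<Sum>z\<in>B - W. b\<^sup>2 * ?E (\<lambda>A. of_bool (z \<in> cl A B y)))"
        unfolding power2_eq_square using a(2) * \<open>0 \<le> b\<close> by (intro sum_mono mult_right_mono mult_mono) auto
      also have "\<dots> \<le> (\<Sum>y\<in>B - W. \<Sum>z\<in>B. b\<^sup>2 * ?E (\<lambda>A. of_bool (z \<in> cl A B y)))"
        using B * by (intro sum_mono sum_mono2) auto
      also have "\<dots> \<le> (\<Sum>y\<in>B. \<Sum>z\<in>B. b\<^sup>2 * ?E (\<lambda>A. of_bool (z \<in> cl A B y)))"
        using B * by (intro sum_mono2 sum_nonneg) auto
      finally show ?thesis .
    qed
    also have "\<dots> = b\<^sup>2 * X"
    proof -
      have "(\<Sum>z\<in>B. ?E (\<lambda>A. of_bool (z \<in> cl A B y))) = bexp J (edges B) (\<lambda>A. card (cl A B y))" if "y \<in> B" for y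
        unfolding EB[symmetric, of "\<lambda>S. real (card S)"] bexp_sum[symmetric] using B that by (intro bexp_cong) (auto simp: card_cl_sum)
      then show ?thesis by (simp add: X_def sum_distrib_left[symmetric])
    qed
    finally show ?thesis by simp
  qed
  have var: "?E (\<lambda>A. (Y A - T * p)\<^sup>2) \<le> b\<^sup>2 * X"
  proof -
    have "?E (\<lambda>A. (Y A - T * p)\<^sup>2) = ?E (\<lambda>A. (Y A)\<^sup>2 + (T * p)\<^sup>2 - 2 * (T * p) * Y A)"
      by (intro bexp_cong) (simp add: power2_diff)
    also have "\<dots> = ?E (\<lambda>A. (Y A)\<^sup>2) - (T * p)\<^sup>2"
      using fin EY by (simp add: bexp_diff bexp_add bexp_cmult power2_eq_square)
    finally show ?thesis using EY2 by simp
  qed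
  \<comment> \<open>All vertices of the explored cluster see the same weights \<open>a\<close>, so
    the sum over \<open>u\<close> becomes the factor \<open>card (cl A W x)\<close>;
    \<open>N\<close> bounds what is lost by discarding the cluster of \<open>x\<close> in
    \<open>B\<close>.\<close>
  have ZY: "card (cl A W x) * (Y A - N A) \<le> Z A" for A
  proof -
    let ?C = "cl A W x" and ?K = "cl A B x"
    have CK: "?C \<subseteq> ?K" using W by (intro cl_mono) auto
    have C: "?C \<subseteq> W" using W by (intro cl_subset)
    have "Y A - N A \<le> (\<Sum>y\<in>B - W. a y * of_bool (y \<in> cl A (V - ?C) g))"
    proof -
      have "Y A \<le> (\<Sum>y\<in>B - W. a y * of_bool (y \<in> cl A (V - ?C) g) + b * of_bool (y \<in> ?K))"
        unfolding Y_def
      proof (rule sum_mono)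
        fix y assume y: "y \<in> B - W"
        show "a y * of_bool (g \<in> cl A V y) \<le> a y * of_bool (y \<in> cl A (V - ?C) g) + b * of_bool (y \<in> ?K)"
        proof (cases "g \<in> cl A V y \<and> y \<notin> ?K")
          case True
          then have "g \<in> cl A (V - ?K) y"
            using cl_ghost_off[of x B y g A] y fin B V by auto
          then have "g \<in> cl A (V - ?C) y"
            using cl_mono[of A "V - ?K" A "V - ?C" y] CK by auto
          then show ?thesis using True by (simp add: cl_sym[of g])
        qed (use a(2)[OF y] \<open>0 \<le> b\<close> in auto)
      qed
      also have "\<dots> = (\<Sum>y\<in>B - W. a y * of_bool (y \<in> cl A (V - ?C) g)) + b * (\<Sum>y\<in>B - W. of_bool (y \<in> ?K))"
        by (simp add: sum.distrib sum_distrib_left)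
      also have "(\<Sum>y\<in>B - W. of_bool (y \<in> ?K)) \<le> real (card ?K)"
        unfolding card_cl_sum[OF B(1) fin(5)] using B by (intro sum_mono2) auto
      finally show ?thesis using \<open>0 \<le> b\<close> by (simp add: N_def mult_left_mono)
    qed
    then have "card ?C * (Y A - N A) \<le> card ?C * (\<Sum>y\<in>B - W. a y * of_bool (y \<in> cl A (V - ?C) g))"
      by (intro mult_left_mono) auto
    also have "\<dots> = (\<Sum>u\<in>?C. \<Sum>y\<in>(B - W) \<inter> cl A (V - ?C) g. J {u, y})"
    proof -
      have "(\<Sum>y\<in>(B - W) \<inter> cl A (V - ?C) g. J {u, y}) = (\<Sum>y\<in>B - W. a y * of_bool (y \<in> cl A (V - ?C) g))"
        if "u \<in> ?C" for u
        using that a(1) C B by (intro sum.mono_neutral_cong_left) auto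
      then show ?thesis by simp
    qed
    also have "\<dots> \<le> Z A"
      unfolding Z_def using B V C fin W by (intro sum_mono sum_mono2 J) auto
    finally show ?thesis .
  qed
  have "1 - p = ?E (\<lambda>A. exp (- Z A))"
  proof -
    have "1 - p = ?E (\<lambda>A. of_bool (g \<notin> cl A V x))"
      using p[of x] fin by (simp add: of_bool_not_iff bexp_diff)
    then show ?thesis unfolding Z_def bexp_disconnect[OF fin(1,3) W(2) fin(6)] .
  qed
  also have "\<dots> \<le> ?E (\<lambda>A. exp (- (T * p - 2 * \<delta>) * card (cl A W x)) + ((Y A - T * p)\<^sup>2 / \<delta>\<^sup>2 + N A / \<delta>))"
  proof (intro bexp_mono J)
    fix A
    let ?c = "real (card (cl A W x))"
    have "0 \<le> J {u, y}" if "u \<in> cl A W x" "y \<in> (V - W) \<inter> cl A (V - cl A W x) g" for u y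
    proof -
      have "u \<in> W" using that(1) cl_subset[OF W(2), of A] by auto
      then show ?thesis using that(2) fin(3) by (intro J) auto
    qed
    then have nn: "0 \<le> N A" "0 \<le> Z A"
      using \<open>0 \<le> b\<close> unfolding N_def Z_def by (auto intro!: sum_nonneg)
    have nn2: "0 \<le> (Y A - T * p)\<^sup>2 / \<delta>\<^sup>2" "0 \<le> N A / \<delta>" using nn \<open>0 < \<delta>\<close> by auto
    \<comment> \<open>Chebyshev for \<open>Y\<close> and Markov for \<open>N\<close>: on the first
      two events one of the added error terms is at least 1.\<close>
    consider "\<bar>Y A - T * p\<bar> \<ge> \<delta>" | "N A \<ge> \<delta>" | "\<bar>Y A - T * p\<bar> < \<delta>" "N A < \<delta>" by linarith
    then show "exp (- Z A) \<le> exp (- (T * p - 2 * \<delta>) * ?c) + ((Y A - T * p)\<^sup>2 / \<delta>\<^sup>2 + N A / \<delta>)"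
    proof cases
      case 1
      then have "\<delta>\<^sup>2 \<le> (Y A - T * p)\<^sup>2" using \<open>0 < \<delta>\<close> by (simp add: abs_le_square_iff[symmetric])
      then have "1 \<le> (Y A - T * p)\<^sup>2 / \<delta>\<^sup>2" using \<open>0 < \<delta>\<close> by simp
      moreover have "exp (- Z A) \<le> 1" using nn by simp
      ultimately show ?thesis using nn2 by (smt (verit) exp_ge_zero)
    next
      case 2
      then have "1 \<le> N A / \<delta>" using \<open>0 < \<delta>\<close> by simp
      moreover have "exp (- Z A) \<le> 1" using nn by simp
      ultimately show ?thesis using nn2 by (smt (verit) exp_ge_zero)
    next
      case 3
      then have "T * p - 2 * \<delta> \<le> Y A - N A" by linarith
      then have "?c * (T * p - 2 * \<delta>) \<le> ?c * (Y A - N A)" by (intro mult_left_mono) auto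
      then have "- Z A \<le> - (T * p - 2 * \<delta>) * ?c"
        using ZY[of A] by (simp add: algebra_simps)
      then have "exp (- Z A) \<le> exp (- (T * p - 2 * \<delta>) * ?c)" by simp
      then show ?thesis using nn2 by linarith
    qed
  qed
  also have "\<dots> = ?E (\<lambda>A. exp (- (T * p - 2 * \<delta>) * card (cl A W x))) + (?E (\<lambda>A. (Y A - T * p)\<^sup>2) / \<delta>\<^sup>2 + ?E N / \<delta>)"
    by (simp only: bexp_add bexp_divide)
  also have "\<dots> \<le> ?E (\<lambda>A. exp (- (T * p - 2 * \<delta>) * card (cl A W x))) + (b\<^sup>2 * X / \<delta>\<^sup>2 + ?E N / \<delta>)"
    using var \<open>0 < \<delta>\<close> by (simp add: divide_right_mono)
  also have "?E N = b * bexp J (edges B) (\<lambda>A. card (cl A B x))"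
    unfolding N_def bexp_cmult EB[of "\<lambda>S. real (card S)"] ..
  also have "?E (\<lambda>A. exp (- (T * p - 2 * \<delta>) * card (cl A W x)))
      = bexp J (edges W) (\<lambda>A. exp (- (T * p - 2 * \<delta>) * card (cl A W x)))"
    by (rule EW[of "\<lambda>S. exp (- (T * p - 2 * \<delta>) * card S)"])
  finally show ?thesis using fin by (simp add: bexp_diff X_def)
qed

section \<open>The hierarchical lattice\<close>

text \<open>The relation of lying in a common \<open>n\<close>-block. It replaces the distance,
  which is only ever compared with powers of \<open>L\<close>.\<close>

definition hagree :: "nat \<Rightarrow> hvert \<Rightarrow> hvert \<Rightarrow> bool" where
  "hagree n x y \<longleftrightarrow> (\<forall>i>n. x i = y i)"

definition hball :: "nat \<Rightarrow> nat \<Rightarrow> nat \<Rightarrow> hvert \<Rightarrow> hvert set" where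
  "hball d L n x = {y \<in> hier d L. hagree n x y}"

text \<open>\<open>hlev x x\<close> is the unspecified maximum of the empty set.\<close>
definition hlev :: "hvert \<Rightarrow> hvert \<Rightarrow> nat" where
  "hlev x y = Max {i. x i \<noteq> y i}"

text \<open>Addition in the group. These translations are isometries and make the model
  transitive.\<close>

definition htr :: "nat \<Rightarrow> hvert \<Rightarrow> hvert \<Rightarrow> hvert" where
  "htr L a z = (\<lambda>i j. (a i j + z i j) mod L)"

lemma hagree_refl [simp]: "hagree n x x"
  and hagree_sym: "hagree n x y \<longleftrightarrow> hagree n y x"
  and hagree_trans: "hagree n x y \<Longrightarrow> hagree n y z \<Longrightarrow> hagree n x z"
  and hagree_mono: "hagree n x y \<Longrightarrow> n \<le> m \<Longrightarrow> hagree m x y"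
  by (auto simp: hagree_def)

lemma finite_hdiff:
  assumes "x \<in> hier d L" "y \<in> hier d L"
  shows "finite {i. x i \<noteq> y i}"
proof -
  have "{i. x i \<noteq> y i} \<subseteq> {i. x i \<noteq> (\<lambda>_. 0)} \<union> {i. y i \<noteq> (\<lambda>_. 0)}" by auto
  then show ?thesis using assms by (auto simp: hier_def intro: finite_subset)
qed

lemma hagree_iff_hlev:
  assumes "x \<in> hier d L" "y \<in> hier d L" "x \<noteq> y"
  shows "hagree n x y \<longleftrightarrow> hlev x y \<le> n"
proof -
  have "{i. x i \<noteq> y i} \<noteq> {}" using assms(3) by auto
  then show ?thesis
    using finite_hdiff[OF assms(1,2)] unfolding hagree_def hlev_def by (subst Max_le_iff) (auto simp: not_le)
qed

lemma hagree_0: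
  assumes "x \<in> hier d L" "y \<in> hier d L" "hagree 0 x y"
  shows "x = y"
proof
  fix i show "x i = y i"
    using assms by (cases "i = 0") (auto simp: hier_def hagree_def)
qed

lemma hlev_sym: "hlev x y = hlev y x"
  unfolding hlev_def by metis

lemma hedges_edges: "hedges d L = edges (hier d L)"
  by (simp add: hedges_def edges_def)

lemma mem_hball: "y \<in> hball d L n x \<longleftrightarrow> y \<in> hier d L \<and> hagree n x y"
  by (simp add: hball_def)

lemma hball_subset_hier: "hball d L n x \<subseteq> hier d L"
  by (auto simp: hball_def)

lemma hball_mono: "n \<le> m \<Longrightarrow> hball d L n x \<subseteq> hball d L m x"
  by (auto simp: hball_def intro: hagree_mono)

lemma hball_self: "x \<in> hier d L \<Longrightarrow> x \<in> hball d L n x"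
  by (simp add: hball_def)

lemma hball_eq: "hagree n x y \<Longrightarrow> hball d L n y = hball d L n x"
  unfolding hball_def using hagree_trans hagree_sym by blast

lemma hball_0: "x \<in> hier d L \<Longrightarrow> hball d L 0 x = {x}"
  using hagree_0 by (auto simp: hball_def)

locale hlattice =
  fixes d L :: nat
  assumes d_pos: "1 \<le> d" and L_ge: "2 \<le> L"
begin

abbreviation H :: "hvert set" where "H \<equiv> hier d L"
abbreviation bl :: "nat \<Rightarrow> hvert set" where "bl n \<equiv> hball d L n horigin"
abbreviation ball :: "nat \<Rightarrow> hvert \<Rightarrow> hvert set" where "ball n x \<equiv> hball d L n x"
definition q :: nat where "q = L ^ d"

lemma q_ge: "2 \<le> q"
proof -
  have "2 ^ 1 \<le> (2::nat) ^ d" using d_pos by (intro power_increasing) auto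
  also have "\<dots> \<le> q" unfolding q_def using L_ge by (intro power_mono) auto
  finally show ?thesis by simp
qed

lemma origin_H [simp]: "horigin \<in> H"
  using L_ge by (auto simp: hier_def horigin_def)

lemma origin_bl [simp]: "horigin \<in> bl n"
  by (rule hball_self) simp

lemma hnorm_le_iff:
  assumes "x \<in> H" "y \<in> H"
  shows "hnorm L x y \<le> L ^ n \<longleftrightarrow> hagree n x y"
  using assms L_ge hagree_iff_hlev[OF assms, of n] by (auto simp: hnorm_def hlev_def)

lemma hblock_eq: "hblock d L n = bl n"
  using hnorm_le_iff by (auto simp: hblock_def hball_def)

lemma elen_eq:
  assumes "x \<in> H" "y \<in> H" "x \<noteq> y"
  shows "elen L {x, y} = L ^ hlev x y"
proof -
  have *: "hnorm L x y = L ^ hlev x y" "hnorm L y x = L ^ hlev x y"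
    using assms(3) hlev_sym[of x y] by (auto simp: hnorm_def hlev_def)
  have "(\<lambda>(u, v). hnorm L u v) ` ({x, y} \<times> {x, y}) = {0, L ^ hlev x y}"
    using * by (auto simp: hnorm_def)
  then show ?thesis by (simp add: elen_def)
qed

lemma isometry_invariantD:
  assumes "isometry_invariant d L J" "x \<in> H" "y \<in> H" "x \<noteq> y" "x' \<in> H" "y' \<in> H" "x' \<noteq> y'"
    and "hlev x y = hlev x' y'"
  shows "J {x, y} = J {x', y'}"
  using assms elen_eq unfolding isometry_invariant_def hedges_edges by simp

text \<open>The ultrametric property: from outside, all points of a block are seen at the same
  distance.\<close>

lemma hlev_outside:
  assumes "u \<in> bl n" "y \<in> H - bl n"
  shows "hlev u y = hlev horigin y" "u \<noteq> y" "horigin \<noteq> y"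
proof -
  have H: "u \<in> H" "hagree n horigin u" "y \<in> H" "\<not> hagree n horigin y"
    using assms by (auto simp: mem_hball)
  then show ne: "u \<noteq> y" "horigin \<noteq> y" by auto
  have "hagree m u y \<longleftrightarrow> hagree m horigin y" for m
  proof (cases "n \<le> m")
    case True
    then show ?thesis using H hagree_mono hagree_trans hagree_sym by meson
  next
    case False
    then have "\<not> hagree m u y" "\<not> hagree m horigin y"
      using H hagree_mono[of m _ y n] hagree_trans by (meson nat_le_linear)+
    then show ?thesis by simp
  qed
  then have "hlev u y \<le> m \<longleftrightarrow> hlev horigin y \<le> m" for m
    using hagree_iff_hlev[of u d L y m] hagree_iff_hlev[of horigin d L y m] H ne by simp
  then show "hlev u y = hlev horigin y" by (metis le_antisym order_refl)
qed

lemma H_eq_Union: "H = (\<Union>n. bl n)"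
proof -
  have "\<exists>n. hagree n horigin x" if "x \<in> H" for x
  proof (cases "x = horigin")
    case False
    then show ?thesis using hagree_iff_hlev[of horigin d L x] that by auto
  qed auto
  then show ?thesis by (auto simp: mem_hball)
qed

lemma htr_H: "a \<in> H \<Longrightarrow> z \<in> H \<Longrightarrow> htr L a z \<in> H"
proof -
  assume *: "a \<in> H" "z \<in> H"
  have "{i. htr L a z i \<noteq> (\<lambda>_. 0)} \<subseteq> {i. a i \<noteq> (\<lambda>_. 0)} \<union> {i. z i \<noteq> (\<lambda>_. 0)}"
    by (auto simp: htr_def)
  moreover have "finite ({i. a i \<noteq> (\<lambda>_. 0)} \<union> {i. z i \<noteq> (\<lambda>_. 0)})"
    using * by (auto simp: hier_def)
  ultimately have "finite {i. htr L a z i \<noteq> (\<lambda>_. 0)}" using finite_subset by blast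
  then show ?thesis using * L_ge by (auto simp: hier_def htr_def)
qed

lemma htr_origin: "a \<in> H \<Longrightarrow> htr L a horigin = a"
  by (auto simp: htr_def horigin_def hier_def intro!: ext)

lemma htr_comp_eq:
  assumes "x \<in> H" "y \<in> H" "z \<in> H"
  shows "htr L x y i = htr L x z i \<longleftrightarrow> y i = z i"
proof
  assume eq: "htr L x y i = htr L x z i"
  show "y i = z i"
  proof
    fix j
    have "(x i j + y i j) mod L = (x i j + z i j) mod L"
      using fun_cong[OF eq, of j] by (simp add: htr_def)
    moreover have "((x i j + w) mod L + (L - x i j)) mod L = w mod L" for w
    proof -
      have "x i j < L" using assms(1) by (simp add: hier_def)
      then have "x i j + w + (L - x i j) = w + L" by simp
      then show ?thesis by (metis mod_add_left_eq mod_add_self2)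
    qed
    ultimately have "y i j mod L = z i j mod L" by metis
    then show "y i j = z i j" using assms by (auto simp: hier_def)
  qed
qed (simp add: htr_def)

lemma hagree_htr: "x \<in> H \<Longrightarrow> y \<in> H \<Longrightarrow> z \<in> H \<Longrightarrow> hagree n (htr L x y) (htr L x z) \<longleftrightarrow> hagree n y z"
  by (simp add: hagree_def htr_comp_eq)

lemma hlev_htr: "x \<in> H \<Longrightarrow> y \<in> H \<Longrightarrow> z \<in> H \<Longrightarrow> hlev (htr L x y) (htr L x z) = hlev y z"
  by (simp add: hlev_def htr_comp_eq)

lemma inj_htr: "x \<in> H \<Longrightarrow> inj_on (htr L x) H"
  using htr_comp_eq by (intro inj_onI ext) metis

lemma htr_bl: "x \<in> H \<Longrightarrow> htr L x ` bl n = ball n x"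
proof
  assume x: "x \<in> H"
  show "htr L x ` bl n \<subseteq> ball n x"
    using hagree_htr[OF x origin_H, of _ n] htr_H[OF x] htr_origin[OF x] by (auto simp: mem_hball)
  show "ball n x \<subseteq> htr L x ` bl n"
  proof
    fix y assume y: "y \<in> ball n x"
    then have yH: "y \<in> H" by (simp add: mem_hball)
    \<comment> \<open>The difference of \<open>y\<close> and \<open>x\<close> in the group, written
      with \<open>L - x i j\<close> to stay clear of truncated subtraction.\<close>
    define z where "z = (\<lambda>i j. (y i j + (L - x i j)) mod L)"
    have xl: "x i j < L" "y i j < L" for i j using x yH by (auto simp: hier_def)
    have "{i. z i \<noteq> (\<lambda>_. 0)} \<subseteq> {i. y i \<noteq> (\<lambda>_. 0)} \<union> {i. x i \<noteq> (\<lambda>_. 0)}"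
      by (auto simp: z_def)
    moreover have "finite ({i. y i \<noteq> (\<lambda>_. 0)} \<union> {i. x i \<noteq> (\<lambda>_. 0)})"
      using x yH by (auto simp: hier_def)
    ultimately have "finite {i. z i \<noteq> (\<lambda>_. 0)}" using finite_subset by blast
    then have zH: "z \<in> H" using x yH L_ge by (auto simp: hier_def z_def)
    have yz: "y = htr L x z"
    proof (intro ext)
      fix i j
      have "(x i j + (y i j + (L - x i j)) mod L) mod L = (y i j + L) mod L"
        using xl[of i j] by (simp add: mod_simps)
      then show "y i j = htr L x z i j" using xl[of i j] by (simp add: htr_def z_def)
    qed
    have "hagree n horigin z"
      using y hagree_htr[OF x origin_H zH, of n] yz htr_origin[OF x] by (simp add: mem_hball)
    then show "y \<in> htr L x ` bl n" using yz zH by (auto simp: mem_hball)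
  qed
qed

lemma card_bl: "card (bl n) = q ^ n" and finite_bl [simp, intro]: "finite (bl n)"
proof -
  define P where "P = PiE ({1..n} \<times> {..<d}) (\<lambda>_. {..<L})"
  define f where "f = (\<lambda>x::hvert. restrict (\<lambda>(i, j). x i j) ({1..n} \<times> {..<d}))"
  have zero: "x i j = 0" if "x \<in> bl n" "\<not> (i \<in> {1..n} \<and> j < d)" for x i j
  proof (cases "n < i")
    case True
    then have "x i = horigin i" using that(1) by (simp add: mem_hball hagree_def)
    then show ?thesis by (simp add: horigin_def)
  next
    case False
    then have "i = 0 \<or> d \<le> j" using that(2) by auto
    then show ?thesis using that(1) by (auto simp: mem_hball hier_def)
  qed
  have "bij_betw f (bl n) P"
  proof (intro bij_betw_imageI inj_onI)
    fix x y assume xy: "x \<in> bl n" "y \<in> bl n" "f x = f y"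
    show "x = y"
    proof (intro ext)
      fix i j
      show "x i j = y i j"
      proof (cases "i \<in> {1..n} \<and> j < d")
        case True
        then show ?thesis using fun_cong[OF xy(3), of "(i, j)"] by (simp add: f_def)
      next
        case False
        then show ?thesis using zero[OF xy(1) False] zero[OF xy(2) False] by simp
      qed
    qed
  next
    show "f ` bl n = P"
    proof
      show "f ` bl n \<subseteq> P"
        unfolding f_def P_def
        by (intro image_subsetI) (auto simp only: restrict_PiE_iff mem_hball hier_def lessThan_iff)
      show "P \<subseteq> f ` bl n"
      proof
        fix p assume p: "p \<in> P"
        define x where "x = (\<lambda>i j. if i \<in> {1..n} \<and> j < d then p (i, j) else 0)"
        have "{i. x i \<noteq> (\<lambda>_. 0)} \<subseteq> {1..n}" by (auto simp: x_def)
        then have "finite {i. x i \<noteq> (\<lambda>_. 0)}" using finite_subset by blast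
        then have "x \<in> H" using p L_ge by (auto simp: hier_def x_def P_def PiE_iff)
        then have "x \<in> bl n" by (auto simp: mem_hball hagree_def horigin_def x_def)
        moreover have "f x = p"
          using p by (auto simp: f_def x_def P_def PiE_def extensional_def)
        ultimately show "p \<in> f ` bl n" by auto
      qed
    qed
  qed
  moreover have "card P = q ^ n" "finite P"
    by (auto simp: P_def card_PiE q_def power_mult[symmetric] mult.commute intro!: finite_PiE)
  ultimately show "card (bl n) = q ^ n" "finite (bl n)"
    using bij_betw_same_card bij_betw_finite by metis+
qed

lemma card_ball: "x \<in> H \<Longrightarrow> card (ball n x) = q ^ n"
  and finite_ball [simp, intro]: "x \<in> H \<Longrightarrow> finite (ball n x)"
proof -
  assume x: "x \<in> H"
  have "inj_on (htr L x) (bl n)" by (rule inj_on_subset[OF inj_htr[OF x] hball_subset_hier])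
  then show "card (ball n x) = q ^ n" unfolding htr_bl[OF x, symmetric] by (simp add: card_image card_bl)
  show "finite (ball n x)" unfolding htr_bl[OF x, symmetric] by simp
qed

lemma ball_in_bl: "x \<in> bl N \<Longrightarrow> n \<le> N \<Longrightarrow> ball n x \<subseteq> bl N"
  unfolding mem_hball using hball_eq[of N horigin x d L] hball_mono[of n N d L x] by simp

lemma ball_eq_bl: "x \<in> bl N \<Longrightarrow> ball N x = bl N"
  unfolding mem_hball using hball_eq[of N horigin x d L] by simp

lemma kernel_htr:
  assumes "isometry_invariant d L J" "x \<in> H" "e \<in> edges H"
  shows "J (htr L x ` e) = J e"
proof -
  obtain u v where e: "e = {u, v}" "u \<in> H" "v \<in> H" "u \<noteq> v" using assms(3) by (auto simp: edges_def)
  have "htr L x u \<noteq> htr L x v" using inj_htr[OF assms(2)] e by (auto simp: inj_on_def)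
  then show ?thesis
    using isometry_invariantD[OF assms(1), of "htr L x u" "htr L x v" u v] e assms(2)
    by (simp add: htr_H hlev_htr)
qed

lemma bexp_ball:
  assumes "isometry_invariant d L J" "x \<in> H"
  shows "bexp J (edges (ball n x)) F = bexp J (edges (bl n)) (\<lambda>A. F (image (htr L x) ` A))"
proof -
  have inj: "inj_on (htr L x) (bl n)" by (rule inj_on_subset[OF inj_htr[OF assms(2)] hball_subset_hier])
  show ?thesis
    unfolding htr_bl[OF assms(2), symmetric] bexp_image_edges[OF inj]
    using kernel_htr[OF assms] edges_mono[OF hball_subset_hier, of d L n horigin]
    by (intro bexp_cong_weight) auto
qed

lemma card_cl_htr:
  assumes "x \<in> H" "y \<in> bl n" "A \<subseteq> edges (bl n)"
  shows "card (cl (image (htr L x) ` A) (ball n x) (htr L x y)) = card (cl A (bl n) y)"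
proof -
  have inj: "inj_on (htr L x) (bl n)" by (rule inj_on_subset[OF inj_htr[OF assms(1)] hball_subset_hier])
  show ?thesis
    unfolding htr_bl[OF assms(1), symmetric] cl_image[OF inj assms(2,3)]
    by (rule card_image, rule inj_on_subset[OF inj]) (rule cl_subset[OF assms(2)])
qed

text \<open>A translation by an element of \<open>bl N\<close> preserves \<open>bl N\<close>, so
  finite volume has no boundary effect: within a block all vertices are equivalent.\<close>

lemma bexp_card_cl_transitive:
  assumes "isometry_invariant d L J" "x \<in> bl N"
  shows "bexp J (edges (bl N)) (\<lambda>A. f (card (cl A (bl N) x)))
    = bexp J (edges (bl N)) (\<lambda>A. f (card (cl A (bl N) horigin)))"
proof -
  have x: "x \<in> H" using assms(2) by (simp add: mem_hball)
  have "bexp J (edges (ball N x)) (\<lambda>A. f (card (cl A (ball N x) x)))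
    = bexp J (edges (bl N)) (\<lambda>A. f (card (cl A (bl N) horigin)))"
    unfolding bexp_ball[OF assms(1) x]
    using card_cl_htr[OF x, of horigin N] htr_origin[OF x] by (intro bexp_cong) simp
  then show ?thesis unfolding ball_eq_bl[OF assms(2)] .
qed

end

section \<open>Finite-volume description of the percolation probability\<close>

context hlattice
begin

definition cluster_tail :: "(hvert set \<Rightarrow> real) \<Rightarrow> nat \<Rightarrow> nat \<Rightarrow> real" where
  "cluster_tail J N s = bexp J (edges (bl N)) (\<lambda>A. of_bool (s \<le> card (cl A (bl N) horigin)))"

lemma edges_bl_subset: "edges (bl N) \<subseteq> hedges d L"
  unfolding hedges_edges by (rule edges_mono[OF hball_subset_hier])

text \<open>An event of finitely many edges is a finite disjoint union of cylinders. This is the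
  passage from the infinite product measure to \<open>bexp\<close>.\<close>

lemma perc_law_cylinder:
  assumes J: "\<And>e. e \<in> hedges d L \<Longrightarrow> 0 \<le> J e" and E: "finite E" "E \<subseteq> hedges d L"
  shows "{\<omega> \<in> space (perc_law d L J). Q {e \<in> E. \<omega> e}} \<in> sets (perc_law d L J)"
    and "measure (perc_law d L J) {\<omega> \<in> space (perc_law d L J). Q {e \<in> E. \<omega> e}} = bexp J E (\<lambda>A. of_bool (Q A))"
proof -
  let ?M = "\<lambda>e. measure_pmf (bernoulli_pmf (1 - exp (- J e)))"
  let ?I = "hedges d L"
  interpret product_prob_space ?M ?I by unfold_locales
  define C where "C = (\<lambda>A. {\<omega> \<in> space (perc_law d L J). {e \<in> E. \<omega> e} = A})"
  have C_emb: "C A = prod_emb ?I ?M E (PiE E (\<lambda>e. {e \<in> A}))" if "A \<subseteq> E" for A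
    using that E unfolding C_def perc_law_def space_PiM prod_emb_def
    by (auto simp: PiE_iff extensional_def)
  have C_sets: "C A \<in> sets (perc_law d L J)" if "A \<subseteq> E" for A
    unfolding C_emb[OF that] perc_law_def by (rule sets_PiM_I[OF E(1,2)]) auto
  have C_meas: "measure (perc_law d L J) (C A) = (\<Prod>e\<in>E. if e \<in> A then 1 - exp (- J e) else exp (- J e))"
    if "A \<subseteq> E" for A
  proof -
    have "measure (perc_law d L J) (C A) = (\<Prod>e\<in>E. measure (?M e) {e \<in> A})"
      unfolding C_emb[OF that] perc_law_def using E by (intro measure_PiM_emb) auto
    also have "\<dots> = (\<Prod>e\<in>E. if e \<in> A then 1 - exp (- J e) else exp (- J e))"
      using J E by (intro prod.cong refl) (auto simp: measure_pmf_single)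
    finally show ?thesis .
  qed
  have eq: "{\<omega> \<in> space (perc_law d L J). Q {e \<in> E. \<omega> e}} = (\<Union>A\<in>{A. A \<subseteq> E \<and> Q A}. C A)"
    by (auto simp: C_def)
  have fin: "finite {A. A \<subseteq> E \<and> Q A}" using E by auto
  show "{\<omega> \<in> space (perc_law d L J). Q {e \<in> E. \<omega> e}} \<in> sets (perc_law d L J)"
    unfolding eq using fin C_sets by auto
  have "measure (perc_law d L J) (\<Union>A\<in>{A. A \<subseteq> E \<and> Q A}. C A) = (\<Sum>A\<in>{A. A \<subseteq> E \<and> Q A}. measure (perc_law d L J) (C A))"
  proof (rule measure_finite_Union[OF fin])
    show "C ` {A. A \<subseteq> E \<and> Q A} \<subseteq> sets (perc_law d L J)" using C_sets by auto
    show "disjoint_family_on C {A. A \<subseteq> E \<and> Q A}" by (auto simp: disjoint_family_on_def C_def)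
    show "emeasure (perc_law d L J) (C A) \<noteq> \<infinity>" for A
      using P.emeasure_finite unfolding perc_law_def by auto
  qed
  also have "\<dots> = (\<Sum>A\<in>{A. A \<subseteq> E \<and> Q A}. (\<Prod>e\<in>E. if e \<in> A then 1 - exp (- J e) else exp (- J e)))"
    using C_meas by (intro sum.cong) auto
  also have "\<dots> = bexp J E (\<lambda>A. of_bool (Q A))"
    unfolding bexp_def using E by (intro sum.mono_neutral_cong_left) auto
  finally show "measure (perc_law d L J) {\<omega> \<in> space (perc_law d L J). Q {e \<in> E. \<omega> e}} = bexp J E (\<lambda>A. of_bool (Q A))"
    unfolding eq .
qed

lemma cluster_eq: "cluster d L \<omega> x = cl (Collect \<omega>) H x"
proof -
  have "open_rel d L \<omega> = adj (Collect \<omega>) H"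
    by (auto simp: open_rel_def adj_def hedges_edges)
  then show ?thesis by (simp add: cluster_def cl_def)
qed

lemma cl_bl_mono: "n \<le> m \<Longrightarrow> cl A (bl n) x \<subseteq> cl A (bl m) x"
  by (intro cl_mono hball_mono) auto

lemma cl_H_Union: "cl A H horigin = (\<Union>N. cl A (bl N) horigin)"
proof
  show "(\<Union>N. cl A (bl N) horigin) \<subseteq> cl A H horigin"
    using cl_mono[of A "bl N" A H horigin for N] hball_subset_hier by blast
  show "cl A H horigin \<subseteq> (\<Union>N. cl A (bl N) horigin)"
  proof (rule cl_closed)
    fix u v assume *: "u \<in> (\<Union>N. cl A (bl N) horigin)" "u \<in> H" "v \<in> H" "u \<noteq> v" "{u, v} \<in> A"
    then obtain n m where nm: "u \<in> cl A (bl n) horigin" "v \<in> bl m" using H_eq_Union by blast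
    let ?k = "max n m"
    have "u \<in> cl A (bl ?k) horigin" "v \<in> bl ?k" 
      using nm cl_bl_mono[of n ?k A horigin] hball_mono[of m ?k d L horigin] by auto
    moreover have "u \<in> bl ?k" using calculation(1) cl_subset[OF origin_bl[of ?k], of A] by blast
    ultimately have "v \<in> cl A (bl ?k) horigin" using * by - (rule cl_step[of u])
    then show "v \<in> (\<Union>N. cl A (bl N) horigin)" by auto
  qed auto
qed

lemma finite_subset_cl_bl: "finite T \<Longrightarrow> T \<subseteq> cl A H horigin \<Longrightarrow> \<exists>N. T \<subseteq> cl A (bl N) horigin"
proof (induction T rule: finite_induct)
  case (insert t T)
  then obtain n m where "T \<subseteq> cl A (bl n) horigin" "t \<in> cl A (bl m) horigin"
    using cl_H_Union by blast
  then have "insert t T \<subseteq> cl A (bl (max n m)) horigin"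
    using cl_bl_mono[of n "max n m" A horigin] cl_bl_mono[of m "max n m" A horigin] by auto
  then show ?case by blast
qed auto

text \<open>The disjunction is there because \<open>card\<close> of an infinite set is 0. Finitely
  many vertices of the full cluster are reached by finitely many finite paths, hence inside one
  block.\<close>

lemma large_cluster_iff:
  "infinite (cl A H horigin) \<or> s \<le> card (cl A H horigin) \<longleftrightarrow> (\<exists>N. s \<le> card (cl A (bl N) horigin))"
proof
  assume "infinite (cl A H horigin) \<or> s \<le> card (cl A H horigin)"
  then obtain T where "finite T" "T \<subseteq> cl A H horigin" "card T = s"
    by (metis infinite_arbitrarily_large obtain_subset_with_card_n)
  then obtain N where "T \<subseteq> cl A (bl N) horigin" using finite_subset_cl_bl by blast
  then show "\<exists>N. s \<le> card (cl A (bl N) horigin)"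
    using card_mono[of "cl A (bl N) horigin" T] \<open>card T = s\<close> by auto
next
  assume "\<exists>N. s \<le> card (cl A (bl N) horigin)"
  then obtain N where N: "s \<le> card (cl A (bl N) horigin)" ..
  have "cl A (bl N) horigin \<subseteq> cl A H horigin" using cl_H_Union by blast
  then show "infinite (cl A H horigin) \<or> s \<le> card (cl A H horigin)"
    using N card_mono le_trans by blast
qed

text \<open>Two monotone limits: clusters in blocks increase with \<open>N\<close>, and an infinite
  cluster is the decreasing limit of clusters of size at least \<open>s\<close>. All further
  statements about \<open>theta\<close> are statements about \<open>cluster_tail\<close>.\<close>

lemma theta_limits:
  assumes J: "\<And>e. e \<in> hedges d L \<Longrightarrow> 0 \<le> J e"
  obtains P where "\<And>s. (\<lambda>N. cluster_tail J N s) \<longlonglongrightarrow> P s" "P \<longlonglongrightarrow> theta d L J"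
    "\<And>s N. cluster_tail J N s \<le> P s" "\<And>s. theta d L J \<le> P s"
proof -
  let ?M = "perc_law d L J"
  interpret prob_space ?M
    unfolding perc_law_def by (intro prob_space_PiM measure_pmf.prob_space_axioms)
  define E where "E = (\<lambda>N s. {\<omega> \<in> space ?M. s \<le> card (cl (Collect \<omega>) (bl N) horigin)})"
  define F where "F = (\<lambda>s. {\<omega> \<in> space ?M. infinite (cl (Collect \<omega>) H horigin) \<or> s \<le> card (cl (Collect \<omega>) H horigin)})"
  have cl_eq: "cl {e \<in> edges (bl N). \<omega> e} (bl N) horigin = cl (Collect \<omega>) (bl N) horigin" for \<omega> N
    by (rule cl_cong) auto
  have E_sets: "E N s \<in> sets ?M" and E_meas: "prob (E N s) = cluster_tail J N s" for N s
    using perc_law_cylinder[where J=J and E="edges (bl N)" and Q="\<lambda>A. s \<le> card (cl A (bl N) horigin)",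
        OF J finite_edges[OF finite_bl] edges_bl_subset]
    unfolding cl_eq E_def cluster_tail_def by auto
  have inc: "incseq (\<lambda>N. E N s)" for s
    unfolding E_def using card_mono[OF finite_cl[OF finite_bl] cl_bl_mono] order_trans
    by (intro monoI) blast
  have FU: "F s = (\<Union>N. E N s)" for s
    unfolding F_def E_def large_cluster_iff by auto
  have F_sets: "F s \<in> sets ?M" for s unfolding FU using E_sets by auto
  have lim1: "(\<lambda>N. cluster_tail J N s) \<longlonglongrightarrow> prob (F s)" for s
    unfolding E_meas[symmetric] FU using E_sets inc by (intro finite_Lim_measure_incseq) auto
  have dec: "decseq F" unfolding F_def by (auto simp: decseq_def)
  have "(\<Inter>s. F s) = {\<omega> \<in> space ?M. infinite (cl (Collect \<omega>) H horigin)}"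
    unfolding F_def using not_less_eq_eq by blast
  then have th: "theta d L J = prob (\<Inter>s. F s)"
    by (simp add: theta_def cluster_eq)
  have lim2: "(\<lambda>s. prob (F s)) \<longlonglongrightarrow> theta d L J"
    unfolding th using F_sets dec by (intro finite_Lim_measure_decseq) auto
  show thesis
  proof (rule that[of "\<lambda>s. prob (F s)"])
    show "cluster_tail J N s \<le> prob (F s)" for s N
      unfolding E_meas[symmetric] FU using E_sets FU F_sets by (intro finite_measure_mono) auto
    show "theta d L J \<le> prob (F s)" for s
      unfolding th using F_sets by (intro finite_measure_mono) auto
  qed (use lim1 lim2 in auto)
qed

lemma theta_nonneg: "0 \<le> theta d L J"
  by (simp add: theta_def)

lemma cluster_tail_eventually_ge:
  assumes "\<And>e. e \<in> hedges d L \<Longrightarrow> 0 \<le> J e" "t < theta d L J"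
  shows "\<forall>\<^sub>F N in sequentially. t < cluster_tail J N s"
proof -
  obtain P where P: "\<And>s. (\<lambda>N. cluster_tail J N s) \<longlonglongrightarrow> P s" "P \<longlonglongrightarrow> theta d L J"
    "\<And>s N. cluster_tail J N s \<le> P s" "\<And>s. theta d L J \<le> P s"
    by (rule theta_limits[OF assms(1)]) blast+
  show ?thesis using order_tendstoD(1)[OF P(1)[of s], of t] P(4)[of s] assms(2) by auto
qed

lemma theta_ge:
  assumes "\<And>e. e \<in> hedges d L \<Longrightarrow> 0 \<le> J e" "\<And>s. \<exists>N. c \<le> cluster_tail J N s"
  shows "c \<le> theta d L J"
proof -
  obtain P where P: "\<And>s. (\<lambda>N. cluster_tail J N s) \<longlonglongrightarrow> P s" "P \<longlonglongrightarrow> theta d L J"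
    "\<And>s N. cluster_tail J N s \<le> P s" "\<And>s. theta d L J \<le> P s"
    by (rule theta_limits[OF assms(1)]) blast+
  have "c \<le> P s" for s using P(3)[of _ s] assms(2)[of s] order_trans by blast
  then show ?thesis using LIMSEQ_le_const[OF P(2)] by blast
qed

lemma cluster_tail_le_theta:
  assumes "\<And>e. e \<in> hedges d L \<Longrightarrow> 0 \<le> J e" "theta d L J < t"
  shows "\<exists>s. \<forall>N. cluster_tail J N s < t"
proof -
  obtain P where P: "\<And>s. (\<lambda>N. cluster_tail J N s) \<longlonglongrightarrow> P s" "P \<longlonglongrightarrow> theta d L J"
    "\<And>s N. cluster_tail J N s \<le> P s" "\<And>s. theta d L J \<le> P s"
    by (rule theta_limits[OF assms(1)]) blast+
  obtain s where "P s < t" using order_tendstoD(2)[OF P(2) assms(2)] by (auto simp: eventually_sequentially)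
  then show ?thesis using P(3) le_less_trans by blast
qed

lemma theta_mono:
  assumes "\<And>e. e \<in> hedges d L \<Longrightarrow> 0 \<le> J e" "\<And>e. e \<in> hedges d L \<Longrightarrow> J e \<le> J' e"
  shows "theta d L J \<le> theta d L J'"
proof (rule field_le_epsilon)
  fix \<epsilon> :: real assume "0 < \<epsilon>"
  have J': "0 \<le> J' e" if "e \<in> hedges d L" for e using assms that order_trans by blast
  have le: "cluster_tail J N s \<le> cluster_tail J' N s" for N s
    unfolding cluster_tail_def
  proof (rule bexp_mono_weight)
    fix A B assume "A \<subseteq> (B :: hvert set set)"
    then have "card (cl A (bl N) horigin) \<le> card (cl B (bl N) horigin)"
      by (intro card_mono finite_cl finite_bl cl_mono) auto
    then show "of_bool (s \<le> card (cl A (bl N) horigin)) \<le> (of_bool (s \<le> card (cl B (bl N) horigin)) :: real)"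
      by auto
  qed (use assms edges_bl_subset in auto)
  have "theta d L J - \<epsilon> \<le> theta d L J'"
  proof (rule theta_ge[OF J'])
    fix s
    have "\<forall>\<^sub>F N in sequentially. theta d L J - \<epsilon> < cluster_tail J N s"
      using \<open>0 < \<epsilon>\<close> by (intro cluster_tail_eventually_ge assms) auto
    then obtain N where "theta d L J - \<epsilon> < cluster_tail J N s" by (auto simp: eventually_sequentially)
    then show "\<exists>N. theta d L J - \<epsilon> \<le> cluster_tail J' N s" using le[of N s] by (intro exI[of _ N]) auto
  qed
  then show "theta d L J \<le> theta d L J' + \<epsilon>" by simp
qed

end

section \<open>Gelation\<close>

lemma one_minus_exp_scale:
  fixes c x :: real
  assumes "0 \<le> c" "c \<le> 1"
  shows "c * (1 - exp (- x)) \<le> 1 - exp (- (c * x))"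
proof -
  have "exp ((1 - c) *\<^sub>R 0 + c *\<^sub>R (- x)) \<le> (1 - c) * exp 0 + c * exp (- x)"
    using convex_onD[OF exp_convex, of c 0 "- x"] assms by simp
  then show ?thesis by (simp add: algebra_simps)
qed

text \<open>The ghost vertex is an element of the type outside the lattice; \<open>gkernel\<close> joins it to every vertex
  with intensity \<open>h\<close>, so that \<open>magnet n h\<close> below is the probability that the origin is connected to it.\<close>
definition ghost :: "nat \<Rightarrow> hvert" where
  "ghost L = (\<lambda>_ _. L)"

lemma ghost_notin [simp]: "ghost L \<notin> hier d L"
  by (auto simp: ghost_def hier_def)

definition gkernel :: "nat \<Rightarrow> (hvert set \<Rightarrow> real) \<Rightarrow> real \<Rightarrow> hvert set \<Rightarrow> real" where
  "gkernel L J h e = (if ghost L \<in> e then h else J e)"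

lemma (in hlattice) star_image:
  "(\<lambda>y. {horigin, y}) ` (H - {horigin}) = {e \<in> hedges d L. horigin \<in> e}"
proof (intro equalityI subsetI)
  fix e assume "e \<in> {e \<in> hedges d L. horigin \<in> e}"
  then obtain x y where "e = {x, y}" "x \<in> H" "y \<in> H" "x \<noteq> y" "horigin = x \<or> horigin = y"
    by (auto simp: hedges_def)
  then show "e \<in> (\<lambda>y. {horigin, y}) ` (H - {horigin})"
    by (auto simp: insert_commute)
qed (auto simp: hedges_edges)

section \<open>Magnetization of a block and the mean-field inequality\<close>

locale hkernel = hlattice +
  fixes J :: "hvert set \<Rightarrow> real"
  assumes J_nonneg: "\<And>e. e \<in> hedges d L \<Longrightarrow> 0 \<le> J e"
    and J_inv: "isometry_invariant d L J"
    and J_int: "kintegrable d L J"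
begin

text \<open>The intensity that a vertex sends out of its \<open>n\<close>-block; by
  \<open>kpair_outside\<close> it does not depend on the vertex.\<close>

definition tau :: "nat \<Rightarrow> real" where
  "tau n = (\<Sum>\<^sub>\<infinity>y\<in>H - bl n. kpair J horigin y)"

definition magnet :: "nat \<Rightarrow> real \<Rightarrow> real" where
  "magnet n h = bexp J (edges (bl n)) (\<lambda>A. 1 - exp (- h * card (cl A (bl n) horigin)))"

definition mean_cluster :: "nat \<Rightarrow> real" where
  "mean_cluster n = bexp J (edges (bl n)) (\<lambda>A. card (cl A (bl n) horigin))"

lemma J_bl_nonneg: "e \<in> edges (bl n) \<Longrightarrow> 0 \<le> J e"
  using edges_bl_subset J_nonneg by blast

lemma kpair_nonneg: "y \<in> H \<Longrightarrow> 0 \<le> kpair J horigin y"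
  by (auto simp: kpair_def hedges_edges intro: J_nonneg)

lemma summable_kpair: "kpair J horigin summable_on (H - bl n)"
proof -
  have inj: "inj_on (\<lambda>y. {horigin, y}) (H - {horigin})"
    by (auto simp: inj_on_def doubleton_eq_iff)
  have "(J \<circ> (\<lambda>y. {horigin, y})) summable_on (H - {horigin})"
    using J_int unfolding kintegrable_def star_image[symmetric] summable_on_reindex[OF inj] .
  then have "kpair J horigin summable_on (H - {horigin})"
    by (rule summable_on_cong[THEN iffD1, rotated]) (auto simp: kpair_def)
  then show ?thesis
    by (rule summable_on_subset_banach) auto
qed

lemma tau_nonneg: "0 \<le> tau n"
  unfolding tau_def by (intro infsum_nonneg kpair_nonneg) auto

lemma tau_split:
  assumes "n \<le> N"
  shows "tau n = (\<Sum>y\<in>bl N - bl n. kpair J horigin y) + tau N"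
proof -
  have eq: "H - bl n = (bl N - bl n) \<union> (H - bl N)"
    using hball_mono[OF assms, of d L horigin] hball_subset_hier[of d L N horigin] by auto
  have "tau n = (\<Sum>\<^sub>\<infinity>y\<in>bl N - bl n. kpair J horigin y) + tau N"
    unfolding tau_def eq
    by (rule infsum_Un_disjoint) (auto intro!: summable_kpair summable_on_finite)
  then show ?thesis by simp
qed

lemma tau_antimono: "n \<le> N \<Longrightarrow> tau N \<le> tau n"
  using tau_split[of n N] kpair_nonneg by (smt (verit) DiffD1 mem_hball sum_nonneg)

lemma kpair_outside:
  assumes "u \<in> bl n" "y \<in> H - bl n"
  shows "J {u, y} = kpair J horigin y"
  using hlev_outside[OF assms] isometry_invariantD[OF J_inv, of u y horigin y] assms
  by (auto simp: kpair_def mem_hball)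

text \<open>The kernel is constant on the shell of \<open>y\<close>, which has at least
  \<open>q ^ (m - 1)\<close> vertices, hence at least \<open>q ^ n\<close>, and each of them
  contributes to \<open>tau n\<close>.\<close>

lemma kpair_le_tau:
  assumes y: "y \<in> H - bl n"
  shows "kpair J horigin y \<le> tau n / q ^ n"
proof -
  have yH: "y \<in> H" "horigin \<noteq> y" using y hlev_outside(3)[OF origin_bl y] by auto
  define m where "m = hlev horigin y"
  have nm: "n < m"
    using y hagree_iff_hlev[of horigin d L y n] yH by (auto simp: m_def mem_hball)
  have same: "kpair J horigin z = kpair J horigin y" if "z \<in> bl m - bl (m - 1)" for z
  proof -
    have z: "z \<in> H" "z \<noteq> horigin" using that by (auto simp: mem_hball)
    have "hlev horigin z = m"
      using that nm hagree_iff_hlev[of horigin d L z m] hagree_iff_hlev[of horigin d L z "m - 1"] z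
      by (simp add: mem_hball) linarith
    then show ?thesis
      using z yH isometry_invariantD[OF J_inv, of horigin z horigin y] by (auto simp: kpair_def m_def)
  qed
  have "q ^ n \<le> q ^ (m - 1)" using nm q_ge by (intro power_increasing) auto
  also have "\<dots> \<le> q ^ m - q ^ (m - 1)"
  proof -
    have "2 * q ^ (m - 1) \<le> q * q ^ (m - 1)" using q_ge by simp
    also have "\<dots> = q ^ m" using nm by (metis One_nat_def Suc_pred less_nat_zero_code not_gr_zero power_Suc)
    finally show ?thesis by simp
  qed
  also have "\<dots> = card (bl m - bl (m - 1))"
    using hball_mono[of "m - 1" m d L horigin] by (simp add: card_Diff_subset card_bl)
  finally have card: "real (q ^ n) \<le> real (card (bl m - bl (m - 1)))" by linarith
  have "real (q ^ n) * kpair J horigin y \<le> real (card (bl m - bl (m - 1))) * kpair J horigin y"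
    using card kpair_nonneg[OF yH(1)] by (rule mult_right_mono)
  also have "\<dots> = (\<Sum>z\<in>bl m - bl (m - 1). kpair J horigin z)"
    using same by simp
  also have "\<dots> \<le> (\<Sum>z\<in>bl m - bl n. kpair J horigin z)"
  proof (rule sum_mono2)
    have "bl n \<subseteq> bl (m - 1)" using nm by (intro hball_mono) simp
    then show "bl m - bl (m - 1) \<subseteq> bl m - bl n" by auto
  qed (auto intro: kpair_nonneg dest: hball_subset_hier[THEN subsetD])
  also have "\<dots> \<le> tau n"
    using tau_split[of n m] tau_nonneg[of m] nm by simp
  finally show ?thesis using q_ge by (simp add: field_simps)
qed

lemma magnet_nonneg: "0 \<le> h \<Longrightarrow> 0 \<le> magnet n h"
  unfolding magnet_def by (intro bexp_nonneg J_bl_nonneg) auto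

lemma magnet_mono: "h \<le> h' \<Longrightarrow> magnet n h \<le> magnet n h'"
  unfolding magnet_def by (intro bexp_mono J_bl_nonneg) (auto intro!: mult_right_mono)

text \<open>Concavity in the field, together with the value 0 at field 0.\<close>

lemma magnet_scale:
  assumes "0 \<le> c" "c \<le> 1"
  shows "c * magnet n h \<le> magnet n (c * h)"
  unfolding magnet_def bexp_cmult[symmetric]
  using one_minus_exp_scale[OF assms, of "h * card (cl A (bl n) horigin)" for A]
  by (intro bexp_mono J_bl_nonneg) (auto simp: mult.assoc)

lemma card_cl_le: "real (card (cl A (bl n) horigin)) \<le> q ^ n"
  using card_mono[OF finite_bl cl_subset[OF origin_bl], of A n] card_bl by (metis of_nat_le_iff of_nat_power)

text \<open>The slope in the field is at most the cluster size, hence at most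
  \<open>q ^ n\<close>.\<close>

lemma magnet_add:
  assumes "0 \<le> h" "0 \<le> c"
  shows "magnet n (h + c) \<le> magnet n c + h * q ^ n"
proof -
  have "magnet n (h + c) \<le> bexp J (edges (bl n)) (\<lambda>A. (1 - exp (- c * card (cl A (bl n) horigin))) + h * q ^ n)"
    unfolding magnet_def
  proof (intro bexp_mono J_bl_nonneg)
    fix A
    let ?k = "real (card (cl A (bl n) horigin))"
    have "exp (- c * ?k) * (1 - h * ?k) \<le> exp (- c * ?k) * exp (- h * ?k)"
      using exp_ge_add_one_self[of "- h * ?k"] by (intro mult_left_mono) auto
    also have "\<dots> = exp (- (h + c) * ?k)" by (simp add: exp_add[symmetric] algebra_simps)
    finally have "1 - exp (- (h + c) * ?k) \<le> 1 - exp (- c * ?k) + exp (- c * ?k) * (h * ?k)"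
      by (simp add: algebra_simps)
    also have "exp (- c * ?k) * (h * ?k) \<le> 1 * (h * q ^ n)"
      using assms card_cl_le[of A n] by (intro mult_mono mult_left_mono) auto
    finally show "1 - exp (- (h + c) * ?k) \<le> 1 - exp (- c * ?k) + h * q ^ n" by simp
  qed
  then show ?thesis by (simp add: bexp_add magnet_def)
qed

lemma gkernel_nonneg:
  assumes "0 \<le> h" "e \<in> edges (insert (ghost L) (bl N))"
  shows "0 \<le> gkernel L J h e"
proof (cases "ghost L \<in> e")
  case False
  then have "e \<in> edges (bl N)" using assms(2) by (auto simp: edges_def)
  then show ?thesis using False J_bl_nonneg by (simp add: gkernel_def)
qed (use assms in \<open>simp add: gkernel_def\<close>)

lemma ghost_notin_bl [simp]: "ghost L \<notin> bl N"
  using hball_subset_hier[of d L N horigin] ghost_notin[of L d] by auto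

lemma gkernel_bl:
  assumes "e \<in> edges (bl N)"
  shows "gkernel L J h e = J e"
proof -
  have "ghost L \<notin> e" using assms ghost_notin_bl[of N] by (auto simp: edges_def)
  then show ?thesis by (simp add: gkernel_def)
qed

lemma bexp_gkernel_bl: "bexp (gkernel L J h) (edges (bl N)) F = bexp J (edges (bl N)) F"
  by (intro bexp_cong_weight gkernel_bl refl)

lemma ghost_connect:
  assumes "y \<in> bl N"
  shows "bexp (gkernel L J h) (edges (insert (ghost L) (bl N))) (\<lambda>A. of_bool (ghost L \<in> cl A (insert (ghost L) (bl N)) y)) = magnet N h"
proof -
  have "bexp (gkernel L J h) (edges (insert (ghost L) (bl N))) (\<lambda>A. of_bool (ghost L \<notin> cl A (insert (ghost L) (bl N)) y))
    = bexp (gkernel L J h) (edges (bl N)) (\<lambda>A. exp (- h * card (cl A (bl N) y)))"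
    using assms by (intro bexp_ghost) (auto simp: gkernel_def)
  also have "\<dots> = bexp J (edges (bl N)) (\<lambda>A. exp (- h * card (cl A (bl N) horigin)))"
    unfolding bexp_gkernel_bl by (rule bexp_card_cl_transitive[OF J_inv assms, of "\<lambda>k. exp (- h * k)"])
  finally show ?thesis by (simp add: magnet_def bexp_diff of_bool_not_iff)
qed

text \<open>\<open>bexp_disconnect_ge\<close> for \<open>bl n\<close> inside \<open>bl N\<close>
  with the ghost added: a vertex of \<open>bl n\<close> sends intensity \<open>h\<close> to the
  ghost itself and \<open>tau n - tau N\<close> to vertices that are connected to the ghost with
  probability \<open>magnet N h\<close>.\<close>

lemma magnet_le:
  assumes "n \<le> N" "0 \<le> h"
  shows "magnet N h \<le> magnet n (h + tau n * magnet N h)"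
proof -
  let ?V = "insert (ghost L) (bl N)" and ?g = "ghost L" and ?G = "gkernel L J h"
  let ?p = "\<lambda>y. if y = ?g then 1 else magnet N h"
  have sub: "bl n \<subseteq> bl N" using assms(1) by (rule hball_mono)
  have "bexp ?G (edges ?V) (\<lambda>A. exp (- (\<Sum>u\<in>cl A (bl n) horigin. \<Sum>y\<in>?V - bl n. ?G {u, y} * ?p y)))
    \<le> bexp ?G (edges ?V) (\<lambda>A. of_bool (?g \<notin> cl A ?V horigin))"
  proof (rule bexp_disconnect_ge)
    show "bexp ?G (edges ?V) (\<lambda>A. of_bool (?g \<in> cl A ?V y)) \<le> ?p y" if "y \<in> ?V - bl n" for y
    proof (cases "y = ?g")
      case False
      then show ?thesis using ghost_connect[of y N h] that by auto
    qed simp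
  qed (use sub assms gkernel_nonneg in auto)
  also have "\<dots> = 1 - magnet N h"
    unfolding of_bool_not_iff bexp_diff ghost_connect[OF origin_bl] by simp
  also have "(\<lambda>A. exp (- (\<Sum>u\<in>cl A (bl n) horigin. \<Sum>y\<in>?V - bl n. ?G {u, y} * ?p y)))
    = (\<lambda>A. exp (- (h + (tau n - tau N) * magnet N h) * card (cl A (bl n) horigin)))"
  proof
    fix A
    have "(\<Sum>y\<in>?V - bl n. ?G {u, y} * ?p y) = h + (tau n - tau N) * magnet N h" if u: "u \<in> cl A (bl n) horigin" for u
    proof -
      have ubl: "u \<in> bl n" using u cl_subset[OF origin_bl, of A n] by auto
      then have "u \<noteq> ?g" by auto
      have "?V - bl n = insert ?g (bl N - bl n)" by auto
      then have "(\<Sum>y\<in>?V - bl n. ?G {u, y} * ?p y) = h + (\<Sum>y\<in>bl N - bl n. ?G {u, y} * ?p y)"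
        by (simp add: gkernel_def)
      also have "(\<Sum>y\<in>bl N - bl n. ?G {u, y} * ?p y) = (\<Sum>y\<in>bl N - bl n. kpair J horigin y * magnet N h)"
      proof (intro sum.cong refl)
        fix y assume y: "y \<in> bl N - bl n"
        then have "y \<noteq> ?g" "y \<in> H - bl n" by (auto simp: mem_hball)
        then show "?G {u, y} * ?p y = kpair J horigin y * magnet N h"
          using kpair_outside[OF ubl] \<open>u \<noteq> ?g\<close> by (simp add: gkernel_def)
      qed
      also have "\<dots> = (tau n - tau N) * magnet N h"
        using tau_split[OF assms(1)] by (simp add: sum_distrib_right)
      finally show ?thesis .
    qed
    then have "(\<Sum>u\<in>cl A (bl n) horigin. \<Sum>y\<in>?V - bl n. ?G {u, y} * ?p y)
        = (\<Sum>u\<in>cl A (bl n) horigin. h + (tau n - tau N) * magnet N h)"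
      by (intro sum.cong refl)
    also have "\<dots> = (h + (tau n - tau N) * magnet N h) * card (cl A (bl n) horigin)"
      by (simp only: sum_constant mult.commute)
    finally show "exp (- (\<Sum>u\<in>cl A (bl n) horigin. \<Sum>y\<in>?V - bl n. ?G {u, y} * ?p y))
      = exp (- (h + (tau n - tau N) * magnet N h) * card (cl A (bl n) horigin))"
      by (simp only: minus_mult_left)
  qed
  also have "bexp ?G (edges ?V) (\<lambda>A. exp (- (h + (tau n - tau N) * magnet N h) * card (cl A (bl n) horigin)))
    = 1 - magnet n (h + (tau n - tau N) * magnet N h)"
  proof -
    have "bexp ?G (edges ?V) (\<lambda>A. exp (- (h + (tau n - tau N) * magnet N h) * card (cl A (bl n) horigin)))
      = bexp ?G (edges (bl n)) (\<lambda>A. exp (- (h + (tau n - tau N) * magnet N h) * card (cl A (bl n) horigin)))"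
      using sub by (intro bexp_local) (auto intro!: edges_mono simp: cl_local)
    then show ?thesis unfolding bexp_gkernel_bl magnet_def by (simp add: bexp_diff)
  qed
  finally have "magnet N h \<le> magnet n (h + (tau n - tau N) * magnet N h)" by simp
  also have "\<dots> \<le> magnet n (h + tau n * magnet N h)"
    using tau_nonneg[of N] magnet_nonneg[OF assms(2), of N] by (intro magnet_mono) (auto intro!: mult_right_mono)
  finally show ?thesis .
qed

text \<open>The self-consistency of \<open>magnet_le\<close> with the ghost removed: a field too
  weak to matter in \<open>bl n\<close> still meets the large clusters of a much larger block. The
  half gives room for working in finite volume.\<close>

lemma half_theta_le_magnet:
  assumes "0 < theta d L J"
  shows "theta d L J / 2 \<le> magnet n (tau n * (theta d L J / 2))"
proof (rule field_le_epsilon)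
  fix \<epsilon> :: real assume \<epsilon>: "0 < \<epsilon>"
  define h where "h = \<epsilon> / q ^ n"
  have h: "0 < h" using \<epsilon> q_ge by (simp add: h_def)
  let ?t = "theta d L J / 2"
  \<comment> \<open>A cluster of \<open>s\<close> vertices meets the ghost with probability at least
    3/4. Together with the 2/3 in the choice of \<open>N\<close> this yields the factor 1/2.\<close>
  obtain s :: nat where s: "ln 4 / h < s" using reals_Archimedean2 by blast
  have "\<forall>\<^sub>F N in sequentially. theta d L J * (2 / 3) < cluster_tail J N s"
    using assms by (intro cluster_tail_eventually_ge J_nonneg) auto
  then obtain N where N: "n \<le> N" "theta d L J * (2 / 3) < cluster_tail J N s"
    by (metis eventually_sequentially nle_le order_refl)
  have "cluster_tail J N s * (3 / 4) \<le> magnet N h"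
    unfolding cluster_tail_def magnet_def bexp_cmult_right[symmetric]
  proof (intro bexp_mono J_bl_nonneg)
    fix A
    let ?k = "card (cl A (bl N) horigin)"
    show "of_bool (s \<le> ?k) * (3 / 4) \<le> 1 - exp (- h * ?k)"
    proof (cases "s \<le> ?k")
      case True
      have "ln 4 \<le> h * s" using s h by (simp add: field_simps)
      also have "\<dots> \<le> h * ?k" using True h by simp
      finally have "exp (- h * ?k) \<le> exp (- ln 4)" by simp
      also have "\<dots> = 1 / 4" by (simp add: exp_minus)
      finally show ?thesis using True by simp
    qed (use h in simp)
  qed
  then have m: "?t \<le> magnet N h" using N by simp
  define m where "m = magnet N h"
  have mpos: "0 < m" "?t \<le> m" using m assms by (auto simp: m_def)
  \<comment> \<open>The magnetization \<open>m\<close> may exceed \<open>?t\<close>; concavity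
    scales the inequality for \<open>m\<close> down to \<open>?t\<close>.\<close>
  have "?t = (?t / m) * m" using mpos by simp
  also have "\<dots> \<le> (?t / m) * magnet n (h + tau n * m)"
    using magnet_le[OF N(1), of h] h mpos assms unfolding m_def[symmetric] by (intro mult_left_mono) auto
  also have "\<dots> \<le> magnet n ((?t / m) * (h + tau n * m))"
    using mpos assms by (intro magnet_scale) auto
  also have "\<dots> \<le> magnet n (h + tau n * ?t)"
  proof (rule magnet_mono)
    have "?t / m * h \<le> 1 * h" using mpos h by (intro mult_right_mono) auto
    moreover have "?t / m * (tau n * m) = tau n * ?t" using mpos by simp
    ultimately show "?t / m * (h + tau n * m) \<le> h + tau n * ?t"
      unfolding distrib_left by linarith
  qed
  also have "\<dots> \<le> magnet n (tau n * ?t) + h * q ^ n"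
    using h assms tau_nonneg by (intro magnet_add) auto
  also have "h * q ^ n = \<epsilon>" using q_ge by (simp add: h_def)
  finally show "?t \<le> magnet n (tau n * ?t) + \<epsilon>" .
qed

text \<open>At scale 0 the self-consistency is that of a Poisson branching process of mean
  \<open>tau 0\<close>, which is subcritical.\<close>

lemma theta_zero_of_tau_less:
  assumes "tau 0 < 1"
  shows "theta d L J = 0"
proof (rule ccontr)
  assume "theta d L J \<noteq> 0"
  then have pos: "0 < theta d L J" using theta_nonneg[of J] by simp
  have bl0: "bl 0 = {horigin}" by (rule hball_0) simp
  have "cl A (bl 0) horigin = {horigin}" for A using cl_subset[OF origin_bl, of A 0] bl0 by auto
  then have "magnet 0 h = 1 - exp (- h)" for h by (simp add: magnet_def)
  then have "theta d L J / 2 \<le> 1 - exp (- (tau 0 * (theta d L J / 2)))"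
    using half_theta_le_magnet[OF pos, of 0] by simp
  also have "\<dots> \<le> tau 0 * (theta d L J / 2)"
    using exp_ge_add_one_self[of "- (tau 0 * (theta d L J / 2))"] by linarith
  finally show False using assms pos by simp
qed

text \<open>\<open>bexp_gelation\<close> in terms of the scales. The error terms compare
  \<open>mean_cluster N\<close> with volumes, so they are small unless \<open>bl N\<close> holds
  clusters of positive density.\<close>

lemma gelation:
  assumes "n \<le> N" "0 \<le> h" "0 < \<delta>"
  shows "magnet n ((tau n - tau N) * magnet N h - 2 * \<delta>)
    \<le> magnet N h + (tau n / q ^ n)\<^sup>2 * (q ^ N * mean_cluster N) / \<delta>\<^sup>2 + (tau n / q ^ n) * mean_cluster N / \<delta>"
proof -
  let ?V = "insert (ghost L) (bl N)" and ?g = "ghost L" and ?G = "gkernel L J h"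
  have sub: "bl n \<subseteq> bl N" using assms(1) by (rule hball_mono)
  have "bexp ?G (edges (bl n)) (\<lambda>A. 1 - exp (- ((tau n - tau N) * magnet N h - 2 * \<delta>) * card (cl A (bl n) horigin)))
    \<le> magnet N h + (tau n / q ^ n)\<^sup>2 * (\<Sum>y\<in>bl N. bexp ?G (edges (bl N)) (\<lambda>A. card (cl A (bl N) y))) / \<delta>\<^sup>2
        + (tau n / q ^ n) * bexp ?G (edges (bl N)) (\<lambda>A. card (cl A (bl N) horigin)) / \<delta>"
  proof (rule bexp_gelation[where a="kpair J horigin"])
    show "?G {u, y} = kpair J horigin y" if "u \<in> bl n" "y \<in> bl N - bl n" for u y
    proof -
      have "{u, y} \<in> edges (bl N)" using that sub by auto
      moreover have "y \<in> H - bl n" using that by (auto simp: mem_hball)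
      ultimately show ?thesis using gkernel_bl kpair_outside[OF that(1)] by metis
    qed
    show "0 \<le> kpair J horigin y \<and> kpair J horigin y \<le> tau n / q ^ n" if "y \<in> bl N - bl n" for y
      using that kpair_le_tau[of y n] kpair_nonneg[of y] by (auto simp: mem_hball)
    show "tau n - tau N = (\<Sum>y\<in>bl N - bl n. kpair J horigin y)"
      using tau_split[OF assms(1)] by simp
  qed (use sub assms gkernel_nonneg ghost_connect tau_nonneg in auto)
  moreover have "(\<Sum>y\<in>bl N. bexp J (edges (bl N)) (\<lambda>A. card (cl A (bl N) y))) = q ^ N * mean_cluster N"
  proof -
    have "(\<Sum>y\<in>bl N. bexp J (edges (bl N)) (\<lambda>A. card (cl A (bl N) y))) = (\<Sum>y\<in>bl N. mean_cluster N)"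
      unfolding mean_cluster_def by (intro sum.cong refl bexp_card_cl_transitive[OF J_inv, of _ N real])
    then show ?thesis by (simp add: card_bl)
  qed
  ultimately show ?thesis unfolding bexp_gkernel_bl mean_cluster_def[symmetric] magnet_def[symmetric] by simp
qed

text \<open>Lets the field be prescribed through its magnetization. Field 1 already catches a single
  vertex with probability above 1/2, which fixes the range.\<close>

lemma magnet_IVT:
  assumes "0 \<le> c" "c \<le> 1 / 2"
  shows "\<exists>h\<ge>0. magnet N h = c"
proof -
  have "continuous_on {0..1} (magnet N)"
    unfolding magnet_def bexp_def by (intro continuous_intros)
  moreover have "magnet N 0 = 0" by (simp add: magnet_def)
  moreover have "1 / 2 \<le> magnet N 1"
  proof -
    have "(2::real) \<le> exp 1" using exp_ge_add_one_self[of 1] by simp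
    then have half: "exp (- 1) \<le> (1 / 2 :: real)" by (simp add: exp_minus field_simps)
    have "bexp J (edges (bl N)) (\<lambda>A. 1 / 2) \<le> magnet N 1"
      unfolding magnet_def
    proof (intro bexp_mono J_bl_nonneg)
      fix A
      have "1 \<le> card (cl A (bl N) horigin)" using cl_card_pos[of "bl N" A horigin] by simp
      then have "exp (- 1 * real (card (cl A (bl N) horigin))) \<le> exp (- 1)" by simp
      then show "1 / 2 \<le> 1 - exp (- 1 * real (card (cl A (bl N) horigin)))" using half by linarith
    qed
    then show ?thesis by simp
  qed
  ultimately have "\<exists>h. 0 \<le> h \<and> h \<le> 1 \<and> magnet N h = c"
    using assms by (intro IVT') auto
  then show ?thesis by auto
qed

end

section \<open>A lower bound on the mean cluster size in a block\<close>

context hkernel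
begin

text \<open>Quantitative strict concavity: halving the field costs less than half of the
  magnetization. With \<open>Z\<close> the response to \<open>x / 2\<close>, the response to
  \<open>x\<close> is \<open>2 * Z - Z\<^sup>2\<close>, and by Cauchy-Schwarz the mean of the square
  is at least the square of the mean.\<close>

lemma magnet_half_gain:
  assumes "t \<le> magnet n x" "0 \<le> x" "0 < t"
  shows "t / 2 + t\<^sup>2 / 8 \<le> magnet n (x / 2)"
proof -
  define Z where "Z = (\<lambda>A. 1 - exp (- (x / 2) * card (cl A (bl n) horigin)))"
  define z where "z = bexp J (edges (bl n)) Z"
  have "magnet n x = bexp J (edges (bl n)) (\<lambda>A. 2 * Z A - (Z A)\<^sup>2)"
    unfolding magnet_def
  proof (intro bexp_cong)
    fix A
    have "exp (- x * card (cl A (bl n) horigin)) = (1 - Z A)\<^sup>2"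
      by (simp add: Z_def exp_double[symmetric])
    then show "1 - exp (- x * card (cl A (bl n) horigin)) = 2 * Z A - (Z A)\<^sup>2"
      by (simp add: power2_eq_square algebra_simps)
  qed
  also have "\<dots> = 2 * z - bexp J (edges (bl n)) (\<lambda>A. (Z A)\<^sup>2)"
    by (simp add: bexp_diff bexp_cmult z_def)
  finally have "t + z\<^sup>2 \<le> 2 * z"
    using bexp_cauchy_schwarz[of "edges (bl n)" J Z] J_bl_nonneg assms(1) by (simp add: z_def)
  moreover from this have "t \<le> 2 * z" using zero_le_power2[of z] by linarith
  then have "(t / 2)\<^sup>2 \<le> z\<^sup>2" using assms(3) by (intro power_mono) auto
  ultimately have "t + t\<^sup>2 / 4 \<le> 2 * z" by (simp add: power_divide)
  then show ?thesis by (simp add: z_def Z_def magnet_def)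
qed

text \<open>Regularity says that a fixed proportion of the intensity leaving a block ends in the
  next block, so the remainder decays geometrically.\<close>

lemma kregular_tau:
  assumes "kregular d L J"
  obtains \<rho> n0 where "0 \<le> \<rho>" "\<rho> < 1" "\<And>n. n0 \<le> n \<Longrightarrow> tau (Suc n) \<le> \<rho> * tau n"
proof -
  obtain C n0 where C: "\<And>n. n0 \<le> n \<Longrightarrow> tau n \<le> C * (\<Sum>\<^sub>\<infinity>x\<in>bl (Suc n) - bl n. kpair J horigin x)"
    using assms unfolding kregular_def hblock_eq tau_def by auto
  define C' where "C' = max C 1"
  have "tau (Suc n) \<le> (1 - 1 / C') * tau n" if "n0 \<le> n" for n
  proof -
    have eq: "(\<Sum>\<^sub>\<infinity>x\<in>bl (Suc n) - bl n. kpair J horigin x) = tau n - tau (Suc n)"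
      using tau_split[of n "Suc n"] by simp
    have "0 \<le> tau n - tau (Suc n)" using tau_antimono[of n "Suc n"] by simp
    then have "C * (tau n - tau (Suc n)) \<le> C' * (tau n - tau (Suc n))"
      unfolding C'_def by (intro mult_right_mono) auto
    then have "tau n \<le> C' * (tau n - tau (Suc n))"
      using C[OF that] unfolding eq by linarith
    moreover have "0 < C'" by (simp add: C'_def)
    ultimately show ?thesis by (simp add: field_simps)
  qed
  moreover have "0 \<le> 1 - 1 / C'" "1 - 1 / C' < 1" by (auto simp: C'_def field_simps)
  ultimately show thesis using that by blast
qed

text \<open>The mean-field equation \<open>t \<le> magnet n (tau n * t)\<close> is strictly concave, so a branching process
  with these offspring laws is supercritical with room to spare. Were the clusters of \<open>bl N\<close>
  small, gelation would contradict a choice of the ghost field with \<open>magnet N h = t / 4\<close>.\<close>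
lemma giant_expectation:
  assumes "0 < theta d L J" "kregular d L J"
  obtains c :: real and N0 where "0 < c" "\<And>N. N0 \<le> N \<Longrightarrow> c * q ^ N \<le> mean_cluster N"
proof -
  define t where "t = theta d L J / 2"
  have "theta d L J \<le> 1"
  proof -
    interpret prob_space "perc_law d L J"
      unfolding perc_law_def by (intro prob_space_PiM measure_pmf.prob_space_axioms)
    show ?thesis unfolding theta_def by simp
  qed
  then have t: "0 < t" "t \<le> 1 / 2" "\<And>n. t \<le> magnet n (tau n * t)"
    using assms(1) half_theta_le_magnet[OF assms(1)] by (auto simp: t_def)
  obtain \<rho> n0 where \<rho>: "0 \<le> \<rho>" "\<rho> < 1" "\<And>n. n0 \<le> n \<Longrightarrow> tau (Suc n) \<le> \<rho> * tau n"
    using kregular_tau[OF assms(2)] by blast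
  \<comment> \<open>After \<open>r\<close> scales only a share \<open>t / 32\<close> of the outgoing
    intensity is left, so nearly all that leaves scale \<open>N - r\<close> stays in
    \<open>bl N\<close>.\<close>
  obtain r where r: "\<rho> ^ r < t / 32" using real_arch_pow_inv[of "t / 32" \<rho>] \<rho> t by auto
  have tau_r: "tau (n + k) \<le> \<rho> ^ k * tau n" if "n0 \<le> n" for n k
  proof (induction k)
    case (Suc k)
    have "tau (n + Suc k) \<le> \<rho> * tau (n + k)" using \<rho>(3)[of "n + k"] that by simp
    also have "\<dots> \<le> \<rho> * (\<rho> ^ k * tau n)" using Suc \<rho> by (intro mult_left_mono)
    finally show ?case by (simp add: mult_ac)
  qed simp
  define \<delta> where "\<delta> = t\<^sup>2 / 400"
  \<comment> \<open>With \<open>n = N - r\<close> the two error terms of \<open>gelation\<close> sum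
    to \<open>w\<close> times \<open>mean_cluster N / q ^ N\<close>, and \<open>w\<close> does not
    depend on \<open>N\<close>.\<close>
  define w where "w = (real q ^ r)\<^sup>2 / \<delta>\<^sup>2 + real q ^ r / \<delta>"
  have \<delta>: "0 < \<delta>" using t by (simp add: \<delta>_def)
  have qpos: "0 < real q" using q_ge by simp
  have w: "0 < w" using \<delta> qpos by (simp add: w_def add_pos_pos)
  show thesis
  proof (rule that[of "t\<^sup>2 / 25 / w" "n0 + r"])
    show "0 < t\<^sup>2 / 25 / w" using t w by simp
    fix N assume N: "n0 + r \<le> N"
    define n where "n = N - r"
    have n: "n0 \<le> n" "N = n + r" using N by (auto simp: n_def)
    have taupos: "0 < tau n"
    proof (rule ccontr)
      assume "\<not> 0 < tau n"
      then have "tau n = 0" using tau_nonneg[of n] by simp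
      then show False using t(3)[of n] t(1) by (simp add: magnet_def)
    qed
    obtain h where h: "0 \<le> h" "magnet N h = t / 4" using magnet_IVT[of "t / 4" N] t by auto
    \<comment> \<open>\<open>s * tau n\<close> bounds from below the field in
      \<open>gelation\<close> at magnetization \<open>t / 4\<close>. The corrections to
      \<open>s = t / 4\<close> are of order \<open>t\<^sup>2\<close> and smaller than the gain of
      about \<open>t\<^sup>2 / 16\<close> from strict concavity; what remains is at least
      \<open>t\<^sup>2 / 25\<close>.\<close>
    define s where "s = (1 - t / 32) * (t / 4) - 2 * \<delta>"
    have s_eq: "s = t / 4 - t * t / 128 - t * t / 200" by (simp add: s_def \<delta>_def power2_eq_square algebra_simps)
    have tt: "t * t \<le> t / 2" "0 \<le> t * t" using t mult_left_mono[of t "1/2" t] by auto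
    have s: "0 \<le> s" "s \<le> t / 2" unfolding s_eq using tt t by linarith+
    have "s * (1 + t / 4) = (s / (t / 2)) * (t / 2 + t\<^sup>2 / 8)"
      using t by (simp add: field_simps power2_eq_square)
    also have "\<dots> \<le> (s / (t / 2)) * magnet n (tau n * t / 2)"
      using t s tau_nonneg[of n] magnet_half_gain[OF t(3)[of n]] by (intro mult_left_mono) auto
    also have "\<dots> \<le> magnet n ((s / (t / 2)) * (tau n * t / 2))"
      using s t by (intro magnet_scale) auto
    also have "\<dots> = magnet n (s * tau n)" using t by (simp add: mult.commute)
    also have "\<dots> \<le> magnet n ((tau n - tau N) * magnet N h - 2 * (\<delta> * tau n))"
    proof (rule magnet_mono)
      have "tau N \<le> \<rho> ^ r * tau n" using tau_r[OF n(1), of r] n by simp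
      also have "\<dots> \<le> t / 32 * tau n" using r taupos by (intro mult_right_mono) auto
      finally have "(1 - t / 32) * tau n * (t / 4) \<le> (tau n - tau N) * (t / 4)"
        using t by (intro mult_right_mono) (auto simp: algebra_simps)
      then show "s * tau n \<le> (tau n - tau N) * magnet N h - 2 * (\<delta> * tau n)"
        unfolding h(2) s_def by (simp add: algebra_simps)
    qed
    also have "\<dots> \<le> magnet N h + (tau n / q ^ n)\<^sup>2 * (q ^ N * mean_cluster N) / (\<delta> * tau n)\<^sup>2 + (tau n / q ^ n) * mean_cluster N / (\<delta> * tau n)"
      using n h \<delta> taupos by (intro gelation) auto
    also have "\<dots> = t / 4 + mean_cluster N / q ^ N * w"
      using taupos qpos \<delta> unfolding h(2) unfolding w_def n(2)
      by (simp add: field_simps power_add power2_eq_square)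
    finally have 1: "s * (1 + t / 4) - t / 4 \<le> mean_cluster N / q ^ N * w" by simp
    have "t\<^sup>2 / 25 \<le> s * (1 + t / 4) - t / 4"
    proof -
      define u v where "u = t * t" and "v = t * t * t"
      have "v \<le> u * 1" using t tt unfolding u_def v_def by (intro mult_left_mono) auto
      moreover have "s * (1 + t / 4) - t / 4 = u / 16 - u / 128 - u / 200 - v / 512 - v / 800"
        unfolding s_eq u_def v_def by (simp add: algebra_simps)
      ultimately have "u / 25 \<le> s * (1 + t / 4) - t / 4"
        using tt(2) unfolding u_def[symmetric] by simp
      then show ?thesis by (simp add: u_def power2_eq_square)
    qed
    then have "t\<^sup>2 / 25 \<le> mean_cluster N / q ^ N * w" using 1 by linarith
    then show "t\<^sup>2 / 25 / w * real (q ^ N) \<le> mean_cluster N"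
      using w qpos by (simp add: field_simps)
  qed
qed

end

section \<open>Merging giant clusters\<close>

context hlattice
begin

text \<open>A canonical point in each \<open>n\<close>-block of \<open>bl N\<close>.\<close>

definition reps :: "nat \<Rightarrow> nat \<Rightarrow> hvert set" where
  "reps n N = {x \<in> bl N. \<forall>i\<le>n. x i = (\<lambda>_. 0)}"

lemma reps_H: "x \<in> reps n N \<Longrightarrow> x \<in> H"
  by (auto simp: reps_def mem_hball)

lemma finite_reps [simp]: "finite (reps n N)"
  by (simp add: reps_def)

lemma reps_agree:
  assumes "x \<in> reps n N" "y \<in> reps n N" "hagree n x y"
  shows "x = y"
proof
  fix i show "x i = y i"
    using assms by (cases "i \<le> n") (auto simp: reps_def hagree_def)
qed

lemma reps_disjoint:
  assumes "x \<in> reps n N" "y \<in> reps n N" "x \<noteq> y" "u \<in> ball n x" "v \<in> ball n y"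
  shows "\<not> hagree n u v"
proof
  assume "hagree n u v"
  then have "hagree n x y"
    using assms(4,5) hagree_trans hagree_sym unfolding mem_hball by meson
  then show False using reps_agree assms by blast
qed

lemma bl_eq_reps: "n \<le> N \<Longrightarrow> bl N = (\<Union>x\<in>reps n N. ball n x)"
proof
  assume nN: "n \<le> N"
  show "(\<Union>x\<in>reps n N. ball n x) \<subseteq> bl N"
    using ball_in_bl[OF _ nN] by (auto simp: reps_def)
  show "bl N \<subseteq> (\<Union>x\<in>reps n N. ball n x)"
  proof
    fix y assume y: "y \<in> bl N"
    define x where "x = (\<lambda>i. if i \<le> n then (\<lambda>_. 0) else y i)"
    have "{i. x i \<noteq> (\<lambda>_. 0)} \<subseteq> {i. y i \<noteq> (\<lambda>_. 0)}" by (auto simp: x_def)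
    moreover have "finite {i. y i \<noteq> (\<lambda>_. 0)}" using y by (auto simp: mem_hball hier_def)
    ultimately have "finite {i. x i \<noteq> (\<lambda>_. 0)}" by (rule finite_subset)
    then have "x \<in> H" using y L_ge by (auto simp: mem_hball hier_def x_def)
    moreover have "hagree N horigin x" using y nN by (auto simp: mem_hball hagree_def x_def)
    ultimately have "x \<in> reps n N" by (auto simp: reps_def mem_hball x_def)
    moreover have "y \<in> ball n x" using y by (auto simp: mem_hball hagree_def x_def)
    ultimately show "y \<in> (\<Union>x\<in>reps n N. ball n x)" by auto
  qed
qed

lemma ball_reps_disjoint:
  assumes "x \<in> reps n N" "y \<in> reps n N" "x \<noteq> y"
  shows "ball n x \<inter> ball n y = {}"
  using reps_disjoint[OF assms] hagree_refl by blast

lemma card_reps: "card (reps n (n + r)) = q ^ r"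
proof -
  have "q ^ (n + r) = card (\<Union>x\<in>reps n (n + r). ball n x)"
    by (subst bl_eq_reps[of n "n + r", symmetric]) (auto simp: card_bl)
  also have "\<dots> = (\<Sum>x\<in>reps n (n + r). card (ball n x))"
    using ball_reps_disjoint reps_H by (intro card_UN_disjoint) auto
  also have "\<dots> = card (reps n (n + r)) * q ^ n"
    using card_ball reps_H by simp
  finally show ?thesis using q_ge by (simp add: power_add)
qed

text \<open>The configuration inside the block of \<open>x\<close>, moved to the origin, so that one
  function on \<open>bl n\<close> can be evaluated in every block.\<close>

definition pull :: "nat \<Rightarrow> hvert \<Rightarrow> hvert set set \<Rightarrow> hvert set set" where
  "pull n x A = {e \<in> edges (bl n). htr L x ` e \<in> A}"

lemma inj_htr_bl: "x \<in> H \<Longrightarrow> inj_on (htr L x) (bl n)"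
  by (rule inj_on_subset[OF inj_htr hball_subset_hier])

lemma pull_image:
  assumes "x \<in> H"
  shows "image (htr L x) ` pull n x A = A \<inter> edges (ball n x)"
  unfolding pull_def htr_bl[OF assms, symmetric] edges_image[OF inj_htr_bl[OF assms]] by auto

lemma pull_of_image:
  assumes "x \<in> H" "B \<subseteq> edges (bl n)"
  shows "pull n x (image (htr L x) ` B) = B"
  using assms(2) inj_on_image_edges[OF inj_htr_bl[OF assms(1)], of n] unfolding pull_def
  by (auto simp: inj_on_def subset_iff)

lemma pull_subset: "pull n x A \<subseteq> edges (bl n)"
  by (auto simp: pull_def)

lemma pull_local:
  assumes "x \<in> H" "edges (ball n x) \<subseteq> E"
  shows "pull n x (A \<inter> E) = pull n x A"
proof -
  have "htr L x ` e \<in> edges (ball n x)" if "e \<in> edges (bl n)" for e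
    using that unfolding htr_bl[OF assms(1), symmetric] edges_image[OF inj_htr_bl[OF assms(1)]] by auto
  then show ?thesis using assms(2) by (auto simp: pull_def)
qed

lemma card_cl_pull:
  assumes "x \<in> H" "y \<in> bl n"
  shows "card (cl A (ball n x) (htr L x y)) = card (cl (pull n x A) (bl n) y)"
proof -
  have "cl A (ball n x) (htr L x y) = cl (image (htr L x) ` pull n x A) (ball n x) (htr L x y)"
    unfolding pull_image[OF assms(1)] by (rule cl_cong) auto
  then show ?thesis using card_cl_htr[OF assms pull_subset] by simp
qed

text \<open>\<open>D\<close> certifies a density rather than measuring the largest one. A lower
  bound may give up on bad configurations by taking the value 0, which is what \<open>merge\<close>
  does.\<close>

definition scheme :: "nat \<Rightarrow> (hvert set set \<Rightarrow> real) \<Rightarrow> bool" where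
  "scheme n D \<longleftrightarrow> (\<forall>A\<subseteq>edges (bl n). 0 \<le> D A \<and> D A \<le> 1 \<and>
     (\<exists>y\<in>bl n. D A * q ^ n \<le> card (cl A (bl n) y)))"

definition center :: "nat \<Rightarrow> (hvert set set \<Rightarrow> real) \<Rightarrow> hvert \<Rightarrow> hvert set set \<Rightarrow> hvert" where
  "center n D x A = htr L x (SOME y. y \<in> bl n \<and> D (pull n x A) * q ^ n \<le> card (cl (pull n x A) (bl n) y))"

definition core :: "nat \<Rightarrow> (hvert set set \<Rightarrow> real) \<Rightarrow> hvert \<Rightarrow> hvert set set \<Rightarrow> hvert set" where
  "core n D x A = cl A (ball n x) (center n D x A)"

lemma core:
  assumes "scheme n D" "x \<in> H"
  shows "center n D x A \<in> ball n x" "D (pull n x A) * q ^ n \<le> card (core n D x A)"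
    "core n D x A \<subseteq> ball n x"
proof -
  have "\<exists>y. y \<in> bl n \<and> D (pull n x A) * q ^ n \<le> card (cl (pull n x A) (bl n) y)"
    using assms(1) pull_subset unfolding scheme_def by blast
  from someI_ex[OF this] obtain y where y: "center n D x A = htr L x y" "y \<in> bl n"
      "D (pull n x A) * q ^ n \<le> card (cl (pull n x A) (bl n) y)"
    unfolding center_def by blast
  then show "D (pull n x A) * q ^ n \<le> card (core n D x A)"
    unfolding core_def using card_cl_pull[OF assms(2) y(2)] by simp
  show 1: "center n D x A \<in> ball n x" using y htr_bl[OF assms(2), of n] by auto
  show "core n D x A \<subseteq> ball n x" unfolding core_def using 1 by (rule cl_subset)
qed

lemma core_local:
  assumes "x \<in> H" "edges (ball n x) \<subseteq> E"
  shows "core n D x (A \<inter> E) = core n D x A"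
  unfolding core_def center_def pull_local[OF assms] using assms(2) by (rule cl_local)

definition linked :: "nat \<Rightarrow> nat \<Rightarrow> (hvert set set \<Rightarrow> real) \<Rightarrow> real \<Rightarrow> hvert set set \<Rightarrow> bool" where
  "linked n N D a A \<longleftrightarrow> (\<forall>x\<in>reps n N. \<forall>y\<in>reps n N. x \<noteq> y \<longrightarrow> a \<le> D (pull n x A) \<longrightarrow> a \<le> D (pull n y A)
     \<longrightarrow> A \<inter> cut (core n D x A) (core n D y A) \<noteq> {})"

text \<open>Blocks below the threshold \<open>a\<close> are dropped, since nothing ensures that
  their cores are joined to others; one missing link among the rest makes the value 0.\<close>

definition merge :: "nat \<Rightarrow> nat \<Rightarrow> (hvert set set \<Rightarrow> real) \<Rightarrow> real \<Rightarrow> hvert set set \<Rightarrow> real" where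
  "merge n r D a A = (\<Sum>x\<in>reps n (n + r). D (pull n x A) * of_bool (a \<le> D (pull n x A))) / q ^ r
     * of_bool (linked n (n + r) D a A)"

text \<open>All cores above the threshold lie in the cluster of any one of them. They are disjoint,
  so their sizes add up, and the division by \<open>q ^ r\<close> matches the growth of the
  volume.\<close>

lemma scheme_merge:
  assumes D: "scheme n D" and a: "0 < a"
  shows "scheme (n + r) (merge n r D a)"
  unfolding scheme_def
proof (intro allI impI conjI)
  fix A assume A: "A \<subseteq> edges (bl (n + r))"
  let ?R = "reps n (n + r)"
  let ?T = "\<lambda>x. D (pull n x A) * of_bool (a \<le> D (pull n x A))"
  have D01: "0 \<le> D (pull n x A)" "D (pull n x A) \<le> 1" for x
    using D pull_subset unfolding scheme_def by auto
  show nn: "0 \<le> merge n r D a A"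
    unfolding merge_def using D01 by (intro mult_nonneg_nonneg divide_nonneg_nonneg sum_nonneg) auto
  have "(\<Sum>x\<in>?R. ?T x) \<le> (\<Sum>x\<in>?R. 1)" using D01 by (intro sum_mono) auto
  then have "(\<Sum>x\<in>?R. ?T x) / q ^ r \<le> 1" using q_ge by (simp add: card_reps)
  then show "merge n r D a A \<le> 1"
    unfolding merge_def using nn by (cases "linked n (n + r) D a A") auto
  show "\<exists>y\<in>bl (n + r). merge n r D a A * q ^ (n + r) \<le> card (cl A (bl (n + r)) y)"
  proof (cases "linked n (n + r) D a A \<and> (\<exists>x\<in>?R. a \<le> D (pull n x A))")
    case False
    have "merge n r D a A = 0"
    proof (cases "linked n (n + r) D a A")
      case True
      then have "(\<Sum>x\<in>?R. ?T x) = 0" using False by (intro sum.neutral) auto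
      then show ?thesis by (simp add: merge_def)
    qed (simp add: merge_def)
    then show ?thesis by (intro bexI[of _ horigin]) auto
  next
    case True
    then obtain x0 where x0: "x0 \<in> ?R" "a \<le> D (pull n x0 A)" by auto
    define R' where "R' = {x \<in> ?R. a \<le> D (pull n x A)}"
    define z where "z = center n D x0 A"
    have sub: "ball n x \<subseteq> bl (n + r)" if "x \<in> ?R" for x
      using that ball_in_bl[of x "n + r" n] by (auto simp: reps_def)
    have z: "z \<in> bl (n + r)" using core(1)[OF D reps_H[OF x0(1)]] sub[OF x0(1)] by (auto simp: z_def)
    have coresub: "core n D x A \<subseteq> cl A (bl (n + r)) z" if x: "x \<in> R'" for x
    proof (cases "x = x0")
      case True
      then show ?thesis unfolding core_def z_def True using sub[OF x0(1)] by (intro cl_mono) auto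
    next
      case False
      have "A \<inter> cut (core n D x0 A) (core n D x A) \<noteq> {}"
        using True False x x0 \<open>linked n (n + r) D a A \<and> _\<close> unfolding linked_def R'_def by auto
      then obtain u v where uv: "u \<in> core n D x0 A" "v \<in> core n D x A" "{u, v} \<in> A"
        unfolding cut_def by auto
      have xR: "x \<in> ?R" using x by (simp add: R'_def)
      have bls: "u \<in> bl (n + r)" "v \<in> bl (n + r)"
        using uv core(3)[OF D reps_H[OF x0(1)]] core(3)[OF D reps_H[OF xR]] sub[OF x0(1)] sub[OF xR] by blast+
      have "u \<noteq> v" using uv(3) A edges_iff[of u v "bl (n + r)"] by blast
      have "u \<in> cl A (bl (n + r)) z"
        using uv(1) cl_mono[of A "ball n x0" A "bl (n + r)" z] sub[OF x0(1)] unfolding core_def z_def by auto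
      then have v: "v \<in> cl A (bl (n + r)) z"
        using bls \<open>u \<noteq> v\<close> uv(3) by (rule cl_step)
      have "core n D x A = cl A (ball n x) v"
        using uv(2) unfolding core_def by (rule cl_eq[symmetric])
      also have "\<dots> \<subseteq> cl A (bl (n + r)) v" using sub[OF xR] by (intro cl_mono) auto
      also have "\<dots> = cl A (bl (n + r)) z" using v by (rule cl_eq)
      finally show ?thesis .
    qed
    have "merge n r D a A * q ^ (n + r) = (\<Sum>x\<in>?R. ?T x) * q ^ n"
      using True q_ge by (simp add: merge_def power_add)
    also have "(\<Sum>x\<in>?R. ?T x) = (\<Sum>x\<in>R'. D (pull n x A))"
      unfolding R'_def by (rule sum.mono_neutral_cong_right) auto
    also have "(\<Sum>x\<in>R'. D (pull n x A)) * q ^ n \<le> (\<Sum>x\<in>R'. real (card (core n D x A)))"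
      unfolding sum_distrib_right using core(2)[OF D reps_H] by (intro sum_mono) (auto simp: R'_def)
    also have "\<dots> = card (\<Union>x\<in>R'. core n D x A)"
    proof -
      have "card (\<Union>x\<in>R'. core n D x A) = (\<Sum>x\<in>R'. card (core n D x A))"
      proof (rule card_UN_disjoint)
        show "\<forall>x\<in>R'. finite (core n D x A)"
          unfolding core_def using reps_H by (auto simp: R'_def)
        show "\<forall>x\<in>R'. \<forall>y\<in>R'. x \<noteq> y \<longrightarrow> core n D x A \<inter> core n D y A = {}"
          using core(3)[OF D reps_H] ball_reps_disjoint unfolding R'_def by blast
      qed (simp add: R'_def)
      then show ?thesis by simp
    qed
    also have "\<dots> \<le> card (cl A (bl (n + r)) z)"
      using coresub by (intro of_nat_mono card_mono) auto
    finally show ?thesis using z by blast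
  qed
qed

end

context hkernel
begin

lemma bexp_pull:
  assumes "x \<in> bl N" "n \<le> N"
  shows "bexp J (edges (bl N)) (\<lambda>A. f (pull n x A)) = bexp J (edges (bl n)) f"
proof -
  have x: "x \<in> H" using assms(1) by (simp add: mem_hball)
  have sub: "edges (ball n x) \<subseteq> edges (bl N)" using ball_in_bl[OF assms] by (rule edges_mono)
  have "bexp J (edges (bl N)) (\<lambda>A. f (pull n x A)) = bexp J (edges (ball n x)) (\<lambda>A. f (pull n x A))"
    using sub by (intro bexp_local) (auto simp: pull_local[OF x])
  also have "\<dots> = bexp J (edges (bl n)) f"
    unfolding bexp_ball[OF J_inv x] by (intro bexp_cong) (simp add: pull_of_image[OF x])
  finally show ?thesis .
qed

text \<open>Union bound over pairs of blocks. Cores depend only on edges inside their blocks; given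
  two cores of size at least \<open>a * q ^ n\<close>, at least
  \<open>a\<^sup>2 * (q ^ n)\<^sup>2\<close> fresh edges of weight at least \<open>jm\<close> have
  to be closed.\<close>

lemma bexp_not_linked:
  fixes a jm :: real
  assumes D: "scheme n D" and a: "0 < a"
    and jm: "0 \<le> jm" "\<And>u v. u \<in> bl (n + r) \<Longrightarrow> v \<in> bl (n + r) \<Longrightarrow> \<not> hagree n u v \<Longrightarrow> jm \<le> J {u, v}"
  shows "bexp J (edges (bl (n + r))) (\<lambda>A. of_bool (\<not> linked n (n + r) D a A))
    \<le> (q ^ r)\<^sup>2 * exp (- (a\<^sup>2 * (q ^ n)\<^sup>2 * jm))"
proof -
  let ?R = "reps n (n + r)" and ?E = "edges (bl (n + r))"
  let ?f = "\<lambda>x y A. of_bool (a \<le> D (pull n x A) \<and> a \<le> D (pull n y A)) *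
      of_bool (A \<inter> cut (core n D x A) (core n D y A) = {}) :: real"
  have pair: "bexp J ?E (?f x y) \<le> exp (- (a\<^sup>2 * (q ^ n)\<^sup>2 * jm))"
    if xy: "x \<in> ?R" "y \<in> ?R" "x \<noteq> y" for x y
  proof -
    have xyH: "x \<in> H" "y \<in> H" using xy reps_H by auto
    have sub: "ball n x \<subseteq> bl (n + r)" "ball n y \<subseteq> bl (n + r)"
      using xy ball_in_bl[of _ "n + r" n] by (auto simp: reps_def)
    have disj: "ball n x \<inter> ball n y = {}" using ball_reps_disjoint[OF xy] .
    define C where "C = cut (ball n x) (ball n y)"
    define R where "R = ?E - C"
    have CE: "C \<subseteq> ?E" using sub disj unfolding C_def cut_def by auto
    have E: "?E = R \<union> C" "finite R" "finite C" "R \<inter> C = {}" 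
      using CE unfolding R_def by (auto intro: finite_subset[OF CE])
    have ex: "edges (ball n x) \<subseteq> R"
    proof -
      have "edges (ball n x) \<inter> C = {}" using disj unfolding C_def cut_def edges_def by (auto simp: doubleton_eq_iff)
      then show ?thesis using edges_mono[OF sub(1)] unfolding R_def by auto
    qed
    have ey: "edges (ball n y) \<subseteq> R"
    proof -
      have "edges (ball n y) \<inter> C = {}" using disj unfolding C_def cut_def edges_def by (auto simp: doubleton_eq_iff)
      then show ?thesis using edges_mono[OF sub(2)] unfolding R_def by auto
    qed
    define Z where "Z = (\<lambda>A. cut (core n D x A) (core n D y A))"
    define F where "F = (\<lambda>A. of_bool (a \<le> D (pull n x A) \<and> a \<le> D (pull n y A)) :: real)"
    have ZC: "C \<inter> Z A = Z A" for A
      using core(3)[OF D xyH(1), of A] core(3)[OF D xyH(2), of A] unfolding C_def Z_def cut_def by auto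
    have Zl: "Z (A \<inter> R) = Z A" for A
      unfolding Z_def core_local[OF xyH(1) ex] core_local[OF xyH(2) ey] ..
    have Fl: "F (A \<inter> R) = F A" for A
      unfolding F_def pull_local[OF xyH(1) ex] pull_local[OF xyH(2) ey] ..
    have "bexp J ?E (?f x y) = bexp J (R \<union> C) (\<lambda>A. F (A \<inter> R) * of_bool (A \<inter> C \<inter> Z (A \<inter> R) = {}))"
      unfolding E(1)[symmetric] Zl Fl Int_assoc ZC by (simp add: F_def Z_def)
    also have "\<dots> = bexp J (R \<union> C) (\<lambda>A. F (A \<inter> R) * exp (- (\<Sum>e\<in>C \<inter> Z (A \<inter> R). J e)))"
      using E by (intro bexp_no_open_cond) auto
    also have "\<dots> = bexp J ?E (\<lambda>A. F A * exp (- (\<Sum>e\<in>Z A. J e)))"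
      unfolding E(1)[symmetric] Zl Fl ZC ..
    also have "\<dots> \<le> exp (- (a\<^sup>2 * (q ^ n)\<^sup>2 * jm))"
    proof (intro bexp_le_const J_bl_nonneg)
      fix A
      show "F A * exp (- (\<Sum>e\<in>Z A. J e)) \<le> exp (- (a\<^sup>2 * (q ^ n)\<^sup>2 * jm))"
      proof (cases "F A = 0")
        case False
        then have F: "a \<le> D (pull n x A)" "a \<le> D (pull n y A)" by (auto simp: F_def)
        let ?X = "core n D x A" and ?Y = "core n D y A"
        have X: "?X \<subseteq> ball n x" "?Y \<subseteq> ball n y" using core(3)[OF D] xyH by auto
        have card: "a * q ^ n \<le> card ?X" "a * q ^ n \<le> card ?Y"
          using core(2)[OF D xyH(1), of A] core(2)[OF D xyH(2), of A]
            mult_right_mono[OF F(1), of "real (q ^ n)"] mult_right_mono[OF F(2), of "real (q ^ n)"]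
          by linarith+
        have "a\<^sup>2 * (q ^ n)\<^sup>2 * jm = (a * q ^ n) * (a * q ^ n) * jm"
          by (simp add: power2_eq_square)
        also have "\<dots> \<le> real (card ?X) * real (card ?Y) * jm"
          using card jm(1) a by (intro mult_right_mono mult_mono) auto
        also have "\<dots> = (\<Sum>u\<in>?X. \<Sum>v\<in>?Y. jm)" by simp
        also have "\<dots> \<le> (\<Sum>u\<in>?X. \<Sum>v\<in>?Y. J {u, v})"
        proof (intro sum_mono jm(2))
          fix u v assume "u \<in> ?X" "v \<in> ?Y"
          then have uv: "u \<in> ball n x" "v \<in> ball n y" using X by auto
          show "u \<in> bl (n + r)" "v \<in> bl (n + r)" using uv sub by auto
          show "\<not> hagree n u v" using reps_disjoint[OF xy uv] .
        qed
        also have "\<dots> = (\<Sum>e\<in>Z A. J e)"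
        proof -
          have "finite ?X" "finite ?Y" using X xyH by (auto intro: finite_subset)
          moreover have "?X \<inter> ?Y = {}" using X disj by auto
          ultimately show ?thesis unfolding Z_def by (intro sum_cut[symmetric])
        qed
        finally show ?thesis by (simp add: F_def)
      qed simp
    qed auto
    finally show ?thesis .
  qed
  have "bexp J ?E (\<lambda>A. of_bool (\<not> linked n (n + r) D a A))
    \<le> bexp J ?E (\<lambda>A. \<Sum>x\<in>?R. \<Sum>y\<in>?R. of_bool (x \<noteq> y) * ?f x y A)"
  proof (intro bexp_mono J_bl_nonneg)
    fix A
    show "of_bool (\<not> linked n (n + r) D a A) \<le> (\<Sum>x\<in>?R. \<Sum>y\<in>?R. of_bool (x \<noteq> y) * ?f x y A)"
    proof (cases "linked n (n + r) D a A")
      case False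
      then obtain x y where xy: "x \<in> ?R" "y \<in> ?R" "of_bool (x \<noteq> y) * ?f x y A = 1"
        unfolding linked_def by auto
      have "1 \<le> (\<Sum>y\<in>?R. of_bool (x \<noteq> y) * ?f x y A)"
        unfolding xy(3)[symmetric] using xy by (intro member_le_sum) auto
      also have "\<dots> \<le> (\<Sum>x\<in>?R. \<Sum>y\<in>?R. of_bool (x \<noteq> y) * ?f x y A)"
        using xy by (intro member_le_sum[of x ?R "\<lambda>x. \<Sum>y\<in>?R. of_bool (x \<noteq> y) * ?f x y A"] sum_nonneg) auto
      finally show ?thesis using False by simp
    qed (auto intro!: sum_nonneg)
  qed
  also have "\<dots> = (\<Sum>x\<in>?R. \<Sum>y\<in>?R. of_bool (x \<noteq> y) * bexp J ?E (?f x y))"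
    unfolding bexp_sum bexp_cmult ..
  also have "\<dots> \<le> (\<Sum>x\<in>?R. \<Sum>y\<in>?R. exp (- (a\<^sup>2 * (q ^ n)\<^sup>2 * jm)))"
  proof (intro sum_mono)
    fix x y assume "x \<in> ?R" "y \<in> ?R"
    then show "of_bool (x \<noteq> y) * bexp J ?E (?f x y) \<le> exp (- (a\<^sup>2 * (q ^ n)\<^sup>2 * jm))"
      using pair[of x y] by (cases "x = y") auto
  qed
  also have "\<dots> = (q ^ r)\<^sup>2 * exp (- (a\<^sup>2 * (q ^ n)\<^sup>2 * jm))"
    by (simp add: card_reps power2_eq_square)
  finally show ?thesis .
qed

lemma bexp_pull_indep:
  assumes "x \<in> reps n N" "y \<in> reps n N" "x \<noteq> y" "n \<le> N"
  shows "bexp J (edges (bl N)) (\<lambda>A. f (pull n x A) * g (pull n y A))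
    = bexp J (edges (bl n)) f * bexp J (edges (bl n)) g"
proof -
  have H: "x \<in> H" "y \<in> H" "x \<in> bl N" "y \<in> bl N" using assms reps_H by (auto simp: reps_def)
  have "bexp J (edges (bl N)) (\<lambda>A. f (pull n x A) * g (pull n y A))
    = bexp J (edges (bl N)) (\<lambda>A. f (pull n x A)) * bexp J (edges (bl N)) (\<lambda>A. g (pull n y A))"
  proof (rule bexp_indep[of _ "edges (ball n x)" "edges (ball n y)"])
    show "edges (ball n x) \<inter> edges (ball n y) = {}"
      using ball_reps_disjoint[OF assms(1-3)] by (auto simp: edges_def doubleton_eq_iff)
    show "edges (ball n x) \<subseteq> edges (bl N)" "edges (ball n y) \<subseteq> edges (bl N)"
      by (intro edges_mono ball_in_bl H assms(4))+
  qed (simp_all add: pull_local[OF H(1) order_refl] pull_local[OF H(2) order_refl])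
  then show ?thesis using bexp_pull[OF H(3) assms(4)] bexp_pull[OF H(4) assms(4)] by simp
qed

text \<open>The mean over independent blocks contracts the variance by \<open>q ^ r\<close>; the other terms account
  for the blocks below the threshold and for missing connections.\<close>
lemma merge_moments:
  fixes n r a D
  defines "mu \<equiv> bexp J (edges (bl n)) D"
    and "loss \<equiv> \<lambda>A. D A * of_bool (D A < a)"
    and "D' \<equiv> merge n r D a"
    and "f \<equiv> bexp J (edges (bl (n + r))) (\<lambda>A. of_bool (\<not> linked n (n + r) D a A))"
  assumes D: "scheme n D" and a: "0 < a"
  shows "mu - bexp J (edges (bl n)) loss - f \<le> bexp J (edges (bl (n + r))) D'"
    and "bexp J (edges (bl (n + r))) (\<lambda>A. (D' A - mu)\<^sup>2)
      \<le> 3 / 2 * bexp J (edges (bl n)) (\<lambda>A. (D A - mu)\<^sup>2) / q ^ r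
        + 6 * bexp J (edges (bl n)) (\<lambda>A. (loss A)\<^sup>2) + 6 * f"
proof -
  let ?R = "reps n (n + r)" and ?E = "bexp J (edges (bl (n + r)))" and ?e = "bexp J (edges (bl n))"
  let ?Q = "real (q ^ r)"
  have Qpos: "0 < ?Q" using q_ge by simp
  have Rbl: "x \<in> bl (n + r)" if "x \<in> ?R" for x using that by (simp add: reps_def)
  have pullE: "?E (\<lambda>A. g (pull n x A)) = ?e g" if "x \<in> ?R" for g x
    using bexp_pull[OF Rbl[OF that]] by simp
  define avg where "avg = (\<lambda>g A. (\<Sum>x\<in>?R. g (pull n x A)) / ?Q :: real)"
  have avgE: "?E (avg g) = ?e g" for g
    unfolding avg_def bexp_divide bexp_sum using pullE Qpos by (simp add: card_reps)
  define T where "T = (\<lambda>A. D A * of_bool (a \<le> D A))"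
  have D01: "0 \<le> D (pull n x A)" "D (pull n x A) \<le> 1" for x A
    using D pull_subset unfolding scheme_def by auto
  have D'_eq: "D' A = avg T A * of_bool (linked n (n + r) D a A)" for A
    unfolding D'_def merge_def avg_def T_def ..
  have avgT: "0 \<le> avg T A" "avg T A \<le> 1" for A
  proof -
    show "0 \<le> avg T A" unfolding avg_def T_def using D01 by (intro divide_nonneg_nonneg sum_nonneg) auto
    have "(\<Sum>x\<in>?R. T (pull n x A)) \<le> (\<Sum>x\<in>?R. 1)" unfolding T_def using D01 by (intro sum_mono) auto
    then show "avg T A \<le> 1" unfolding avg_def using Qpos by (simp add: card_reps)
  qed
  have Tl: "T A = D A - loss A" for A by (auto simp: T_def loss_def)
  have avg_T: "avg T A = avg D A - avg loss A" for A
    unfolding avg_def Tl by (simp add: sum_subtractf diff_divide_distrib)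
  have "?E (\<lambda>A. avg T A - of_bool (\<not> linked n (n + r) D a A)) \<le> ?E D'"
    using avgT by (intro bexp_mono J_bl_nonneg) (auto simp: D'_eq)
  then have "?E (avg T) - f \<le> ?E D'" by (simp add: bexp_diff f_def)
  moreover have "?E (avg T) = mu - ?e loss"
    unfolding avgE mu_def Tl bexp_diff ..
  ultimately show "mu - ?e loss - f \<le> ?E D'" by simp
  have var: "?E (\<lambda>A. (avg D A - mu)\<^sup>2) = ?e (\<lambda>A. (D A - mu)\<^sup>2) / ?Q"
  proof -
    define c where "c = (\<lambda>A. D A - mu)"
    have ec: "?e c = 0" by (simp add: c_def bexp_diff mu_def)
    have "avg D A - mu = (\<Sum>x\<in>?R. c (pull n x A)) / ?Q" for A
      using Qpos by (simp add: avg_def c_def sum_subtractf card_reps diff_divide_distrib)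
    then have "(avg D A - mu)\<^sup>2 = (\<Sum>x\<in>?R. \<Sum>y\<in>?R. c (pull n x A) * c (pull n y A)) / ?Q\<^sup>2" for A
      by (simp add: power_divide power2_eq_square sum_product)
    then have "?E (\<lambda>A. (avg D A - mu)\<^sup>2) = (\<Sum>x\<in>?R. \<Sum>y\<in>?R. ?E (\<lambda>A. c (pull n x A) * c (pull n y A))) / ?Q\<^sup>2"
      by (simp add: bexp_divide bexp_sum)
    also have "(\<Sum>x\<in>?R. \<Sum>y\<in>?R. ?E (\<lambda>A. c (pull n x A) * c (pull n y A))) = (\<Sum>x\<in>?R. ?e (\<lambda>A. (c A)\<^sup>2))"
    proof (intro sum.cong refl)
      fix x assume x: "x \<in> ?R"
      have "?E (\<lambda>A. c (pull n x A) * c (pull n y A)) = (if y = x then ?e (\<lambda>A. (c A)\<^sup>2) else 0)" if "y \<in> ?R" for y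
        using bexp_pull_indep[of x n "n + r" y c c] x that ec pullE[OF x, of "\<lambda>A. (c A)\<^sup>2"]
        by (auto simp: power2_eq_square)
      then show "(\<Sum>y\<in>?R. ?E (\<lambda>A. c (pull n x A) * c (pull n y A))) = ?e (\<lambda>A. (c A)\<^sup>2)"
        using x by simp
    qed
    also have "\<dots> / ?Q\<^sup>2 = ?e (\<lambda>A. (D A - mu)\<^sup>2) / ?Q"
      using Qpos by (simp add: card_reps c_def power2_eq_square)
    finally show ?thesis .
  qed
  have loss_le: "?E (\<lambda>A. (avg loss A)\<^sup>2) \<le> ?e (\<lambda>A. (loss A)\<^sup>2)"
  proof -
    have "(avg loss A)\<^sup>2 \<le> avg (\<lambda>A. (loss A)\<^sup>2) A" for A
    proof -
      have "(\<Sum>x\<in>?R. loss (pull n x A))\<^sup>2 \<le> ?Q * (\<Sum>x\<in>?R. (loss (pull n x A))\<^sup>2)"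
        using Cauchy_Schwarz_ineq_sum[of "\<lambda>_. 1" "\<lambda>x. loss (pull n x A)" ?R] by (simp add: card_reps)
      then have "((\<Sum>x\<in>?R. loss (pull n x A)) / ?Q)\<^sup>2 \<le> ?Q * (\<Sum>x\<in>?R. (loss (pull n x A))\<^sup>2) / ?Q\<^sup>2"
        unfolding power_divide by (intro divide_right_mono) auto
      also have "\<dots> = (\<Sum>x\<in>?R. (loss (pull n x A))\<^sup>2) / ?Q"
        using Qpos by (simp add: power2_eq_square)
      finally show ?thesis unfolding avg_def .
    qed
    then have "?E (\<lambda>A. (avg loss A)\<^sup>2) \<le> ?E (avg (\<lambda>A. (loss A)\<^sup>2))"
      by (intro bexp_mono J_bl_nonneg) auto
    then show ?thesis unfolding avgE .
  qed
  have "?E (\<lambda>A. (D' A - mu)\<^sup>2) \<le> ?E (\<lambda>A. 3 / 2 * (avg D A - mu)\<^sup>2 + (6 * (avg loss A)\<^sup>2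
      + 6 * of_bool (\<not> linked n (n + r) D a A)))"
  proof (intro bexp_mono J_bl_nonneg)
    fix A
    define z where "z = avg T A - D' A"
    have z: "z\<^sup>2 \<le> of_bool (\<not> linked n (n + r) D a A)"
      unfolding z_def D'_eq using avgT[of A] by (auto simp: power_le_one)
    \<comment> \<open>The weight 3/2 is below 2, so that the variance still contracts after division
      by \<open>q\<close>; the factor 6 on the other squares is the price.\<close>
    have sq: "(x - y - z)\<^sup>2 \<le> 3 / 2 * x\<^sup>2 + (6 * y\<^sup>2 + 6 * z\<^sup>2)" for x y :: real
    proof -
      have "3 / 2 * x\<^sup>2 + (6 * y\<^sup>2 + 6 * z\<^sup>2) - (x - y - z)\<^sup>2 = (x + 2 * (y + z))\<^sup>2 / 2 + 3 * (y - z)\<^sup>2"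
        by (simp add: power2_eq_square field_simps)
      moreover have "0 \<le> (x + 2 * (y + z))\<^sup>2 / 2 + 3 * (y - z)\<^sup>2" by simp
      ultimately show ?thesis by linarith
    qed
    have "(D' A - mu)\<^sup>2 = ((avg D A - mu) - avg loss A - z)\<^sup>2"
      by (simp add: z_def avg_T)
    also have "\<dots> \<le> 3 / 2 * (avg D A - mu)\<^sup>2 + (6 * (avg loss A)\<^sup>2 + 6 * z\<^sup>2)"
      by (rule sq)
    also have "\<dots> \<le> 3 / 2 * (avg D A - mu)\<^sup>2 + (6 * (avg loss A)\<^sup>2
      + 6 * of_bool (\<not> linked n (n + r) D a A))" using z by simp
    finally show "(D' A - mu)\<^sup>2 \<le> 3 / 2 * (avg D A - mu)\<^sup>2 + (6 * (avg loss A)\<^sup>2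
      + 6 * of_bool (\<not> linked n (n + r) D a A))" .
  qed
  also have "\<dots> = 3 / 2 * ?E (\<lambda>A. (avg D A - mu)\<^sup>2) + (6 * ?E (\<lambda>A. (avg loss A)\<^sup>2) + 6 * f)"
    by (simp only: bexp_add bexp_cmult f_def)
  also have "\<dots> \<le> 3 / 2 * ?e (\<lambda>A. (D A - mu)\<^sup>2) / q ^ r + 6 * ?e (\<lambda>A. (loss A)\<^sup>2) + 6 * f"
    using loss_le var by simp
  finally show "?E (\<lambda>A. (D' A - mu)\<^sup>2) \<le> 3 / 2 * ?e (\<lambda>A. (D A - mu)\<^sup>2) / q ^ r + 6 * ?e (\<lambda>A. (loss A)\<^sup>2) + 6 * f" .
qed

end

section \<open>Recursion over the scales by means of a potential\<close>

context hlattice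
begin

text \<open>The weight \<open>2 / (27 * a)\<close> is chosen such that the loss \<open>V / (81 * a)\<close> of the mean in one merging
  step is paid for by the decrease of the variance from \<open>V\<close> to \<open>5 / 6 * V\<close>.\<close>
definition potential :: "(hvert set \<Rightarrow> real) \<Rightarrow> real \<Rightarrow> nat \<Rightarrow> (hvert set set \<Rightarrow> real) \<Rightarrow> real" where
  "potential J a n D = bexp J (edges (bl n)) D
     - 2 / (27 * a) * bexp J (edges (bl n)) (\<lambda>A. (D A - bexp J (edges (bl n)) D)\<^sup>2)"

text \<open>The hypothesis on the family at one parameter, in terms of levels: at length
  \<open>L ^ m\<close> the critical function is of order \<open>ln m / q ^ (2 * m)\<close>.\<close>

definition large_kernel :: "(hvert set \<Rightarrow> real) \<Rightarrow> bool" where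
  "large_kernel J \<longleftrightarrow> (\<forall>K. \<exists>m. \<forall>u\<in>H. \<forall>v\<in>H. u \<noteq> v \<longrightarrow> m \<le> hlev u v \<longrightarrow>
     K * ln (hlev u v) / (real (q ^ hlev u v))\<^sup>2 \<le> J {u, v})"

lemma bl_not_agree:
  assumes "u \<in> bl N" "v \<in> bl N" "\<not> hagree n u v"
  shows "u \<in> H" "v \<in> H" "u \<noteq> v" "n < hlev u v" "hlev u v \<le> N"
proof -
  show H: "u \<in> H" "v \<in> H" "u \<noteq> v" using assms by (auto simp: mem_hball)
  have "hagree N u v" using assms hagree_trans hagree_sym unfolding mem_hball by meson
  then show "n < hlev u v" "hlev u v \<le> N" using hagree_iff_hlev[OF H] assms(3) by auto
qed

end

context hkernel
begin

lemma bexp_var_le: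
  "bexp J (edges (bl n)) (\<lambda>A. (D A - bexp J (edges (bl n)) D)\<^sup>2) \<le> bexp J (edges (bl n)) (\<lambda>A. (D A - m)\<^sup>2)"
proof -
  let ?E = "bexp J (edges (bl n))"
  have *: "?E (\<lambda>A. (D A - x)\<^sup>2) = ?E (\<lambda>A. (D A)\<^sup>2) + x\<^sup>2 - 2 * x * ?E D" for x
  proof -
    have "?E (\<lambda>A. (D A - x)\<^sup>2) = ?E (\<lambda>A. (D A)\<^sup>2 + x\<^sup>2 - 2 * x * D A)"
      by (intro bexp_cong) (simp add: power2_diff)
    then show ?thesis by (simp add: bexp_diff bexp_add bexp_cmult)
  qed
  have "0 \<le> (?E D - m)\<^sup>2" by simp
  then show ?thesis unfolding * by (simp add: power2_eq_square algebra_simps)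
qed

text \<open>The mean is at least \<open>10 * a\<close>, so a value below the threshold is a
  deviation by \<open>9 * a\<close> and Chebyshev bounds the truncation losses by the variance
  \<open>V\<close>. The potential absorbs them, and only missing links cost anything.\<close>

lemma potential_step:
  fixes a jm \<phi> :: real
  assumes D: "scheme n D" and a: "0 < a" and \<phi>: "10 * a \<le> \<phi>" "\<phi> \<le> potential J a n D"
    and jm: "0 \<le> jm" "\<And>u v. u \<in> bl (n + 1) \<Longrightarrow> v \<in> bl (n + 1) \<Longrightarrow> \<not> hagree n u v \<Longrightarrow> jm \<le> J {u, v}"
  shows "\<phi> - (real q)\<^sup>2 * exp (- (a\<^sup>2 * (q ^ n)\<^sup>2 * jm)) * (1 + 1 / (2 * a)) \<le> potential J a (n + 1) (merge n 1 D a)"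
proof -
  let ?e = "bexp J (edges (bl n))" and ?E = "bexp J (edges (bl (n + 1)))"
  let ?D' = "merge n 1 D a"
  let ?l = "\<lambda>A. D A * of_bool (D A < a)"
  define mu where "mu = ?e D"
  define V where "V = ?e (\<lambda>A. (D A - mu)\<^sup>2)"
  define f where "f = ?E (\<lambda>A. of_bool (\<not> linked n (n + 1) D a A))"
  have V: "0 \<le> V" unfolding V_def by (intro bexp_nonneg J_bl_nonneg) auto
  have f0: "0 \<le> f" unfolding f_def by (intro bexp_nonneg J_bl_nonneg) auto
  have f: "f \<le> (real q)\<^sup>2 * exp (- (a\<^sup>2 * (q ^ n)\<^sup>2 * jm))"
    using bexp_not_linked[where r=1, OF D a jm] by (simp add: f_def)
  have potential_eq: "potential J a n D = mu - 2 / (27 * a) * V" by (simp add: potential_def mu_def V_def)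
  then have mu10: "10 * a \<le> mu" using \<phi> V a by (smt (verit) divide_nonneg_nonneg mult_nonneg_nonneg)
  have D0: "0 \<le> D A" if "A \<subseteq> edges (bl n)" for A using D that unfolding scheme_def by auto
  have cheb: "81 * a\<^sup>2 \<le> (D A - mu)\<^sup>2" if "D A < a" for A
  proof -
    have "9 * a \<le> mu - D A" using that mu10 by simp
    then have "(9 * a)\<^sup>2 \<le> (mu - D A)\<^sup>2" using a by (intro power_mono) auto
    then show ?thesis by (simp add: power_mult_distrib power2_commute)
  qed
  have l1: "?e ?l \<le> V / (81 * a)"
  proof -
    have "?e ?l \<le> ?e (\<lambda>A. (D A - mu)\<^sup>2 / (81 * a))"
    proof (intro bexp_mono J_bl_nonneg)
      fix A
      show "?l A \<le> (D A - mu)\<^sup>2 / (81 * a)"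
      proof (cases "D A < a")
        case True
        have "D A * (81 * a) \<le> a * (81 * a)" using True a by (intro mult_right_mono) auto
        also have "\<dots> \<le> (D A - mu)\<^sup>2" using cheb[OF True] by (simp add: power2_eq_square mult_ac)
        finally show ?thesis using True a by (simp add: pos_le_divide_eq)
      qed (use a in auto)
    qed
    then show ?thesis by (simp add: bexp_divide V_def)
  qed
  have l2: "?e (\<lambda>A. (?l A)\<^sup>2) \<le> V / 81"
  proof -
    have "?e (\<lambda>A. (?l A)\<^sup>2) \<le> ?e (\<lambda>A. (D A - mu)\<^sup>2 / 81)"
    proof (intro bexp_mono J_bl_nonneg)
      fix A assume A: "A \<subseteq> edges (bl n)"
      show "(?l A)\<^sup>2 \<le> (D A - mu)\<^sup>2 / 81"
      proof (cases "D A < a")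
        case True
        have "(D A)\<^sup>2 \<le> a\<^sup>2" using True D0[OF A] by (intro power_mono) auto
        then show ?thesis using True cheb[OF True] by simp
      qed auto
    qed
    then show ?thesis by (simp add: bexp_divide V_def)
  qed
  have m1: "mu - V / (81 * a) - f \<le> ?E ?D'"
    using merge_moments(1)[OF D a, of 1] l1 unfolding mu_def f_def by linarith
  \<comment> \<open>The averaging leaves 3/4 and the truncation adds 6/81, together less than
    5/6.\<close>
  have m2: "?E (\<lambda>A. (?D' A - ?E ?D')\<^sup>2) \<le> 5 / 6 * V + 6 * f"
  proof -
    have "?E (\<lambda>A. (?D' A - ?E ?D')\<^sup>2) \<le> ?E (\<lambda>A. (?D' A - mu)\<^sup>2)" by (rule bexp_var_le)
    also have "\<dots> \<le> 3 / 2 * V / q ^ 1 + 6 * ?e (\<lambda>A. (?l A)\<^sup>2) + 6 * f"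
      using merge_moments(2)[OF D a, of 1] unfolding mu_def V_def f_def .
    also have "3 / 2 * V / q ^ 1 \<le> 3 / 4 * V"
    proof -
      have "3 / 2 * V / real q \<le> 3 / 2 * V / 2" using q_ge V by (intro divide_left_mono) auto
      then show ?thesis by simp
    qed
    finally show ?thesis using l2 V by linarith
  qed
  have "\<phi> - f * (1 + 1 / (2 * a)) \<le> mu - V / (81 * a) - f - 2 / (27 * a) * (5 / 6 * V + 6 * f)"
  proof -
    \<comment> \<open>The terms in \<open>V\<close> cancel exactly: 1/81 + (2/27) * (5/6) =
      2/27.\<close>
    have eq: "V / (81 * a) + 2 / (27 * a) * (5 / 6 * V + 6 * f) = 2 / (27 * a) * V + 4 / 9 * (f / a)"
      using a by (simp add: field_simps)
    have "f * (1 + 1 / (2 * a)) = f + 1 / 2 * (f / a)" using a by (simp add: field_simps)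
    moreover have "4 / 9 * (f / a) \<le> 1 / 2 * (f / a)" using f0 a by (intro mult_right_mono) auto
    ultimately show ?thesis using \<phi>(2) eq unfolding potential_eq by linarith
  qed
  also have "\<dots> \<le> ?E ?D' - 2 / (27 * a) * ?E (\<lambda>A. (?D' A - ?E ?D')\<^sup>2)"
  proof -
    have "2 / (27 * a) * ?E (\<lambda>A. (?D' A - ?E ?D')\<^sup>2) \<le> 2 / (27 * a) * (5 / 6 * V + 6 * f)"
      using m2 a by (intro mult_left_mono) auto
    then show ?thesis using m1 by linarith
  qed
  also have "\<dots> = potential J a (n + 1) ?D'" by (simp add: potential_def)
  finally show ?thesis
    using mult_right_mono[OF f, of "1 + 1 / (2 * a)"] a by (smt (verit) divide_nonneg_nonneg)
qed

text \<open>By transitivity the probability for the origin is the mean share of vertices in clusters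
  of density at least \<open>b\<close>; whenever \<open>D\<close> is at least \<open>b\<close>, this
  share is at least \<open>D\<close>.\<close>

lemma scheme_Pge:
  assumes D: "scheme N D" and b: "0 \<le> b"
  shows "bexp J (edges (bl N)) D - b \<le> bexp J (edges (bl N)) (\<lambda>A. of_bool (b * q ^ N \<le> card (cl A (bl N) horigin)))"
proof -
  let ?E = "bexp J (edges (bl N))"
  let ?f = "\<lambda>x A. of_bool (b * q ^ N \<le> card (cl A (bl N) x)) :: real"
  have Q: "0 < real (q ^ N)" using q_ge by simp
  have "?E (\<lambda>A. D A - b) \<le> ?E (\<lambda>A. (\<Sum>x\<in>bl N. ?f x A) / q ^ N)"
  proof (intro bexp_mono J_bl_nonneg)
    fix A assume A: "A \<subseteq> edges (bl N)"
    show "D A - b \<le> (\<Sum>x\<in>bl N. ?f x A) / q ^ N"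
    proof (cases "b \<le> D A")
      case True
      obtain y where y: "y \<in> bl N" "D A * q ^ N \<le> card (cl A (bl N) y)"
        using D A unfolding scheme_def by blast
      have "b * q ^ N \<le> D A * q ^ N" using True by (intro mult_right_mono) auto
      then have "b * q ^ N \<le> card (cl A (bl N) x)" if "x \<in> cl A (bl N) y" for x
        using cl_eq[OF that] y by simp
      then have "(\<Sum>x\<in>cl A (bl N) y. 1) = (\<Sum>x\<in>cl A (bl N) y. ?f x A)"
        by (intro sum.cong refl) simp
      also have "\<dots> \<le> (\<Sum>x\<in>bl N. ?f x A)"
        using cl_subset[OF y(1), of A] by (intro sum_mono2 finite_bl) auto
      finally have "D A * q ^ N \<le> (\<Sum>x\<in>bl N. ?f x A)" using y by simp
      then have "D A \<le> (\<Sum>x\<in>bl N. ?f x A) / q ^ N" using Q by (simp add: pos_le_divide_eq)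
      then show ?thesis using b by simp
    next
      case False
      moreover have "0 \<le> (\<Sum>x\<in>bl N. ?f x A) / q ^ N" by (intro divide_nonneg_nonneg sum_nonneg) auto
      ultimately show ?thesis by linarith
    qed
  qed
  also have "\<dots> = (\<Sum>x\<in>bl N. ?E (?f x)) / q ^ N" by (simp only: bexp_divide bexp_sum)
  also have "(\<Sum>x\<in>bl N. ?E (?f x)) = (\<Sum>x\<in>bl N. ?E (?f horigin))"
    by (intro sum.cong refl bexp_card_cl_transitive[OF J_inv, of _ N "\<lambda>k. of_bool (b * q ^ N \<le> k)"])
  also have "\<dots> / q ^ N = ?E (?f horigin)" using Q by (simp add: card_bl)
  finally show ?thesis by (simp add: bexp_diff)
qed

text \<open>\<open>potential_step\<close> is iterated one scale at a time. The constant in front of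
  the logarithm makes a missing link between scales \<open>k\<close> and \<open>k + 1\<close> cost
  \<open>B / (k + 1)\<^sup>2\<close>, which is summable.\<close>

lemma theta_pos_of_scheme:
  fixes a :: real
  assumes D: "scheme n1 D" and a: "0 < a" and potential1: "11 * a \<le> potential J a n1 D" and n1: "1 \<le> n1"
    and B: "(real q)\<^sup>2 * (1 + 1 / (2 * a)) \<le> a * n1"
    and large: "\<And>u v. u \<in> H \<Longrightarrow> v \<in> H \<Longrightarrow> u \<noteq> v \<Longrightarrow> n1 < hlev u v \<Longrightarrow>
      2 * (real q)\<^sup>2 / a\<^sup>2 * ln (hlev u v) / (real (q ^ hlev u v))\<^sup>2 \<le> J {u, v}"
  shows "0 < theta d L J"
proof -
  define B where "B = (real q)\<^sup>2 * (1 + 1 / (2 * a))"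
  have Bpos: "0 \<le> B" using a by (simp add: B_def)
  \<comment> \<open>The reserve \<open>B / N\<close> pays for all later losses, since
    \<open>B / (k + 1)\<^sup>2\<close> is at most \<open>B / k - B / (k + 1)\<close>. At
    \<open>n1\<close> it fits between \<open>10 * a\<close> and \<open>11 * a\<close>.\<close>
  have step: "\<exists>D. scheme N D \<and> 10 * a + B / N \<le> potential J a N D" if "n1 \<le> N" for N
    using that
  proof (induction N rule: dec_induct)
    case base
    have "B / n1 \<le> a" using B n1 unfolding B_def[symmetric] by (simp add: pos_divide_le_eq)
    then show ?case using D potential1 by (intro exI[of _ D]) auto
  next
    case (step k)
    then obtain D where D: "scheme k D" "10 * a + B / k \<le> potential J a k D" by blast
    have k: "1 \<le> k" using step n1 by simp
    define jm where "jm = 2 * ln (real (k + 1)) / (a\<^sup>2 * (real (q ^ k))\<^sup>2)"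
    have jm0: "0 \<le> jm" by (simp add: jm_def)
    have jm: "jm \<le> J {u, v}" if uv: "u \<in> bl (k + 1)" "v \<in> bl (k + 1)" "\<not> hagree k u v" for u v
    proof -
      note H = bl_not_agree[OF uv]
      then have lev: "hlev u v = k + 1" by simp
      have "jm = 2 * (real q)\<^sup>2 / a\<^sup>2 * ln (hlev u v) / (real (q ^ hlev u v))\<^sup>2"
        unfolding jm_def lev using q_ge by (simp add: power_mult_distrib)
      also have "\<dots> \<le> J {u, v}" using H step by (intro large) auto
      finally show ?thesis .
    qed
    have "10 * a + B / k - (real q)\<^sup>2 * exp (- (a\<^sup>2 * (q ^ k)\<^sup>2 * jm)) * (1 + 1 / (2 * a)) \<le> potential J a (k + 1) (merge k 1 D a)"
      using Bpos k by (intro potential_step[OF D(1) a _ D(2) jm0 jm]) auto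
    moreover have "(real q)\<^sup>2 * exp (- (a\<^sup>2 * (q ^ k)\<^sup>2 * jm)) * (1 + 1 / (2 * a)) = B / (real (k + 1))\<^sup>2"
    proof -
      have "a\<^sup>2 * (real (q ^ k))\<^sup>2 * jm = 2 * ln (real (k + 1))"
        unfolding jm_def using a q_ge by simp
      also have "\<dots> = ln ((real (k + 1))\<^sup>2)" by (simp add: ln_realpow)
      finally have "exp (- (a\<^sup>2 * (real (q ^ k))\<^sup>2 * jm)) = 1 / (real (k + 1))\<^sup>2"
        by (simp add: exp_minus inverse_eq_divide)
      then show ?thesis by (simp add: B_def)
    qed
    moreover have "B / (k + 1) \<le> B / k - B / (real (k + 1))\<^sup>2"
    proof -
      have "1 / (real k + 1)\<^sup>2 \<le> 1 / (real k * (real k + 1))"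
        using k unfolding power2_eq_square by (intro frac_le mult_right_mono) auto
      also have "\<dots> = 1 / real k - 1 / (real k + 1)"
        using k by (simp add: field_simps)
      finally have "1 / (real k + 1) + 1 / (real k + 1)\<^sup>2 \<le> 1 / real k" by simp
      from mult_left_mono[OF this Bpos] show ?thesis by (simp add: distrib_left add.commute)
    qed
    ultimately have "10 * a + B / (k + 1) \<le> potential J a (k + 1) (merge k 1 D a)" by linarith
    then show ?case using scheme_merge[OF D(1) a, of 1] by auto
  qed
  have "5 * a \<le> theta d L J"
  proof (rule theta_ge[OF J_nonneg])
    fix s :: nat
    obtain N0 where N0: "s / (5 * a) < real q ^ N0"
      using real_arch_pow[of "real q" "s / (5 * a)"] q_ge by auto
    define N where "N = max N0 n1"
    have "real q ^ N0 \<le> real q ^ N" using q_ge by (intro power_increasing) (auto simp: N_def)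
    then have "s / (5 * a) \<le> real q ^ N" using N0 by linarith
    then have s: "s \<le> 5 * a * q ^ N" using a by (simp add: field_simps)
    obtain D where D: "scheme N D" "10 * a + B / N \<le> potential J a N D" using step[of N] by (auto simp: N_def)
    have "potential J a N D \<le> bexp J (edges (bl N)) D"
    proof -
      have "0 \<le> bexp J (edges (bl N)) (\<lambda>A. (D A - bexp J (edges (bl N)) D)\<^sup>2)"
        by (intro bexp_nonneg J_bl_nonneg) auto
      then have "0 \<le> 2 / (27 * a) * bexp J (edges (bl N)) (\<lambda>A. (D A - bexp J (edges (bl N)) D)\<^sup>2)"
        using a by (intro mult_nonneg_nonneg) auto
      then show ?thesis unfolding potential_def by linarith
    qed
    then have "10 * a \<le> bexp J (edges (bl N)) D" using D(2) Bpos by (smt (verit) divide_nonneg_nonneg of_nat_0_le_iff)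
    then have "5 * a \<le> bexp J (edges (bl N)) (\<lambda>A. of_bool (5 * a * q ^ N \<le> card (cl A (bl N) horigin)))"
      using scheme_Pge[OF D(1), of "5 * a"] a by linarith
    also have "\<dots> \<le> cluster_tail J N s"
      unfolding cluster_tail_def
    proof (intro bexp_mono J_bl_nonneg)
      fix A
      show "of_bool (5 * a * q ^ N \<le> card (cl A (bl N) horigin)) \<le> (of_bool (s \<le> card (cl A (bl N) horigin)) :: real)"
        using s by (auto simp: of_bool_def)
    qed
    finally show "\<exists>N. 5 * a \<le> cluster_tail J N s" by blast
  qed
  then show ?thesis using a by linarith
qed

text \<open>A large mean yields a giant cluster only with some positive probability, far from
  concentration; a single merging over many scales makes the variance small. The constants 12 and 4
  exceed the 11 and 2 in \<open>theta_pos_of_scheme\<close> so that the kernel may be lowered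
  afterwards.\<close>

lemma scheme_start:
  assumes theta: "0 < theta d L J" and reg: "kregular d L J" and large: "large_kernel J"
  obtains a :: real and n1 D where "0 < a" "scheme n1 D" "12 * a \<le> potential J a n1 D" "1 \<le> n1"
    "(real q)\<^sup>2 * (1 + 1 / (2 * a)) \<le> a * n1"
    "\<And>u v. u \<in> H \<Longrightarrow> v \<in> H \<Longrightarrow> u \<noteq> v \<Longrightarrow> n1 < hlev u v \<Longrightarrow>
      4 * (real q)\<^sup>2 / a\<^sup>2 * ln (hlev u v) / (real (q ^ hlev u v))\<^sup>2 \<le> J {u, v}"
proof -
  obtain c :: real and N0 where c: "0 < c" "\<And>N. N0 \<le> N \<Longrightarrow> c * q ^ N \<le> mean_cluster N"
    using giant_expectation[OF theta reg] by blast
  have qpos: "0 < real q" using q_ge by simp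
  have mean_cluster_le: "mean_cluster N \<le> q ^ N" for N
    unfolding mean_cluster_def using card_cl_le by (intro bexp_le_const J_bl_nonneg) auto
  have c1: "c \<le> 1"
  proof -
    have "c * real (q ^ N0) \<le> 1 * real (q ^ N0)" using c(2)[of N0] mean_cluster_le[of N0] by simp
    then show ?thesis by (rule mult_right_le_imp_le) (use qpos in simp)
  qed
  \<comment> \<open>\<open>D\<close> below takes the value \<open>c / 2\<close> with probability at
    least \<open>c / 2\<close>, so its mean is at least
    \<open>c\<^sup>2 / 4 = 25 * a\<close>.\<close>
  define a where "a = c\<^sup>2 / 100"
  have a: "0 < a" using c by (simp add: a_def)
  have ac: "a \<le> c / 2" using c c1 mult_left_mono[of c 1 c] by (simp add: a_def power2_eq_square)
  define \<kappa> where "\<kappa> = 2 / (27 * a)"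
  have \<kappa>: "0 < \<kappa>" using a by (simp add: \<kappa>_def)
  \<comment> \<open>The variance left by averaging costs the potential at most
    \<open>\<kappa> * (3 / 2) * 9 * a\<^sup>2 = a\<close>, and \<open>\<eta>\<close> is such that
    missing links cost at most another \<open>a\<close>.\<close>
  obtain r where r: "(1 / real q) ^ r < 9 * a\<^sup>2"
    using real_arch_pow_inv[of "9 * a\<^sup>2" "1 / real q"] a q_ge by auto
  define \<eta> where "\<eta> = a / (1 + 6 * \<kappa>)"
  have \<eta>: "0 < \<eta>" using a \<kappa> by (simp add: \<eta>_def)
  define X where "X = \<bar>ln (\<eta> / (real (q ^ r))\<^sup>2)\<bar>"
  \<comment> \<open>Pairs in different \<open>n\<close>-blocks of \<open>bl (n + r)\<close> have
    weight at least \<open>K / (q ^ (n + r))\<^sup>2\<close>, which turns the exponent in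
    \<open>bexp_not_linked\<close> into \<open>X\<close> for every \<open>n\<close>. The 3 in the
    choice of \<open>n\<close> makes the logarithm of the level at least 1.\<close>
  define K where "K = X * (real (q ^ r))\<^sup>2 / a\<^sup>2"
  have K: "0 \<le> K" by (simp add: K_def X_def)
  obtain m1 where m1: "\<And>u v. u \<in> H \<Longrightarrow> v \<in> H \<Longrightarrow> u \<noteq> v \<Longrightarrow> m1 \<le> hlev u v \<Longrightarrow>
     K * ln (hlev u v) / (real (q ^ hlev u v))\<^sup>2 \<le> J {u, v}"
    using large unfolding large_kernel_def by meson
  obtain m2 where m2: "\<And>u v. u \<in> H \<Longrightarrow> v \<in> H \<Longrightarrow> u \<noteq> v \<Longrightarrow> m2 \<le> hlev u v \<Longrightarrow>
     4 * (real q)\<^sup>2 / a\<^sup>2 * ln (hlev u v) / (real (q ^ hlev u v))\<^sup>2 \<le> J {u, v}"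
    using large unfolding large_kernel_def by meson
  obtain m3 :: nat where m3: "(real q)\<^sup>2 * (1 + 1 / (2 * a)) / a < m3" using reals_Archimedean2 by blast
  define n where "n = Max {N0, m1, m2, m3, 3}"
  have n: "N0 \<le> n" "m1 \<le> n" "m2 \<le> n" "m3 \<le> n" "3 \<le> n" by (auto simp: n_def)
  define G where "G = (\<lambda>A. \<exists>x\<in>bl n. c / 2 * q ^ n \<le> card (cl A (bl n) x))"
  define D where "D = (\<lambda>A. c / 2 * of_bool (G A) :: real)"
  let ?e = "bexp J (edges (bl n))" and ?E = "bexp J (edges (bl (n + r)))"
  let ?D' = "merge n r D a"
  have D: "scheme n D"
    unfolding scheme_def
  proof (intro allI impI conjI)
    fix A
    show "0 \<le> D A" "D A \<le> 1" using c c1 by (auto simp: D_def)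
    show "\<exists>y\<in>bl n. D A * q ^ n \<le> card (cl A (bl n) y)"
    proof (cases "G A")
      case True
      then show ?thesis by (auto simp: D_def G_def)
    next
      case False
      then show ?thesis by (intro bexI[of _ horigin]) (auto simp: D_def)
    qed
  qed
  define mu where "mu = ?e D"
  have mu: "25 * a \<le> mu"
  proof -
    let ?p = "?e (\<lambda>A. of_bool (G A))"
    have "c * q ^ n \<le> mean_cluster n" using c(2) n by simp
    also have "mean_cluster n \<le> ?e (\<lambda>A. of_bool (G A) * real (q ^ n) + c / 2 * real (q ^ n))"
      unfolding mean_cluster_def
    proof (intro bexp_mono J_bl_nonneg)
      fix A
      show "real (card (cl A (bl n) horigin)) \<le> of_bool (G A) * real (q ^ n) + c / 2 * real (q ^ n)"
      proof (cases "G A")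
        case True
        have "0 \<le> c / 2 * q ^ n" using c by simp
        moreover have "of_bool (G A) = (1 :: real)" using True by simp
        ultimately show ?thesis using card_cl_le[of A n] by (simp only: mult_1)
      next
        case False
        then have "\<not> c / 2 * q ^ n \<le> card (cl A (bl n) horigin)" unfolding G_def using origin_bl by blast
        then show ?thesis using False by simp
      qed
    qed
    also have "\<dots> = (?p + c / 2) * q ^ n"
      by (simp add: bexp_add bexp_cmult_right distrib_right)
    finally have "c * q ^ n \<le> (?p + c / 2) * q ^ n" .
    then have "c \<le> ?p + c / 2" by (rule mult_right_le_imp_le) (use qpos in simp)
    then have "c / 2 * (c / 2) \<le> c / 2 * ?p" using c by (intro mult_left_mono) auto
    then show ?thesis unfolding mu_def D_def bexp_cmult a_def by (simp add: power2_eq_square)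
  qed
  have mu1: "mu \<le> 1"
    unfolding mu_def using D by (intro bexp_le_const J_bl_nonneg) (auto simp: scheme_def)
  have mu0: "0 \<le> mu" using mu a by simp
  have loss: "D A * of_bool (D A < a) = 0" for A using ac by (auto simp: D_def)
  define f where "f = ?E (\<lambda>A. of_bool (\<not> linked n (n + r) D a A))"
  have f: "f \<le> \<eta>"
  proof -
    define jm where "jm = K / (real (q ^ (n + r)))\<^sup>2"
    have "f \<le> (q ^ r)\<^sup>2 * exp (- (a\<^sup>2 * (q ^ n)\<^sup>2 * jm))"
      unfolding f_def
    proof (rule bexp_not_linked[OF D a])
      show "0 \<le> jm" using K by (simp add: jm_def)
      fix u v assume uv: "u \<in> bl (n + r)" "v \<in> bl (n + r)" "\<not> hagree n u v"
      note H = bl_not_agree[OF uv]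
      have "(1::real) \<le> ln (hlev u v)"
      proof -
        have "exp 1 \<le> (3::real)" by (rule exp_le)
        also have "\<dots> \<le> hlev u v" using H n by simp
        finally show ?thesis using H by (subst ln_ge_iff) auto
      qed
      moreover have "(real (q ^ hlev u v))\<^sup>2 \<le> (real (q ^ (n + r)))\<^sup>2"
        using H q_ge by (intro power_mono of_nat_mono power_increasing) auto
      ultimately have "jm \<le> K * ln (hlev u v) / (real (q ^ hlev u v))\<^sup>2"
        unfolding jm_def using K q_ge mult_left_mono[of 1 "ln (hlev u v)" K] by (intro frac_le) auto
      also have "\<dots> \<le> J {u, v}" using H n by (intro m1) auto
      finally show "jm \<le> J {u, v}" .
    qed
    also have "\<dots> = (real (q ^ r))\<^sup>2 * exp (- X)"
    proof -
      have "a\<^sup>2 * (real (q ^ n))\<^sup>2 * jm = X"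
        unfolding jm_def K_def using a qpos by (simp add: power_add power_mult_distrib)
      then show ?thesis by simp
    qed
    also have "(real (q ^ r))\<^sup>2 * exp (- X) \<le> (real (q ^ r))\<^sup>2 * (\<eta> / (real (q ^ r))\<^sup>2)"
    proof (intro mult_left_mono)
      have "exp (- X) \<le> exp (ln (\<eta> / (real (q ^ r))\<^sup>2))" by (simp add: X_def)
      then show "exp (- X) \<le> \<eta> / (real (q ^ r))\<^sup>2" using \<eta> qpos by simp
    qed auto
    also have "\<dots> = \<eta>" using qpos by simp
    finally show ?thesis .
  qed
  have m1': "mu - f \<le> ?E ?D'"
    using merge_moments(1)[OF D a, of r] unfolding mu_def f_def loss by simp
  have m2': "?E (\<lambda>A. (?D' A - ?E ?D')\<^sup>2) \<le> 3 / 2 * (1 / real q) ^ r + 6 * f"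
  proof -
    have V: "?e (\<lambda>A. (D A - mu)\<^sup>2) \<le> 1"
    proof (intro bexp_le_const J_bl_nonneg)
      fix A
      have "\<bar>D A - mu\<bar> \<le> 1" using c c1 mu0 mu1 by (auto simp: D_def)
      then show "(D A - mu)\<^sup>2 \<le> 1" by (simp add: abs_square_le_1)
    qed auto
    have "?E (\<lambda>A. (?D' A - ?E ?D')\<^sup>2) \<le> ?E (\<lambda>A. (?D' A - mu)\<^sup>2)" by (rule bexp_var_le)
    also have "\<dots> \<le> 3 / 2 * ?e (\<lambda>A. (D A - mu)\<^sup>2) / q ^ r + 6 * f"
      using merge_moments(2)[OF D a, of r] unfolding mu_def f_def loss by simp
    also have "3 / 2 * ?e (\<lambda>A. (D A - mu)\<^sup>2) / q ^ r \<le> 3 / 2 * 1 / q ^ r"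
      using V by (intro divide_right_mono mult_left_mono) auto
    finally show ?thesis by (simp add: power_divide)
  qed
  have potential: "12 * a \<le> potential J a (n + r) ?D'"
  proof -
    have "\<kappa> * ?E (\<lambda>A. (?D' A - ?E ?D')\<^sup>2) \<le> \<kappa> * (3 / 2 * (1 / real q) ^ r + 6 * f)"
      using m2' \<kappa> by (intro mult_left_mono) auto
    also have "\<dots> \<le> \<kappa> * (3 / 2 * (9 * a\<^sup>2) + 6 * f)"
      using r \<kappa> by (intro mult_left_mono) auto
    also have "\<dots> = a + 6 * \<kappa> * f"
      using a by (simp add: \<kappa>_def power2_eq_square field_simps)
    finally have "mu - f - a - 6 * \<kappa> * f \<le> potential J a (n + r) ?D'"
      using m1' unfolding potential_def \<kappa>_def[symmetric] by linarith
    moreover have "f * (1 + 6 * \<kappa>) \<le> a"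
      using mult_right_mono[OF f, of "1 + 6 * \<kappa>"] \<kappa> by (simp add: \<eta>_def)
    ultimately show ?thesis using mu a by (simp add: algebra_simps)
  qed
  show thesis
  proof (rule that[of a "n + r" ?D'])
    show "scheme (n + r) ?D'" by (rule scheme_merge[OF D a])
    have "(real q)\<^sup>2 * (1 + 1 / (2 * a)) \<le> m3 * a" using m3 a by (simp add: pos_divide_less_eq)
    also have "\<dots> \<le> real (n + r) * a" using n a by (intro mult_right_mono) auto
    finally show "(real q)\<^sup>2 * (1 + 1 / (2 * a)) \<le> a * real (n + r)" by (simp add: mult.commute)
    show "4 * (real q)\<^sup>2 / a\<^sup>2 * ln (hlev u v) / (real (q ^ hlev u v))\<^sup>2 \<le> J {u, v}"
      if "u \<in> H" "v \<in> H" "u \<noteq> v" "n + r < hlev u v" for u v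
      using that n by (intro m2) auto
  qed (use a potential n in auto)
qed

end

section \<open>Barriers between annuli\<close>

context hlattice
begin

text \<open>With radii at scales \<open>k\<^sup>2\<close> the gaps \<open>2 * k - 1\<close> make
  edges across a whole annulus summably rare, while \<open>ln (k\<^sup>2)\<close> is only
  \<open>2 * ln k\<close>, so that barriers keep a polynomial probability in
  \<open>k\<close>.\<close>

definition annulus :: "nat \<Rightarrow> hvert set" where
  "annulus k = bl (k\<^sup>2) - bl ((k - 1)\<^sup>2)"

definition small_at :: "nat \<Rightarrow> nat \<Rightarrow> hvert set set \<Rightarrow> hvert \<Rightarrow> bool" where
  "small_at s k A x \<longleftrightarrow> card (cl A (annulus k) x) \<le> s"

definition escape :: "nat \<Rightarrow> nat \<Rightarrow> hvert set set \<Rightarrow> bool" where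
  "escape N k A \<longleftrightarrow> (\<exists>u\<in>bl ((k - 1)\<^sup>2). \<exists>v\<in>bl N - bl (k\<^sup>2). {u, v} \<in> A)"

text \<open>If this fails, a small cluster of the annulus is left by at most one open edge and is a
  dead end for paths.\<close>

definition bridge :: "nat \<Rightarrow> nat \<Rightarrow> nat \<Rightarrow> hvert set set \<Rightarrow> bool" where
  "bridge s N k A \<longleftrightarrow> (\<exists>x\<in>annulus k. \<exists>x'\<in>annulus k. \<exists>y\<in>bl N - annulus k. \<exists>y'\<in>bl N - annulus k.
     x' \<in> cl A (annulus k) x \<and> small_at s k A x \<and> {x, y} \<noteq> {x', y'} \<and> {x, y} \<in> A \<and> {x', y'} \<in> A)"

text \<open>Edges at small clusters are permitted, as the absence of bridges takes care of them.
  Restricting to large clusters brings the factor \<open>\<delta>\<^sup>2\<close> into the exponent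
  of \<open>bexp_barrier\<close>.\<close>

definition barrier :: "nat \<Rightarrow> nat \<Rightarrow> hvert set set \<Rightarrow> bool" where
  "barrier s k A \<longleftrightarrow> (\<forall>x\<in>annulus k. \<forall>y\<in>annulus (k + 1).
     \<not> small_at s k A x \<longrightarrow> \<not> small_at s (k + 1) A y \<longrightarrow> {x, y} \<notin> A)"

lemma bl_sq_mono: "j \<le> k \<Longrightarrow> bl (j\<^sup>2) \<subseteq> bl (k\<^sup>2)"
  by (intro hball_mono power_mono) auto

lemma small_at_cl: "y \<in> cl A (annulus k) x \<Longrightarrow> small_at s k A y \<longleftrightarrow> small_at s k A x"
  by (simp add: small_at_def cl_eq)

text \<open>The closed set separating the origin from infinity: adjoin to \<open>bl (k\<^sup>2)\<close> the small clusters of the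
  outer annulus that touch a large one of the inner annulus, and drop the small clusters of the inner
  annulus that have an edge to the outer one.\<close>
lemma cl_confined:
  assumes N: "(k + 1)\<^sup>2 \<le> N" and A: "A \<subseteq> edges (bl N)"
    and esc: "\<not> escape N k A" "\<not> escape N (k + 1) A"
    and bri: "\<not> bridge s N k A" "\<not> bridge s N (k + 1) A"
    and bar: "barrier s k A"
  shows "cl A (bl N) horigin \<subseteq> bl ((k + 1)\<^sup>2)"
proof -
  let ?L0 = "bl ((k - 1)\<^sup>2)" and ?L1 = "bl (k\<^sup>2)" and ?L2 = "bl ((k + 1)\<^sup>2)"
  let ?A1 = "annulus k" and ?A2 = "annulus (k + 1)"
  have sub: "?L0 \<subseteq> ?L1" "?L1 \<subseteq> ?L2" "?L2 \<subseteq> bl N"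
    using bl_sq_mono[of "k - 1" k] bl_sq_mono[of k "k + 1"] hball_mono[OF N] by auto
  have A1: "?A1 = ?L1 - ?L0" and A2: "?A2 = ?L2 - ?L1" by (auto simp: annulus_def)
  define X where "X = {u \<in> ?A1. small_at s k A u \<and> (\<exists>w\<in>cl A ?A1 u. \<exists>y\<in>?A2. {w, y} \<in> A)}"
  define Y where "Y = {u \<in> ?A2. small_at s (k + 1) A u \<and>
    (\<exists>w\<in>cl A ?A2 u. \<exists>x\<in>?A1. \<not> small_at s k A x \<and> {w, x} \<in> A)}"
  have "cl A (bl N) horigin \<subseteq> (?L1 - X) \<union> Y"
  proof (rule cl_closed)
    have "horigin \<in> ?L0" by simp
    then show "horigin \<in> (?L1 - X) \<union> Y" using sub A1 unfolding X_def by auto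
    fix u v
    assume u: "u \<in> (?L1 - X) \<union> Y" "u \<in> bl N" and v: "v \<in> bl N" and uv: "u \<noteq> v" "{u, v} \<in> A"
    have vu: "{v, u} \<in> A" using uv(2) by (simp add: insert_commute)
    show "v \<in> (?L1 - X) \<union> Y"
    proof (cases "u \<in> Y")
      case uY: False
      then have uX: "u \<in> ?L1" "u \<notin> X" using u by auto
      show ?thesis
      proof (cases "v \<in> ?L1")
        case True
        \<comment> \<open>The cluster of a vertex of \<open>X\<close> is small and already has an
          exit into the outer annulus. Either \<open>u\<close> belongs to it and so to
          \<open>X\<close>, or the edge to \<open>u\<close> is a second exit.\<close>
        have "v \<notin> X"
        proof
          assume "v \<in> X"
          then obtain w y where w: "v \<in> ?A1" "small_at s k A v" "w \<in> cl A ?A1 v" "y \<in> ?A2" "{w, y} \<in> A"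
            unfolding X_def by auto
          have wA: "w \<in> ?A1" using w(3) cl_subset[OF w(1), of A] by auto
          show False
          proof (cases "u \<in> ?A1")
            case True
            then have "u \<in> cl A ?A1 v" using cl_step[of v A ?A1 v u] w(1) vu uv(1) by auto
            then have "u \<in> X" using True w small_at_cl cl_eq unfolding X_def by (metis (mono_tags, lifting) mem_Collect_eq)
            then show False using uX by simp
          next
            case False
            have "{v, u} \<noteq> {w, y}" using w(4) uX True A2 by (auto simp: doubleton_eq_iff)
            moreover have "u \<in> bl N - ?A1" "y \<in> bl N - ?A1" using False u w(4) A1 A2 sub by auto
            ultimately show False using bri(1) w wA vu unfolding bridge_def by blast
          qed
        qed
        then show ?thesis using True by simp
      next
        case vL1: False
        then have "v \<in> ?L2" using esc(2) uX uv v unfolding escape_def by auto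
        then have vA: "v \<in> ?A2" using vL1 A2 by simp
        have "u \<notin> ?L0" using esc(1) vL1 uv v unfolding escape_def by auto
        then have uA: "u \<in> ?A1" using uX A1 by simp
        have "\<not> small_at s k A u"
        proof
          assume "small_at s k A u"
          then have "u \<in> X" using uA vA uv(2) cl_self[of u A ?A1] unfolding X_def by blast
          then show False using uX by simp
        qed
        moreover from this have "small_at s (k + 1) A v" using bar uA vA uv(2) unfolding barrier_def by blast
        ultimately have "v \<in> Y" using vA uA vu cl_self[of v A ?A2] unfolding Y_def by blast
        then show ?thesis by simp
      qed
    next
      case uY: True
      then obtain w x where w: "u \<in> ?A2" "small_at s (k + 1) A u" "w \<in> cl A ?A2 u" "x \<in> ?A1"
        "\<not> small_at s k A x" "{w, x} \<in> A" unfolding Y_def by auto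
      have wA: "w \<in> ?A2" using w(3) cl_subset[OF w(1), of A] by auto
      \<comment> \<open>The small cluster of \<open>u\<close> already has the exit
        \<open>{w, x}\<close>, so any further one would form a bridge.\<close>
      have no: False if "v \<in> bl N - ?A2" "{u, v} \<noteq> {w, x}"
        using that bri(2) w wA uv(2) A1 A2 sub unfolding bridge_def by blast
      show ?thesis
      proof (cases "v \<in> ?L1")
        case True
        have "v \<notin> X"
        proof
          assume "v \<in> X"
          then have "small_at s k A v" unfolding X_def by simp
          then have "v \<noteq> x" using w by auto
          then have "{u, v} \<noteq> {w, x}" using wA True A2 by (auto simp: doubleton_eq_iff)
          then show False using no v True A2 by auto
        qed
        then show ?thesis using True by simp
      next
        case vL1: False
        show ?thesis
        proof (cases "v \<in> ?L2")
          case True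
          then have vA: "v \<in> ?A2" using vL1 A2 by simp
          then have vu: "v \<in> cl A ?A2 u" using cl_step[of u A ?A2 u v] w(1) uv by auto
          have "cl A ?A2 v = cl A ?A2 u" "small_at s (k + 1) A v"
            using cl_eq[OF vu] small_at_cl[OF vu, of s] w(2) by simp_all
          then have "v \<in> Y" using vA w unfolding Y_def by blast
          then show ?thesis by simp
        next
          case False
          have "{u, v} \<noteq> {w, x}" using wA w(4) False vL1 A1 A2 by (auto simp: doubleton_eq_iff)
          then show ?thesis using no v False A2 by auto
        qed
      qed
    qed
  qed
  also have "\<dots> \<subseteq> ?L2" using sub A2 unfolding Y_def by auto
  finally show ?thesis .
qed

lemma annulus_subset: "annulus k \<subseteq> bl (k\<^sup>2)"
  by (auto simp: annulus_def)

lemma finite_annulus [simp]: "finite (annulus k)"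
  by (simp add: annulus_def)

lemma small_at_local: "edges (annulus k) \<subseteq> E \<Longrightarrow> small_at s k (A \<inter> E) x \<longleftrightarrow> small_at s k A x"
  by (simp add: small_at_def cl_local)

lemma barrier_local:
  assumes "edges (annulus k \<union> annulus (k + 1)) \<subseteq> E"
  shows "barrier s k (A \<inter> E) \<longleftrightarrow> barrier s k A"
proof -
  have E: "edges (annulus k) \<subseteq> E" "edges (annulus (k + 1)) \<subseteq> E"
    using assms edges_mono[of "annulus k" "annulus k \<union> annulus (k + 1)"]
      edges_mono[of "annulus (k + 1)" "annulus k \<union> annulus (k + 1)"] by auto
  have "{x, y} \<in> E" if "x \<in> annulus k" "y \<in> annulus (k + 1)" for x y
  proof -
    have "x \<noteq> y" using that by (auto simp: annulus_def)
    then have "{x, y} \<in> edges (annulus k \<union> annulus (k + 1))" using that by auto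
    then show ?thesis using assms by auto
  qed
  then show ?thesis
    unfolding barrier_def small_at_local[OF E(1)] small_at_local[OF E(2)] by auto
qed

end

section \<open>First-moment bounds for escapes and bridges\<close>

context hkernel
begin

lemma sum_J_outside:
  assumes "u \<in> bl n" "n \<le> N"
  shows "(\<Sum>v\<in>bl N - bl n. J {u, v}) \<le> tau n"
proof -
  have "(\<Sum>v\<in>bl N - bl n. J {u, v}) = (\<Sum>v\<in>bl N - bl n. kpair J horigin v)"
    by (intro sum.cong refl kpair_outside[OF assms(1)]) (auto simp: mem_hball)
  then show ?thesis using tau_split[OF assms(2)] tau_nonneg[of N] by simp
qed

lemma bexp_escape:
  assumes "k\<^sup>2 \<le> N"
  shows "bexp J (edges (bl N)) (\<lambda>A. of_bool (escape N k A)) \<le> real (q ^ (k - 1)\<^sup>2) * tau (k\<^sup>2)"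
proof -
  let ?E = "bexp J (edges (bl N))" and ?L0 = "bl ((k - 1)\<^sup>2)" and ?F = "bl N - bl (k\<^sup>2)"
  have sub: "?L0 \<subseteq> bl (k\<^sup>2)" "bl (k\<^sup>2) \<subseteq> bl N" using bl_sq_mono[of "k - 1" k] hball_mono[OF assms] by auto
  have "?E (\<lambda>A. of_bool (escape N k A)) \<le> ?E (\<lambda>A. \<Sum>u\<in>?L0. \<Sum>v\<in>?F. of_bool ({u, v} \<in> A))"
  proof (intro bexp_mono J_bl_nonneg)
    fix A
    show "of_bool (escape N k A) \<le> (\<Sum>u\<in>?L0. \<Sum>v\<in>?F. of_bool ({u, v} \<in> A) :: real)"
    proof (cases "escape N k A")
      case True
      then obtain u v where uv: "u \<in> ?L0" "v \<in> ?F" "{u, v} \<in> A" unfolding escape_def by auto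
      have "1 = (of_bool ({u, v} \<in> A) :: real)" using uv by simp
      also have "\<dots> \<le> (\<Sum>v\<in>?F. of_bool ({u, v} \<in> A))"
        using uv by (intro member_le_sum) auto
      also have "\<dots> \<le> (\<Sum>u\<in>?L0. \<Sum>v\<in>?F. of_bool ({u, v} \<in> A))"
        using uv by (intro member_le_sum[of u ?L0 "\<lambda>u. \<Sum>v\<in>?F. of_bool ({u, v} \<in> A)"] sum_nonneg) auto
      finally show ?thesis using True by simp
    qed (auto intro!: sum_nonneg)
  qed
  also have "\<dots> = (\<Sum>u\<in>?L0. \<Sum>v\<in>?F. ?E (\<lambda>A. of_bool ({u, v} \<in> A)))"
    unfolding bexp_sum ..
  also have "\<dots> \<le> (\<Sum>u\<in>?L0. \<Sum>v\<in>?F. J {u, v})"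
    using sub by (intro sum_mono bexp_open_le) auto
  also have "\<dots> \<le> (\<Sum>u\<in>?L0. tau (k\<^sup>2))"
    using sub by (intro sum_mono sum_J_outside assms) auto
  finally show ?thesis by (simp add: card_bl)
qed

text \<open>Seen from \<open>x\<close>, the inner block consists of vertices of equal weight,
  bounded by \<open>kpair_le_tau\<close>; the part outside the annulus beyond \<open>x\<close> is a
  tail.\<close>

lemma sum_J_annulus:
  assumes "k\<^sup>2 \<le> N" "x \<in> annulus k"
  shows "(\<Sum>y\<in>bl N - annulus k. J {x, y}) \<le> 2 * tau ((k - 1)\<^sup>2)"
proof -
  let ?n = "(k - 1)\<^sup>2"
  have sub: "bl ?n \<subseteq> bl (k\<^sup>2)" "bl (k\<^sup>2) \<subseteq> bl N" using bl_sq_mono[of "k - 1" k] hball_mono[OF assms(1)] by auto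
  have eq: "bl N - annulus k = bl ?n \<union> (bl N - bl (k\<^sup>2))" using sub by (auto simp: annulus_def)
  have x: "x \<in> H - bl ?n" using assms(2) by (auto simp: annulus_def mem_hball)
  have "(\<Sum>y\<in>bl N - annulus k. J {x, y}) = (\<Sum>y\<in>bl ?n. J {x, y}) + (\<Sum>y\<in>bl N - bl (k\<^sup>2). J {x, y})"
    unfolding eq using sub by (intro sum.union_disjoint) auto
  also have "(\<Sum>y\<in>bl ?n. J {x, y}) = (\<Sum>y\<in>bl ?n. kpair J horigin x)"
    using kpair_outside[OF _ x] by (intro sum.cong refl) (simp add: insert_commute)
  also have "\<dots> \<le> tau ?n"
    using kpair_le_tau[OF x] q_ge by (simp add: card_bl field_simps)
  also have "(\<Sum>y\<in>bl N - bl (k\<^sup>2). J {x, y}) \<le> tau (k\<^sup>2)"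
    using assms annulus_subset by (intro sum_J_outside) auto
  also have "tau (k\<^sup>2) \<le> tau ?n" by (intro tau_antimono power_mono) auto
  finally show ?thesis by simp
qed

text \<open>The pairs with the inner block are counted from the inner block, which has far fewer
  vertices than the annulus. Summing \<open>sum_J_annulus\<close> over the annulus would lose a
  factor of the ratio of the volumes.\<close>

lemma sum_sum_J_annulus:
  assumes "k\<^sup>2 \<le> N"
  shows "(\<Sum>x\<in>annulus k. \<Sum>y\<in>bl N - annulus k. J {x, y})
    \<le> real (q ^ (k - 1)\<^sup>2) * tau ((k - 1)\<^sup>2) + real (q ^ k\<^sup>2) * tau (k\<^sup>2)"
proof -
  let ?n = "(k - 1)\<^sup>2"
  have sub: "bl ?n \<subseteq> bl (k\<^sup>2)" "bl (k\<^sup>2) \<subseteq> bl N" using bl_sq_mono[of "k - 1" k] hball_mono[OF assms] by auto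
  have eq: "bl N - annulus k = bl ?n \<union> (bl N - bl (k\<^sup>2))" using sub by (auto simp: annulus_def)
  have "(\<Sum>x\<in>annulus k. \<Sum>y\<in>bl N - annulus k. J {x, y})
    = (\<Sum>x\<in>annulus k. (\<Sum>y\<in>bl ?n. J {x, y}) + (\<Sum>y\<in>bl N - bl (k\<^sup>2). J {x, y}))"
    unfolding eq using sub by (intro sum.cong refl sum.union_disjoint) auto
  also have "\<dots> = (\<Sum>y\<in>bl ?n. \<Sum>x\<in>annulus k. J {y, x}) + (\<Sum>x\<in>annulus k. \<Sum>y\<in>bl N - bl (k\<^sup>2). J {x, y})"
    unfolding sum.distrib by (subst sum.swap) (simp add: insert_commute)
  also have "(\<Sum>y\<in>bl ?n. \<Sum>x\<in>annulus k. J {y, x}) \<le> (\<Sum>y\<in>bl ?n. tau ?n)"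
    unfolding annulus_def by (intro sum_mono sum_J_outside power_mono) auto
  also have "(\<Sum>x\<in>annulus k. \<Sum>y\<in>bl N - bl (k\<^sup>2). J {x, y}) \<le> (\<Sum>x\<in>bl (k\<^sup>2). tau (k\<^sup>2))"
  proof -
    have "(\<Sum>x\<in>annulus k. \<Sum>y\<in>bl N - bl (k\<^sup>2). J {x, y}) \<le> (\<Sum>x\<in>annulus k. tau (k\<^sup>2))"
      using annulus_subset assms by (intro sum_mono sum_J_outside) auto
    also have "\<dots> \<le> (\<Sum>x\<in>bl (k\<^sup>2). tau (k\<^sup>2))"
      using annulus_subset tau_nonneg by (intro sum_mono2) auto
    finally show ?thesis .
  qed
  finally show ?thesis by (simp add: card_bl)
qed

text \<open>The clusters of the annulus and the two exits involve disjoint edges. One exit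
  contributes its supremum over \<open>x\<close>, the other the full sum over \<open>x'\<close> and
  \<open>y'\<close>, and a vertex \<open>x'\<close> of a small cluster has at most \<open>s\<close>
  partners \<open>x\<close>.\<close>

lemma bexp_bridge:
  assumes k: "k\<^sup>2 \<le> N"
  shows "bexp J (edges (bl N)) (\<lambda>A. of_bool (bridge s N k A))
    \<le> s * (2 * tau ((k - 1)\<^sup>2)) * (real (q ^ (k - 1)\<^sup>2) * tau ((k - 1)\<^sup>2) + real (q ^ k\<^sup>2) * tau (k\<^sup>2))"
proof -
  let ?E = "bexp J (edges (bl N))" and ?A = "annulus k" and ?O = "bl N - annulus k"
  have sub: "?A \<subseteq> bl N" using annulus_subset hball_mono[OF k] by blast
  have esub: "edges ?A \<subseteq> edges (bl N)" using sub by (rule edges_mono)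
  let ?g = "\<lambda>x x' A. of_bool (x' \<in> cl A ?A x \<and> small_at s k A x) :: real"
  let ?h = "\<lambda>x x' y y' A. of_bool ({x, y} \<noteq> {x', y'}) * (?g x x' A * (of_bool ({x, y} \<in> A) * of_bool ({x', y'} \<in> A)))"
  have nonneg: "0 \<le> J {x, y}" if "x \<in> ?A" "y \<in> ?O" for x y
    using that sub by (intro J_bl_nonneg[of _ N]) auto
  have "?E (\<lambda>A. of_bool (bridge s N k A)) \<le> ?E (\<lambda>A. \<Sum>x\<in>?A. \<Sum>x'\<in>?A. \<Sum>y\<in>?O. \<Sum>y'\<in>?O. ?h x x' y y' A)"
  proof (intro bexp_mono J_bl_nonneg)
    fix A
    show "of_bool (bridge s N k A) \<le> (\<Sum>x\<in>?A. \<Sum>x'\<in>?A. \<Sum>y\<in>?O. \<Sum>y'\<in>?O. ?h x x' y y' A)"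
    proof (cases "bridge s N k A")
      case True
      then obtain x x' y y' where **: "x \<in> ?A" "x' \<in> ?A" "y \<in> ?O" "y' \<in> ?O"
        "x' \<in> cl A ?A x" "small_at s k A x" "{x, y} \<noteq> {x', y'}" "{x, y} \<in> A" "{x', y'} \<in> A"
        unfolding bridge_def by blast
      have "?h x x' y y' A = 1" using **(5-9) by simp
      note * = **(1-4) this
      have "1 \<le> (\<Sum>y'\<in>?O. ?h x x' y y' A)"
        unfolding *(5)[symmetric] using * by (intro member_le_sum) auto
      also have "\<dots> \<le> (\<Sum>y\<in>?O. \<Sum>y'\<in>?O. ?h x x' y y' A)"
        using * by (intro member_le_sum[of y ?O "\<lambda>y. \<Sum>y'\<in>?O. ?h x x' y y' A"] sum_nonneg) auto
      also have "\<dots> \<le> (\<Sum>x'\<in>?A. \<Sum>y\<in>?O. \<Sum>y'\<in>?O. ?h x x' y y' A)"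
        using * by (intro member_le_sum[of x' ?A "\<lambda>x'. \<Sum>y\<in>?O. \<Sum>y'\<in>?O. ?h x x' y y' A"] sum_nonneg) auto
      also have "\<dots> \<le> (\<Sum>x\<in>?A. \<Sum>x'\<in>?A. \<Sum>y\<in>?O. \<Sum>y'\<in>?O. ?h x x' y y' A)"
        using * by (intro member_le_sum[of x ?A "\<lambda>x. \<Sum>x'\<in>?A. \<Sum>y\<in>?O. \<Sum>y'\<in>?O. ?h x x' y y' A"] sum_nonneg) auto
      finally show ?thesis using True by simp
    next
      case False
      have "0 \<le> (\<Sum>x\<in>?A. \<Sum>x'\<in>?A. \<Sum>y\<in>?O. \<Sum>y'\<in>?O. ?h x x' y y' A)"
        by (intro sum_nonneg) auto
      then show ?thesis using False by simp
    qed
  qed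
  also have "\<dots> = (\<Sum>x\<in>?A. \<Sum>x'\<in>?A. \<Sum>y\<in>?O. \<Sum>y'\<in>?O. ?E (?h x x' y y'))"
    unfolding bexp_sum ..
  also have "\<dots> \<le> (\<Sum>x\<in>?A. \<Sum>x'\<in>?A. \<Sum>y\<in>?O. \<Sum>y'\<in>?O. ?E (?g x x') * (J {x, y} * J {x', y'}))"
  proof (intro sum_mono)
    fix x x' y y' assume xy: "x \<in> ?A" "x' \<in> ?A" "y \<in> ?O" "y' \<in> ?O"
    have g0: "0 \<le> ?E (?g x x')" by (intro bexp_nonneg J_bl_nonneg) auto
    show "?E (?h x x' y y') \<le> ?E (?g x x') * (J {x, y} * J {x', y'})"
    proof (cases "{x, y} = {x', y'}")
      case True
      then show ?thesis using g0 nonneg xy by simp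
    next
      case False
      have e: "{x, y} \<in> edges (bl N)" "{x', y'} \<in> edges (bl N)" "{x, y} \<notin> edges ?A" "{x', y'} \<notin> edges ?A"
        using xy sub by auto
      have "?E (?h x x' y y') = ?E (\<lambda>A. ?g x x' A * (of_bool ({x, y} \<in> A) * of_bool ({x', y'} \<in> A)))"
        using False by simp
      also have "\<dots> = ?E (?g x x') * ?E (\<lambda>A. of_bool ({x, y} \<in> A) * of_bool ({x', y'} \<in> A))"
        by (rule bexp_indep[of _ "edges ?A" "{{x, y}, {x', y'}}"])
          (use e esub in \<open>auto simp: cl_local small_at_local\<close>)
      also have "\<dots> \<le> ?E (?g x x') * (J {x, y} * J {x', y'})"
      proof (rule mult_left_mono[OF _ g0])
        have "?E (\<lambda>A. of_bool ({x, y} \<in> A) * of_bool ({x', y'} \<in> A)) = ?E (\<lambda>A. of_bool ({x, y} \<in> A)) * ?E (\<lambda>A. of_bool ({x', y'} \<in> A))"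
          by (rule bexp_indep[of _ "{{x, y}}" "{{x', y'}}"]) (use e False in auto)
        also have "\<dots> \<le> J {x, y} * J {x', y'}"
          using e nonneg xy by (intro mult_mono bexp_open_le bexp_nonneg J_bl_nonneg) auto
        finally show "?E (\<lambda>A. of_bool ({x, y} \<in> A) * of_bool ({x', y'} \<in> A)) \<le> J {x, y} * J {x', y'}" .
      qed
      finally show ?thesis .
    qed
  qed
  also have "\<dots> = (\<Sum>x\<in>?A. \<Sum>x'\<in>?A. ?E (?g x x') * ((\<Sum>y\<in>?O. J {x, y}) * (\<Sum>y'\<in>?O. J {x', y'})))"
    unfolding sum_product unfolding sum_distrib_left ..
  also have "\<dots> \<le> (\<Sum>x\<in>?A. \<Sum>x'\<in>?A. ?E (?g x x') * (2 * tau ((k - 1)\<^sup>2) * (\<Sum>y'\<in>?O. J {x', y'})))"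
  proof (intro sum_mono mult_left_mono mult_right_mono)
    fix x x' assume x: "x \<in> ?A" "x' \<in> ?A"
    show "(\<Sum>y\<in>?O. J {x, y}) \<le> 2 * tau ((k - 1)\<^sup>2)" using sum_J_annulus[OF k x(1)] .
    show "0 \<le> (\<Sum>y'\<in>?O. J {x', y'})" using nonneg[OF x(2)] by (rule sum_nonneg)
    show "0 \<le> ?E (?g x x')" by (intro bexp_nonneg J_bl_nonneg) auto
  qed
  also have "\<dots> = (\<Sum>x'\<in>?A. (2 * tau ((k - 1)\<^sup>2) * (\<Sum>y'\<in>?O. J {x', y'})) * (\<Sum>x\<in>?A. ?E (?g x x')))"
    by (subst sum.swap) (simp only: sum_distrib_right[symmetric] mult.commute)
  also have "\<dots> \<le> (\<Sum>x'\<in>?A. (2 * tau ((k - 1)\<^sup>2) * (\<Sum>y'\<in>?O. J {x', y'})) * s)"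
  proof (intro sum_mono mult_left_mono)
    fix x' assume x': "x' \<in> ?A"
    have "(\<Sum>x\<in>?A. ?E (?g x x')) = ?E (\<lambda>A. \<Sum>x\<in>?A. ?g x x' A)" by (simp only: bexp_sum)
    also have "\<dots> \<le> s"
    proof (intro bexp_le_const J_bl_nonneg)
      fix A
      have "(\<Sum>x\<in>?A. ?g x x' A) = (\<Sum>x\<in>?A. of_bool (x \<in> cl A ?A x') * of_bool (small_at s k A x'))"
      proof (intro sum.cong refl)
        fix x show "?g x x' A = of_bool (x \<in> cl A ?A x') * of_bool (small_at s k A x')"
          using cl_sym[of x' A ?A x] small_at_cl[of x A k x' s] by auto
      qed
      also have "\<dots> = card (cl A ?A x') * of_bool (small_at s k A x')"
        unfolding sum_distrib_right[symmetric] card_cl_sum[OF finite_annulus x', symmetric] by simp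
      also have "\<dots> \<le> s" by (auto simp: small_at_def)
      finally show "(\<Sum>x\<in>?A. ?g x x' A) \<le> s" .
    qed auto
    finally show "(\<Sum>x\<in>?A. ?E (?g x x')) \<le> s" .
    show "0 \<le> 2 * tau ((k - 1)\<^sup>2) * (\<Sum>y'\<in>?O. J {x', y'})"
      using tau_nonneg nonneg x' by (intro mult_nonneg_nonneg sum_nonneg) auto
  qed
  also have "\<dots> = s * (2 * tau ((k - 1)\<^sup>2)) * (\<Sum>x'\<in>?A. \<Sum>y'\<in>?O. J {x', y'})"
    unfolding sum_distrib_left[symmetric] sum_distrib_right[symmetric] by (simp only: mult_ac)
  also have "\<dots> \<le> s * (2 * tau ((k - 1)\<^sup>2)) * (real (q ^ (k - 1)\<^sup>2) * tau ((k - 1)\<^sup>2) + real (q ^ k\<^sup>2) * tau (k\<^sup>2))"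
    using sum_sum_J_annulus[OF k] tau_nonneg by (intro mult_left_mono mult_nonneg_nonneg) auto
  finally show ?thesis .
qed

end

lemma edges_disjoint: "V \<inter> W = {} \<Longrightarrow> edges V \<inter> edges W = {}"
  by (auto simp: edges_def doubleton_eq_iff)

lemma summable_sq_geometric: "summable (\<lambda>k. real k ^ 2 * (1 / 2) ^ k)"
proof (rule summable_ratio_test[of "3 / 4" 5])
  fix k :: nat assume k: "5 \<le> k"
  have "5 * real k \<le> real k * real k" using k by (intro mult_right_mono) auto
  moreover have "5 \<le> real k" using k by simp
  ultimately have "2 + real k * 4 \<le> real k * real k" by linarith
  then have "(real k + 1)\<^sup>2 \<le> 3 / 2 * real k ^ 2"
    by (simp add: power2_eq_square algebra_simps)
  then have "(real k + 1)\<^sup>2 * (1 / 2) ^ k \<le> 3 / 2 * real k ^ 2 * (1 / 2) ^ k"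
    by (rule mult_right_mono) simp
  then show "norm (real (Suc k) ^ 2 * (1 / 2) ^ Suc k) \<le> 3 / 4 * norm (real k ^ 2 * (1 / 2) ^ k)"
    by (simp add: add.commute)
qed simp

text \<open>Squaring makes the product over integers of one parity telescope, as needed for barriers
  two steps apart.\<close>

lemma sq_one_minus_inverse_le:
  fixes x :: real
  assumes "1 \<le> x"
  shows "(1 - 1 / x)\<^sup>2 \<le> (x - 1) / (x + 1)"
proof -
  have "(1 - 1 / x)\<^sup>2 * (x + 1) = (x - 1) * ((x - 1) * (x + 1) / (x * x))"
    using assms by (simp add: field_simps power2_eq_square)
  also have "\<dots> \<le> (x - 1) * 1"
  proof (rule mult_left_mono)
    have "(x - 1) * (x + 1) \<le> x * x" by (simp add: algebra_simps)
    then show "(x - 1) * (x + 1) / (x * x) \<le> 1" using assms by (simp add: divide_le_eq)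
  qed (use assms in simp)
  finally show ?thesis using assms by (simp add: pos_le_divide_eq)
qed

section \<open>Frequency of barriers\<close>

context hkernel
begin

text \<open>Given the clusters inside both annuli, the edges between them are fresh. Jensen's
  inequality leaves the mean weight between large clusters, and as the annuli are independent each
  pair of vertices carries the factor \<open>\<delta> * \<delta>\<close>.\<close>

lemma bexp_barrier:
  assumes N: "(k + 1)\<^sup>2 \<le> N" and \<delta>: "cluster_tail J N (Suc s) \<le> \<delta>"
  shows "exp (- (\<delta>\<^sup>2 * (real (q ^ k\<^sup>2) * tau (k\<^sup>2)))) \<le> bexp J (edges (bl N)) (\<lambda>A. of_bool (barrier s k A))"
proof -
  let ?E = "bexp J (edges (bl N))" and ?A1 = "annulus k" and ?A2 = "annulus (k + 1)"
  have sub: "?A1 \<subseteq> bl (k\<^sup>2)" "?A2 \<subseteq> bl N - bl (k\<^sup>2)" "bl (k\<^sup>2) \<subseteq> bl N" "k\<^sup>2 \<le> N"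
  proof -
    show kN: "k\<^sup>2 \<le> N" using N power_mono[of k "k + 1" 2] by linarith
    show "?A1 \<subseteq> bl (k\<^sup>2)" by (rule annulus_subset)
    show "?A2 \<subseteq> bl N - bl (k\<^sup>2)" using hball_mono[OF N, of d L horigin] by (auto simp: annulus_def)
    show "bl (k\<^sup>2) \<subseteq> bl N" using kN by (rule hball_mono)
  qed
  have disj: "?A1 \<inter> ?A2 = {}" and inN: "?A1 \<subseteq> bl N" "?A2 \<subseteq> bl N" using sub by auto
  have nonneg: "0 \<le> J {x, y}" if "x \<in> ?A1" "y \<in> ?A2" for x y
    using that inN disj by (intro J_bl_nonneg[of _ N]) auto
  define C where "C = cut ?A1 ?A2"
  define R where "R = edges (bl N) - C"
  have CE: "C \<subseteq> edges (bl N)" using inN disj unfolding C_def cut_def by auto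
  have E: "edges (bl N) = R \<union> C" "finite R" "finite C" "R \<inter> C = {}"
    using CE unfolding R_def by (auto intro: finite_subset[OF CE])
  have e1: "edges ?A1 \<subseteq> R" and e2: "edges ?A2 \<subseteq> R"
  proof -
    have "edges ?A1 \<inter> C = {}" "edges ?A2 \<inter> C = {}"
      using disj unfolding C_def cut_def edges_def by (auto simp: doubleton_eq_iff)
    then show "edges ?A1 \<subseteq> R" "edges ?A2 \<subseteq> R"
      using edges_mono[OF inN(1)] edges_mono[OF inN(2)] unfolding R_def by auto
  qed
  define Z where "Z = (\<lambda>A. cut {x \<in> ?A1. \<not> small_at s k A x} {y \<in> ?A2. \<not> small_at s (k + 1) A y})"
  have ZC: "C \<inter> Z A = Z A" for A unfolding C_def Z_def cut_def by auto
  have Zl: "Z (A \<inter> R) = Z A" for A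
    unfolding Z_def small_at_local[OF e1] small_at_local[OF e2] ..
  have bar: "barrier s k A \<longleftrightarrow> A \<inter> Z A = {}" for A
    unfolding barrier_def Z_def cut_def by blast
  have big: "?E (\<lambda>A. of_bool (\<not> small_at s j A x)) \<le> \<delta>" if x: "x \<in> annulus j" and j: "annulus j \<subseteq> bl N" for j x
  proof -
    have xN: "x \<in> bl N" using x j by auto
    have "?E (\<lambda>A. of_bool (\<not> small_at s j A x)) \<le> ?E (\<lambda>A. of_bool (Suc s \<le> card (cl A (bl N) x)))"
    proof (intro bexp_mono J_bl_nonneg)
      fix A
      have "card (cl A (annulus j) x) \<le> card (cl A (bl N) x)"
        using j by (intro card_mono finite_cl finite_bl cl_mono) auto
      then show "of_bool (\<not> small_at s j A x) \<le> (of_bool (Suc s \<le> card (cl A (bl N) x)) :: real)"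
        by (auto simp: small_at_def)
    qed
    also have "\<dots> = cluster_tail J N (Suc s)"
      unfolding cluster_tail_def by (rule bexp_card_cl_transitive[OF J_inv xN, of "\<lambda>k. of_bool (Suc s \<le> k)"])
    finally show ?thesis using \<delta> by linarith
  qed
  have \<delta>0: "0 \<le> \<delta>"
  proof -
    have "0 \<le> cluster_tail J N (Suc s)" unfolding cluster_tail_def by (intro bexp_nonneg J_bl_nonneg) auto
    then show ?thesis using \<delta> by simp
  qed
  have eZ: "?E (\<lambda>A. \<Sum>e\<in>Z A. J e) \<le> \<delta>\<^sup>2 * (real (q ^ k\<^sup>2) * tau (k\<^sup>2))"
  proof -
    have "?E (\<lambda>A. \<Sum>e\<in>Z A. J e) = ?E (\<lambda>A. \<Sum>x\<in>?A1. \<Sum>y\<in>?A2.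
        J {x, y} * (of_bool (\<not> small_at s k A x) * of_bool (\<not> small_at s (k + 1) A y)))"
    proof (intro bexp_cong)
      fix A
      have "(\<Sum>e\<in>Z A. J e) = (\<Sum>x\<in>{x \<in> ?A1. \<not> small_at s k A x}. \<Sum>y\<in>{y \<in> ?A2. \<not> small_at s (k + 1) A y}. J {x, y})"
        unfolding Z_def using disj by (intro sum_cut) auto
      also have "\<dots> = (\<Sum>x\<in>?A1. of_bool (\<not> small_at s k A x) * (\<Sum>y\<in>?A2. of_bool (\<not> small_at s (k + 1) A y) * J {x, y}))"
      proof -
        have "(\<Sum>y\<in>{y \<in> ?A2. \<not> small_at s (k + 1) A y}. J {x, y}) = (\<Sum>y\<in>?A2. of_bool (\<not> small_at s (k + 1) A y) * J {x, y})" for x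
          by (intro sum.mono_neutral_cong_left) auto
        then show ?thesis by (simp only:) (intro sum.mono_neutral_cong_left; auto)
      qed
      finally show "(\<Sum>e\<in>Z A. J e) = (\<Sum>x\<in>?A1. \<Sum>y\<in>?A2.
        J {x, y} * (of_bool (\<not> small_at s k A x) * of_bool (\<not> small_at s (k + 1) A y)))"
        by (simp only: sum_distrib_left mult_ac)
    qed
    also have "\<dots> = (\<Sum>x\<in>?A1. \<Sum>y\<in>?A2. J {x, y} *
        ?E (\<lambda>A. of_bool (\<not> small_at s k A x) * of_bool (\<not> small_at s (k + 1) A y)))"
      unfolding bexp_sum bexp_cmult ..
    also have "\<dots> \<le> (\<Sum>x\<in>?A1. \<Sum>y\<in>?A2. J {x, y} * (\<delta> * \<delta>))"
    proof (intro sum_mono mult_left_mono nonneg)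
      fix x y assume xy: "x \<in> ?A1" "y \<in> ?A2"
      have "?E (\<lambda>A. of_bool (\<not> small_at s k A x) * of_bool (\<not> small_at s (k + 1) A y))
        = ?E (\<lambda>A. of_bool (\<not> small_at s k A x)) * ?E (\<lambda>A. of_bool (\<not> small_at s (k + 1) A y))"
        by (rule bexp_indep[OF _ edges_mono[OF inN(1)] edges_mono[OF inN(2)] edges_disjoint[OF disj]])
          (auto simp: small_at_local)
      also have "\<dots> \<le> \<delta> * \<delta>"
        using big xy inN \<delta>0 by (intro mult_mono bexp_nonneg J_bl_nonneg) auto
      finally show "?E (\<lambda>A. of_bool (\<not> small_at s k A x) * of_bool (\<not> small_at s (k + 1) A y)) \<le> \<delta> * \<delta>" .
    qed
    also have "\<dots> = \<delta>\<^sup>2 * (\<Sum>x\<in>?A1. \<Sum>y\<in>?A2. J {x, y})"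
      unfolding sum_distrib_right[symmetric] by (simp add: power2_eq_square)
    also have "\<dots> \<le> \<delta>\<^sup>2 * (\<Sum>x\<in>bl (k\<^sup>2). tau (k\<^sup>2))"
    proof (rule mult_left_mono)
      have "(\<Sum>x\<in>?A1. \<Sum>y\<in>?A2. J {x, y}) \<le> (\<Sum>x\<in>?A1. tau (k\<^sup>2))"
      proof (rule sum_mono)
        fix x assume x: "x \<in> ?A1"
        have "(\<Sum>y\<in>?A2. J {x, y}) \<le> (\<Sum>y\<in>bl N - bl (k\<^sup>2). J {x, y})"
          using sub x by (intro sum_mono2 J_bl_nonneg[of _ N]) auto
        also have "\<dots> \<le> tau (k\<^sup>2)" using sub x by (intro sum_J_outside) auto
        finally show "(\<Sum>y\<in>?A2. J {x, y}) \<le> tau (k\<^sup>2)" .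
      qed
      also have "\<dots> \<le> (\<Sum>x\<in>bl (k\<^sup>2). tau (k\<^sup>2))"
        using sub tau_nonneg by (intro sum_mono2) auto
      finally show "(\<Sum>x\<in>?A1. \<Sum>y\<in>?A2. J {x, y}) \<le> (\<Sum>x\<in>bl (k\<^sup>2). tau (k\<^sup>2))" .
    qed simp
    finally show ?thesis by (simp add: card_bl)
  qed
  have "exp (- (\<delta>\<^sup>2 * (real (q ^ k\<^sup>2) * tau (k\<^sup>2)))) \<le> exp (- ?E (\<lambda>A. \<Sum>e\<in>Z A. J e))"
    using eZ by simp
  also have "\<dots> \<le> ?E (\<lambda>A. exp (- (\<Sum>e\<in>Z A. J e)))"
    by (intro bexp_jensen_exp J_bl_nonneg) auto
  also have "\<dots> = bexp J (R \<union> C) (\<lambda>A. 1 * exp (- (\<Sum>e\<in>C \<inter> Z (A \<inter> R). J e)))"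
    unfolding E(1)[symmetric] Zl ZC by simp
  also have "\<dots> = bexp J (R \<union> C) (\<lambda>A. 1 * of_bool (A \<inter> C \<inter> Z (A \<inter> R) = {}))"
    using E by (intro bexp_no_open_cond[symmetric, where F="\<lambda>_. 1"]) auto
  also have "\<dots> = ?E (\<lambda>A. of_bool (barrier s k A))"
    unfolding E(1)[symmetric] Zl Int_assoc ZC bar by simp
  finally show ?thesis .
qed

text \<open>A barrier involves two consecutive annuli, so those at \<open>k0, k0 + 2, ...\<close>
  are independent. The squares of the failure probabilities are at most
  \<open>(k - 1) / (k + 1)\<close>, and their product telescopes.\<close>

lemma bexp_no_barrier:
  fixes k0 m N :: nat
  assumes "1 \<le> k0" "0 < m" "(k0 + 2 * m - 1)\<^sup>2 \<le> N"
    and p: "\<And>k. k0 \<le> k \<Longrightarrow> (k + 1)\<^sup>2 \<le> N \<Longrightarrow> 1 / k \<le> bexp J (edges (bl N)) (\<lambda>A. of_bool (barrier s k A))"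
  shows "(bexp J (edges (bl N)) (\<lambda>A. of_bool (\<forall>i<m. \<not> barrier s (k0 + 2 * i) A)))\<^sup>2 \<le> real (k0 - 1) / real (k0 + 2 * m - 1)"
  using assms(2,3)
proof (induction m)
  case (Suc m)
  let ?E = "bexp J (edges (bl N))" and ?k = "k0 + 2 * m"
  let ?P = "\<lambda>m. ?E (\<lambda>A. of_bool (\<forall>i<m. \<not> barrier s (k0 + 2 * i) A))"
  let ?p = "?E (\<lambda>A. of_bool (\<not> barrier s ?k A))"
  have kN: "(?k + 1)\<^sup>2 \<le> N" using Suc.prems by simp
  have m1: "(?k - 1)\<^sup>2 \<le> N"
  proof -
    have "(?k - 1)\<^sup>2 \<le> (?k + 1)\<^sup>2" by (intro power_mono) auto
    then show ?thesis using kN by linarith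
  qed
  have P0: "0 \<le> ?P m" "?P m \<le> 1" 
  proof -
    show "0 \<le> ?P m" by (intro bexp_nonneg J_bl_nonneg) auto
    show "?P m \<le> 1" by (intro bexp_le_const J_bl_nonneg) auto
  qed
  have k1: "1 \<le> real ?k" using assms(1) by simp
  have p0: "0 \<le> ?p" "?p \<le> 1 - 1 / ?k"
  proof -
    show "0 \<le> ?p" by (intro bexp_nonneg J_bl_nonneg) auto
    show "?p \<le> 1 - 1 / ?k" using p[of ?k] kN by (simp add: of_bool_not_iff bexp_diff)
  qed
  have eq: "?P (Suc m) = ?P m * ?p"
  proof -
    let ?V = "bl ((?k - 1)\<^sup>2)" and ?W = "annulus ?k \<union> annulus (?k + 1)"
    have "bl ((?k + 1)\<^sup>2) \<subseteq> bl N" "bl ((?k - 1)\<^sup>2) \<subseteq> bl N" "annulus ?k \<subseteq> bl ((?k + 1)\<^sup>2)"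
      "annulus (?k + 1) \<subseteq> bl ((?k + 1)\<^sup>2)"
      using annulus_subset[of ?k] annulus_subset[of "?k + 1"] bl_sq_mono[of ?k "?k + 1"]
        hball_mono[OF kN, of d L horigin] hball_mono[OF m1, of d L horigin] by auto
    then have sub: "?V \<subseteq> bl N" "?W \<subseteq> bl N" by auto
    have disj: "?V \<inter> ?W = {}"
      using bl_sq_mono[of "?k - 1" ?k] by (auto simp: annulus_def)
    have loc: "barrier s (k0 + 2 * i) (A \<inter> edges ?V) \<longleftrightarrow> barrier s (k0 + 2 * i) A" if "i < m" for i A
    proof (rule barrier_local, rule edges_mono)
      have "k0 + 2 * i + 1 \<le> ?k - 1" using that by simp
      then have "bl ((k0 + 2 * i + 1)\<^sup>2) \<subseteq> ?V" by (rule bl_sq_mono)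
      then show "annulus (k0 + 2 * i) \<union> annulus (k0 + 2 * i + 1) \<subseteq> ?V"
        using annulus_subset[of "k0 + 2 * i"] annulus_subset[of "k0 + 2 * i + 1"]
          bl_sq_mono[of "k0 + 2 * i" "k0 + 2 * i + 1"] by auto
    qed
    have "?P (Suc m) = ?E (\<lambda>A. of_bool (\<forall>i<m. \<not> barrier s (k0 + 2 * i) A) * of_bool (\<not> barrier s ?k A))"
      by (intro bexp_cong) (auto simp: less_Suc_eq)
    also have "\<dots> = ?P m * ?p"
    proof (rule bexp_indep[OF _ edges_mono[OF sub(1)] edges_mono[OF sub(2)] edges_disjoint[OF disj]])
      show "of_bool (\<forall>i<m. \<not> barrier s (k0 + 2 * i) A) = (of_bool (\<forall>i<m. \<not> barrier s (k0 + 2 * i) (A \<inter> edges ?V)) :: real)" for A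
        using loc by simp
      show "of_bool (\<not> barrier s ?k A) = (of_bool (\<not> barrier s ?k (A \<inter> edges ?W)) :: real)" for A
        using barrier_local[of ?k "edges ?W" s A] by simp
    qed auto
    finally show ?thesis .
  qed
  have sq: "(1 - 1 / real ?k)\<^sup>2 \<le> (real ?k - 1) / (real ?k + 1)"
    using k1 by (rule sq_one_minus_inverse_le)
  have "(?P (Suc m))\<^sup>2 = (?P m)\<^sup>2 * ?p\<^sup>2" unfolding eq by (rule power_mult_distrib)
  also have "\<dots> \<le> (?P m)\<^sup>2 * ((real ?k - 1) / (real ?k + 1))"
    using power_mono[OF p0(2,1), of 2] sq by (intro mult_left_mono) (linarith, simp)
  also have "\<dots> \<le> real (k0 - 1) / (real ?k + 1)"
  \<comment> \<open>The induction effectively starts at \<open>m = 1\<close>: for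
    \<open>k0 = 1\<close> the quotient at \<open>m = 0\<close> would be 0 / 0, which is 0.\<close>
  proof (cases "m = 0")
    case True
    then show ?thesis using assms(1) by (simp add: of_nat_diff)
  next
    case False
    then have "(?P m)\<^sup>2 \<le> real (k0 - 1) / real (?k - 1)" using Suc.IH m1 by auto
    then have "(?P m)\<^sup>2 * ((real ?k - 1) / (real ?k + 1)) \<le> real (k0 - 1) / real (?k - 1) * ((real ?k - 1) / (real ?k + 1))"
      using k1 by (intro mult_right_mono) auto
    also have "\<dots> = real (k0 - 1) / (real ?k + 1)"
      using False assms(1) by (simp add: of_nat_diff)
    finally show ?thesis .
  qed
  also have "real ?k + 1 = real (k0 + 2 * Suc m - 1)" by simp
  finally show ?case by simp
qed simp

definition dominated :: "real \<Rightarrow> bool" where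
  "dominated C \<longleftrightarrow> (\<exists>m. \<forall>u\<in>H. \<forall>v\<in>H. u \<noteq> v \<longrightarrow> m \<le> hlev u v \<longrightarrow>
     J {u, v} \<le> C * ln (hlev u v) / (real (q ^ hlev u v))\<^sup>2)"

text \<open>Takes the place of the convergence of \<open>tau N\<close> to 0: bounds on partial sums
  pass to the infinite sum.\<close>

lemma tau_le_infsum:
  assumes "\<And>N. n \<le> N \<Longrightarrow> tau n - tau N \<le> b"
  shows "tau n \<le> b"
  unfolding tau_def
proof (rule infsum_le_finite_sums[OF summable_kpair])
  fix F assume F: "finite F" "F \<subseteq> H - bl n"
  have "\<exists>N. F \<subseteq> bl N" using F
  proof (induction F rule: finite_induct)
    case (insert x F)
    then obtain N where "F \<subseteq> bl N" by auto
    moreover obtain M where "x \<in> bl M" using insert H_eq_Union by auto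
    ultimately have "insert x F \<subseteq> bl (max N M)"
      using hball_mono[of N "max N M" d L horigin] hball_mono[of M "max N M" d L horigin] by auto
    then show ?case by blast
  qed auto
  then obtain N where N: "F \<subseteq> bl N" ..
  define N' where "N' = max N n"
  have F': "F \<subseteq> bl N' - bl n" using N F hball_mono[of N N' d L horigin] by (auto simp: N'_def)
  have "sum (kpair J horigin) F \<le> sum (kpair J horigin) (bl N' - bl n)"
    using F' kpair_nonneg by (intro sum_mono2) (auto simp: mem_hball)
  also have "\<dots> = tau n - tau N'" using tau_split[of n N'] by (simp add: N'_def)
  also have "\<dots> \<le> b" by (rule assms) (simp add: N'_def)
  finally show "sum (kpair J horigin) F \<le> b" .
qed

text \<open>A geometric sum with slowly growing weights, by downward induction from
  \<open>N\<close>. The constant 4 reproduces itself because \<open>(1 + 4) * ln (n + 1) / q\<close>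
  is at most \<open>4 * ln n\<close> for \<open>2 \<le> q\<close> and
  \<open>3 \<le> n\<close>.\<close>

lemma tau_bound:
  assumes "dominated C" "0 \<le> C"
  obtains n0 where "\<And>n. n0 \<le> n \<Longrightarrow> real (q ^ n) * tau n \<le> 4 * C * ln n"
proof -
  obtain m where m: "\<And>u v. u \<in> H \<Longrightarrow> v \<in> H \<Longrightarrow> u \<noteq> v \<Longrightarrow> m \<le> hlev u v \<Longrightarrow>
     J {u, v} \<le> C * ln (hlev u v) / (real (q ^ hlev u v))\<^sup>2"
    using assms(1) unfolding dominated_def by meson
  have Q: "0 < real (q ^ n)" for n using q_ge by simp
  have step: "tau n - tau (Suc n) \<le> C * ln (Suc n) / real (q ^ Suc n)" if n: "m \<le> n" for n
  proof -
    have "tau n - tau (Suc n) = (\<Sum>y\<in>bl (Suc n) - bl n. kpair J horigin y)"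
      using tau_split[of n "Suc n"] by simp
    also have "\<dots> \<le> (\<Sum>y\<in>bl (Suc n) - bl n. C * ln (Suc n) / (real (q ^ Suc n))\<^sup>2)"
    proof (rule sum_mono)
      fix y assume y: "y \<in> bl (Suc n) - bl n"
      then have "horigin \<in> bl (Suc n)" "y \<in> bl (Suc n)" "\<not> hagree n horigin y" by (auto simp: mem_hball)
      note H = bl_not_agree[OF this]
      then have lev: "hlev horigin y = Suc n" by simp
      have "kpair J horigin y = J {horigin, y}" using H by (simp add: kpair_def)
      also have "\<dots> \<le> C * ln (Suc n) / (real (q ^ Suc n))\<^sup>2"
        using m[OF H(1,2,3)] lev n by simp
      finally show "kpair J horigin y \<le> C * ln (Suc n) / (real (q ^ Suc n))\<^sup>2" .
    qed
    also have "\<dots> \<le> (\<Sum>y\<in>bl (Suc n). C * ln (Suc n) / (real (q ^ Suc n))\<^sup>2)"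
      using assms(2) by (intro sum_mono2) auto
    also have "\<dots> = C * ln (Suc n) / real (q ^ Suc n)"
      using Q[of "Suc n"] unfolding sum_constant card_bl by (simp add: power2_eq_square)
    finally show ?thesis .
  qed
  define n0 where "n0 = max m 3"
  have ln_step: "5 * ln (Suc n) \<le> 8 * ln n" if "3 \<le> n" for n :: nat
  proof -
    have "exp 1 \<le> real n" using exp_le that by (meson numeral_le_real_of_nat_iff order_trans)
    then have ln1: "1 \<le> ln (real n)" using that by (subst ln_ge_iff) auto
    have "real (Suc n) = real n * (1 + 1 / n)" using that by (simp add: distrib_left)
    then have "ln (Suc n) = ln (real n * (1 + 1 / n))" by simp
    also have "\<dots> = ln (real n) + ln (1 + 1 / n)" using that by (intro ln_mult_pos) (auto intro: add_pos_nonneg)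
    also have "ln (1 + 1 / real n) \<le> 1 / n" by (rule ln_add_one_self_le_self) simp
    also have "1 / real n \<le> 1 / 3" using that by (intro divide_left_mono) auto
    finally show ?thesis using ln1 by linarith
  qed
  have partial: "tau n - tau N \<le> 4 * C * ln n / real (q ^ n)" if "n \<le> N" "n0 \<le> n" for n N
    using that
  proof (induction n rule: inc_induct)
    case base
    then have "0 \<le> ln (real N)" by (simp add: n0_def)
    then show ?case using assms(2) by simp
  next
    case (step n)
    have n3: "3 \<le> n" "m \<le> n" using step.prems by (auto simp: n0_def)
    have "tau n - tau N \<le> C * ln (Suc n) / real (q ^ Suc n) + 4 * C * ln (Suc n) / real (q ^ Suc n)"
      using \<open>\<And>n. m \<le> n \<Longrightarrow> tau n - tau (Suc n) \<le> _\<close>[OF n3(2)] step.IH step.prems by linarith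
    also have "\<dots> = C * (5 * ln (Suc n)) / (q * real (q ^ n))"
      by (simp add: add_divide_distrib[symmetric] algebra_simps)
    also have "\<dots> \<le> C * (8 * ln n) / (2 * real (q ^ n))"
      using ln_step[OF n3(1)] assms(2) q_ge Q[of n] n3 by (intro frac_le mult_left_mono mult_right_mono) auto
    also have "\<dots> = 4 * C * ln n / real (q ^ n)" by simp
    finally show ?case .
  qed
  have "real (q ^ n) * tau n \<le> 4 * C * ln n" if "n0 \<le> n" for n
  proof -
    have "tau n \<le> 4 * C * ln n / real (q ^ n)"
      using partial that by (intro tau_le_infsum) auto
    then show ?thesis using Q[of n] by (simp add: pos_le_divide_eq mult.commute)
  qed
  then show thesis using that by blast
qed

end

context hkernel
begin

text \<open>The 8 is the 4 of \<open>tau_bound\<close> times the 2 from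
  \<open>ln (k\<^sup>2)\<close>; under the hypothesis on \<open>\<delta>\<close> a barrier at
  \<open>k\<close> has probability at least \<open>1 / k\<close>, just enough for
  divergence.\<close>

lemma theta_zero_of_dominated:
  assumes dom: "dominated C" "0 \<le> C" and \<delta>: "\<And>N. cluster_tail J N (Suc s) \<le> \<delta>" "8 * C * \<delta>\<^sup>2 \<le> 1"
  shows "theta d L J = 0"
proof (rule ccontr)
  assume "theta d L J \<noteq> 0"
  then have pos: "0 < theta d L J" using theta_nonneg[of J] by simp
  define \<epsilon> where "\<epsilon> = theta d L J / 3"
  have \<epsilon>: "0 < \<epsilon>" using pos by (simp add: \<epsilon>_def)
  obtain n0 where n0: "\<And>n. n0 \<le> n \<Longrightarrow> real (q ^ n) * tau n \<le> 4 * C * ln n"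
    using tau_bound[OF dom] by blast
  \<comment> \<open>Escapes contribute \<open>8 * C\<close> and bridges
    \<open>s * (16 * C)\<^sup>2\<close>.\<close>
  define K where "K = 8 * C + 256 * s * C\<^sup>2"
  have K: "0 \<le> K" using dom(2) by (simp add: K_def)
  have "summable (\<lambda>k. K * (real k ^ 2 * (1 / 2) ^ k))"
    by (intro summable_mult summable_sq_geometric)
  then obtain k1 where k1: "\<And>m n. k1 \<le> m \<Longrightarrow> norm (\<Sum>k=m..<n. K * (real k ^ 2 * (1 / 2) ^ k)) < \<epsilon>"
    using \<epsilon> unfolding summable_Cauchy by meson
  define k0 where "k0 = max k1 (n0 + 3)"
  have k0: "k1 \<le> k0" "3 \<le> k0" "n0 + 1 \<le> k0" by (auto simp: k0_def)
  have u: "real (q ^ k\<^sup>2) * tau (k\<^sup>2) \<le> 8 * C * ln k" "real (q ^ (k - 1)\<^sup>2) * tau ((k - 1)\<^sup>2) \<le> 8 * C * ln k"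
    if k: "k0 \<le> k" for k
  proof -
    have k3: "3 \<le> k" "n0 \<le> k - 1" using k k0 by auto
    have sq: "x \<le> x\<^sup>2" for x :: nat by (simp add: power2_eq_square)
    have "real (q ^ k\<^sup>2) * tau (k\<^sup>2) \<le> 4 * C * ln (real (k\<^sup>2))"
      using k3 sq[of k] by (intro n0) linarith
    then show "real (q ^ k\<^sup>2) * tau (k\<^sup>2) \<le> 8 * C * ln k" using k3 by (simp add: ln_realpow)
    have "real (q ^ (k - 1)\<^sup>2) * tau ((k - 1)\<^sup>2) \<le> 4 * C * ln (real ((k - 1)\<^sup>2))"
      using k3 sq[of "k - 1"] by (intro n0) linarith
    also have "\<dots> = 8 * C * ln (real (k - 1))" using k3 by (simp add: ln_realpow)
    also have "\<dots> \<le> 8 * C * ln k" using k3 dom(2) by (intro mult_left_mono) auto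
    finally show "real (q ^ (k - 1)\<^sup>2) * tau ((k - 1)\<^sup>2) \<le> 8 * C * ln k" .
  qed
  have inv_q: "1 / real (q ^ n) \<le> (1 / 2) ^ n" for n
  proof -
    have "2 ^ n \<le> real q ^ n" using q_ge by (intro power_mono) auto
    then show ?thesis by (simp add: power_divide frac_le)
  qed
  have bad: "bexp J (edges (bl N)) (\<lambda>A. of_bool (escape N k A) + of_bool (bridge s N k A)) \<le> K * (real k ^ 2 * (1 / 2) ^ k)"
    if k: "k0 \<le> k" and kN: "k\<^sup>2 \<le> N" for k N
  proof -
    have k3: "3 \<le> k" using k k0 by auto
    have lnk: "0 \<le> ln (real k)" "ln (real k) \<le> k" using k3 ln_le_minus_one[of "real k"] by auto
    have Ck: "8 * C * ln k \<le> 8 * C * k" using lnk dom(2) by (intro mult_left_mono) auto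
    define Q where "Q = real (q ^ (k - 1)\<^sup>2)"
    have Q: "0 < Q" using q_ge by (simp add: Q_def)
    have e1: "(1 / 2 :: real) ^ (2 * k - 1) \<le> (1 / 2) ^ k" "(1 / 2 :: real) ^ (k - 1)\<^sup>2 \<le> (1 / 2) ^ k"
    proof -
      show "(1 / 2 :: real) ^ (2 * k - 1) \<le> (1 / 2) ^ k" using k3 by (intro power_decreasing) auto
      have "2 * (k - 1) \<le> (k - 1) * (k - 1)" using k3 by (intro mult_right_mono) auto
      moreover have "k \<le> 2 * (k - 1)" using k3 by simp
      ultimately have "k \<le> (k - 1)\<^sup>2" unfolding power2_eq_square by linarith
      then show "(1 / 2 :: real) ^ (k - 1)\<^sup>2 \<le> (1 / 2) ^ k" by (intro power_decreasing) auto
    qed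
    have kk: "(k - 1)\<^sup>2 + (2 * k - 1) = k\<^sup>2"
      using k3 by (cases k) (auto simp: power2_eq_square)
    have "bexp J (edges (bl N)) (\<lambda>A. of_bool (escape N k A)) \<le> Q * tau (k\<^sup>2)"
      using bexp_escape[OF kN] by (simp add: Q_def)
    also have "\<dots> = (real (q ^ k\<^sup>2) * tau (k\<^sup>2)) * (1 / real (q ^ (2 * k - 1)))"
      using q_ge unfolding Q_def kk[symmetric] by (simp add: power_add)
    also have "\<dots> \<le> (8 * C * k) * (1 / 2) ^ k"
    proof (rule mult_mono)
      show "real (q ^ k\<^sup>2) * tau (k\<^sup>2) \<le> 8 * C * k" using u(1)[OF k] Ck by linarith
      show "1 / real (q ^ (2 * k - 1)) \<le> (1 / 2) ^ k" using inv_q[of "2 * k - 1"] e1(1) by linarith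
    qed (use dom(2) in auto)
    also have "\<dots> \<le> (8 * C * real k ^ 2) * (1 / 2) ^ k"
      using k3 dom(2) by (intro mult_right_mono mult_left_mono) (auto simp: power2_eq_square)
    finally have 1: "bexp J (edges (bl N)) (\<lambda>A. of_bool (escape N k A)) \<le> (8 * C * real k ^ 2) * (1 / 2) ^ k" .
    have tq: "2 * tau ((k - 1)\<^sup>2) \<le> 16 * C * k * (1 / 2) ^ k"
    proof -
      have "tau ((k - 1)\<^sup>2) = (Q * tau ((k - 1)\<^sup>2)) * (1 / Q)" using Q by simp
      also have "\<dots> \<le> (8 * C * k) * (1 / 2) ^ k"
      proof (rule mult_mono)
        show "Q * tau ((k - 1)\<^sup>2) \<le> 8 * C * k" using u(2)[OF k] Ck by (simp add: Q_def)
        show "1 / Q \<le> (1 / 2) ^ k" using inv_q[of "(k - 1)\<^sup>2"] e1(2) unfolding Q_def by linarith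
      qed (use dom(2) Q in auto)
      finally show ?thesis by simp
    qed
    have "bexp J (edges (bl N)) (\<lambda>A. of_bool (bridge s N k A))
      \<le> s * (2 * tau ((k - 1)\<^sup>2)) * (real (q ^ (k - 1)\<^sup>2) * tau ((k - 1)\<^sup>2) + real (q ^ k\<^sup>2) * tau (k\<^sup>2))"
      by (rule bexp_bridge[OF kN])
    also have "\<dots> \<le> s * (16 * C * k * (1 / 2) ^ k) * (16 * C * k)"
    proof (rule mult_mono)
      show "s * (2 * tau ((k - 1)\<^sup>2)) \<le> s * (16 * C * k * (1 / 2) ^ k)"
        using tq by (rule mult_left_mono) simp
      show "real (q ^ (k - 1)\<^sup>2) * tau ((k - 1)\<^sup>2) + real (q ^ k\<^sup>2) * tau (k\<^sup>2) \<le> 16 * C * k"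
        using u[OF k] Ck by linarith
      show "0 \<le> real (q ^ (k - 1)\<^sup>2) * tau ((k - 1)\<^sup>2) + real (q ^ k\<^sup>2) * tau (k\<^sup>2)"
        using tau_nonneg by (intro add_nonneg_nonneg mult_nonneg_nonneg) auto
    qed (use tq dom(2) in auto)
    also have "\<dots> = (256 * s * C\<^sup>2) * (real k ^ 2 * (1 / 2) ^ k)"
      by (simp add: power2_eq_square)
    finally show ?thesis using 1 by (simp add: bexp_add K_def algebra_simps)
  qed
  obtain m :: nat where m: "real k0 / \<epsilon>\<^sup>2 < m" using reals_Archimedean2 by blast
  have m0: "0 < m" 
  proof -
    have "0 \<le> real k0 / \<epsilon>\<^sup>2" by simp
    then show ?thesis using m by linarith
  qed
  define K1 where "K1 = k0 + 2 * m"
  \<comment> \<open>More than the volume of \<open>bl (K1\<^sup>2)\<close>: a cluster of this size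
    has passed all the barriers, unless there is an escape or a bridge.\<close>
  define s' where "s' = Suc (q ^ K1\<^sup>2)"
  have "\<forall>\<^sub>F N in sequentially. 2 * \<epsilon> < cluster_tail J N s'"
    using \<epsilon> by (intro cluster_tail_eventually_ge J_nonneg) (auto simp: \<epsilon>_def)
  then obtain N where N: "K1\<^sup>2 \<le> N" "2 * \<epsilon> < cluster_tail J N s'"
    by (metis eventually_sequentially nle_le order_refl)
  have sqN: "j\<^sup>2 \<le> N" if "j \<le> K1" for j
    using power_mono[of j K1 2] that N(1) by linarith
  let ?E = "bexp J (edges (bl N))"
  let ?P = "\<lambda>A. of_bool (\<forall>i<m. \<not> barrier s (k0 + 2 * i) A) :: real"
  have "cluster_tail J N s' \<le> ?E (\<lambda>A. ?P A + (\<Sum>k=k0..<K1. of_bool (escape N k A) + of_bool (bridge s N k A)))"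
    unfolding cluster_tail_def
  proof (intro bexp_mono J_bl_nonneg)
    fix A assume A: "A \<subseteq> edges (bl N)"
    have nn: "0 \<le> (\<Sum>k=k0..<K1. of_bool (escape N k A) + of_bool (bridge s N k A) :: real)"
      by (intro sum_nonneg) auto
    show "of_bool (s' \<le> card (cl A (bl N) horigin)) \<le> ?P A + (\<Sum>k=k0..<K1. of_bool (escape N k A) + of_bool (bridge s N k A))"
    proof (cases "s' \<le> card (cl A (bl N) horigin) \<and> \<not> (\<forall>i<m. \<not> barrier s (k0 + 2 * i) A)")
      case True
      then obtain i where i: "i < m" "barrier s (k0 + 2 * i) A" by auto
      let ?k = "k0 + 2 * i"
      have kK: "?k + 1 < K1" using i by (simp add: K1_def)
      have "\<exists>k\<in>{k0..<K1}. escape N k A \<or> bridge s N k A"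
      proof (rule ccontr)
        assume no: "\<not> ?thesis"
        have "cl A (bl N) horigin \<subseteq> bl ((?k + 1)\<^sup>2)"
          using no kK sqN[of "?k + 1"] A i by (intro cl_confined) auto
        also have "\<dots> \<subseteq> bl (K1\<^sup>2)" using kK by (intro bl_sq_mono) auto
        finally have "card (cl A (bl N) horigin) \<le> q ^ K1\<^sup>2"
          using card_mono[OF finite_bl] card_bl by metis
        then show False using True by (simp add: s'_def)
      qed
      then obtain k where k: "k \<in> {k0..<K1}" "escape N k A \<or> bridge s N k A" by auto
      then have "1 \<le> (of_bool (escape N k A) + of_bool (bridge s N k A) :: real)" by auto
      also have "\<dots> \<le> (\<Sum>k=k0..<K1. of_bool (escape N k A) + of_bool (bridge s N k A))"
        using k by (intro member_le_sum) auto
      finally show ?thesis using True by simp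
    qed (use nn in auto)
  qed
  also have "\<dots> = ?E ?P + (\<Sum>k=k0..<K1. ?E (\<lambda>A. of_bool (escape N k A) + of_bool (bridge s N k A)))"
    by (simp only: bexp_add bexp_sum)
  also have "(\<Sum>k=k0..<K1. ?E (\<lambda>A. of_bool (escape N k A) + of_bool (bridge s N k A)))
      \<le> (\<Sum>k=k0..<K1. K * (real k ^ 2 * (1 / 2) ^ k))"
    using sqN by (intro sum_mono bad) auto
  also have "\<dots> < \<epsilon>" using k1[OF k0(1), of K1] by auto
  also have "?E ?P < \<epsilon>"
  proof -
    have p: "1 / k \<le> ?E (\<lambda>A. of_bool (barrier s k A))" if k: "k0 \<le> k" "(k + 1)\<^sup>2 \<le> N" for k
    proof -
      have lnk: "0 \<le> ln (real k)" using k k0 by simp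
      have "\<delta>\<^sup>2 * (real (q ^ k\<^sup>2) * tau (k\<^sup>2)) \<le> \<delta>\<^sup>2 * (8 * C * ln k)"
        using u(1)[OF k(1)] by (rule mult_left_mono) simp
      also have "\<dots> = (8 * C * \<delta>\<^sup>2) * ln k" by simp
      also have "\<dots> \<le> 1 * ln k" using \<delta>(2) lnk by (rule mult_right_mono)
      finally have "exp (- ln k) \<le> exp (- (\<delta>\<^sup>2 * (real (q ^ k\<^sup>2) * tau (k\<^sup>2))))" by simp
      also have "\<dots> \<le> ?E (\<lambda>A. of_bool (barrier s k A))"
        using k(2) \<delta>(1) by (rule bexp_barrier)
      finally show ?thesis using k k0 by (simp add: exp_minus inverse_eq_divide)
    qed
    have "(?E ?P)\<^sup>2 \<le> real (k0 - 1) / real (k0 + 2 * m - 1)"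
      using bexp_no_barrier[OF _ m0 _ p, of k0] k0 sqN[of "k0 + 2 * m - 1"] by (auto simp: K1_def)
    also have "\<dots> \<le> real k0 / real m" using m0 k0 by (intro frac_le) auto
    also have "\<dots> < \<epsilon>\<^sup>2" using m m0 \<epsilon> by (simp add: field_simps)
    finally show ?thesis by (rule power2_less_imp_less) (use \<epsilon> in simp)
  qed
  finally show False using N(2) by simp
qed

section \<open>Stability of the cluster size under an increase of the kernel\<close>

lemma sum_J_le_tau:
  assumes u: "u \<in> bl N"
  shows "(\<Sum>y\<in>bl N - {u}. J {u, y}) \<le> tau 0"
proof -
  have uH: "u \<in> H" using u by (simp add: mem_hball)
  have inj: "inj_on (htr L u) (bl N)" by (rule inj_htr_bl[OF uH])
  have img: "htr L u ` (bl N - {horigin}) = bl N - {u}"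
    using htr_bl[OF uH, of N] ball_eq_bl[OF u] htr_origin[OF uH] inj
    by (subst inj_on_image_set_diff[OF inj]) auto
  have "(\<Sum>y\<in>bl N - {u}. J {u, y}) = (\<Sum>z\<in>bl N - {horigin}. J {u, htr L u z})"
    unfolding img[symmetric] by (rule sum.reindex[unfolded comp_def]) (rule inj_on_subset[OF inj], auto)
  also have "\<dots> = (\<Sum>z\<in>bl N - {horigin}. J {horigin, z})"
  proof (intro sum.cong refl)
    fix z assume z: "z \<in> bl N - {horigin}"
    then have "{horigin, z} \<in> edges H" using hball_subset_hier[of d L N horigin] by auto
    from kernel_htr[OF J_inv uH this] show "J {u, htr L u z} = J {horigin, z}"
      using htr_origin[OF uH] by simp
  qed
  also have "\<dots> \<le> tau 0"
    using sum_J_outside[of horigin 0 N] hball_0[OF origin_H] by simp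
  finally show ?thesis .
qed

text \<open>The cluster is \<open>S\<close> iff \<open>S\<close> is connected within itself, an
  increasing event, and its boundary is closed. Raising the kernel favours the former and, for at
  most \<open>s\<close> vertices, multiplies the probability of the latter by no less than
  \<open>exp (- \<eta> * s * tau 0)\<close>. The bound is uniform in \<open>N\<close>, as
  semicontinuity in infinite volume requires.\<close>

lemma cluster_tail_perturb:
  assumes J': "\<And>e. e \<in> hedges d L \<Longrightarrow> J e \<le> J' e" "\<And>e. e \<in> hedges d L \<Longrightarrow> J' e \<le> (1 + \<eta>) * J e"
    and \<eta>: "0 \<le> \<eta>"
  shows "cluster_tail J' N (Suc s) \<le> cluster_tail J N (Suc s) + \<eta> * s * tau 0"
proof -
  let ?B = "bl N" and ?o = horigin
  define x where "x = \<eta> * s * tau 0"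
  have x: "0 \<le> x" using \<eta> tau_nonneg by (simp add: x_def)
  have J'0: "0 \<le> J' e" if "e \<in> edges ?B" for e
    using J_bl_nonneg[OF that] J'(1)[of e] that edges_bl_subset by force
  have J_le: "J e \<le> J' e" "J' e \<le> (1 + \<eta>) * J e" if "e \<in> edges ?B" for e
    using J' that edges_bl_subset by blast+
  let ?q = "\<lambda>J. bexp J (edges ?B) (\<lambda>A. of_bool (card (cl A ?B ?o) \<le> s))"
  have compl: "cluster_tail K N (Suc s) = 1 - ?q K" for K
  proof -
    have "cluster_tail K N (Suc s) = bexp K (edges ?B) (\<lambda>A. 1 - of_bool (card (cl A ?B ?o) \<le> s))"
      unfolding cluster_tail_def by (intro bexp_cong) auto
    then show ?thesis by (simp add: bexp_diff)
  qed
  have "exp (- x) * bexp J (edges ?B) (\<lambda>A. of_bool (cl A ?B ?o = S) * of_bool (card (cl A ?B ?o) \<le> s))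
      \<le> bexp J' (edges ?B) (\<lambda>A. of_bool (cl A ?B ?o = S) * of_bool (card (cl A ?B ?o) \<le> s))" if "S \<in> Pow ?B" for S
  proof (cases "?o \<in> S \<and> card S \<le> s")
    case False
    then have "(\<lambda>A. of_bool (cl A ?B ?o = S) * of_bool (card (cl A ?B ?o) \<le> s) :: real) = (\<lambda>_. 0)"
    proof (intro ext)
      fix A show "of_bool (cl A ?B ?o = S) * of_bool (card (cl A ?B ?o) \<le> s) = (0 :: real)"
        using cl_self[of ?o A ?B] False by auto
    qed
    then show ?thesis by (simp only:) simp
  next
    case True
    have S: "S \<subseteq> ?B" "finite S" using that finite_subset[OF _ finite_bl] by auto
    let ?C = "cut S (?B - S)"
    have C: "?C \<subseteq> edges ?B" "edges S \<subseteq> edges ?B" "edges S \<inter> ?C = {}"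
      using S by (auto simp: cut_def edges_def doubleton_eq_iff)
    have iff: "cl A ?B ?o = S \<longleftrightarrow> cl A S ?o = S \<and> A \<inter> ?C = {}" for A
    proof
      assume eq: "cl A ?B ?o = S"
      have "A \<inter> ?C = {}"
      proof (rule ccontr)
        assume "A \<inter> ?C \<noteq> {}"
        then obtain u v where "u \<in> S" "v \<in> ?B - S" "{u, v} \<in> A" by (auto simp: cut_def)
        then have "v \<in> cl A ?B ?o" using eq S by - (rule cl_step[of u], auto)
        then show False using eq \<open>v \<in> ?B - S\<close> by auto
      qed
      moreover have "cl A ?B ?o \<subseteq> S \<inter> cl A S ?o"
      proof (rule cl_closed)
        fix u v assume *: "u \<in> S \<inter> cl A S ?o" "u \<in> ?B" "v \<in> ?B" "u \<noteq> v" "{u, v} \<in> A"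
        have "v \<in> S" using cl_step[of u A ?B ?o v] * eq by auto
        then show "v \<in> S \<inter> cl A S ?o" using * cl_step[of u A S ?o v] by auto
      qed (use True in auto)
      moreover have "cl A S ?o \<subseteq> S" using True by (intro cl_subset) auto
      ultimately show "cl A S ?o = S \<and> A \<inter> ?C = {}" using eq by auto
    next
      assume *: "cl A S ?o = S \<and> A \<inter> ?C = {}"
      have "cl A ?B ?o \<subseteq> S"
      proof (rule cl_closed)
        fix u v assume uv: "u \<in> S" "u \<in> ?B" "v \<in> ?B" "u \<noteq> v" "{u, v} \<in> A"
        show "v \<in> S"
        proof (rule ccontr)
          assume "v \<notin> S"
          then have "{u, v} \<in> ?C" using uv unfolding cut_def by blast
          then show False using * uv by auto
        qed
      qed (use True in auto)
      moreover have "S \<subseteq> cl A ?B ?o" using * cl_mono[of A S A ?B ?o] S by auto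
      ultimately show "cl A ?B ?o = S" by auto
    qed
    have fact: "bexp K (edges ?B) (\<lambda>A. of_bool (cl A ?B ?o = S) * of_bool (card (cl A ?B ?o) \<le> s))
      = bexp K (edges ?B) (\<lambda>A. of_bool (cl A S ?o = S)) * exp (- (\<Sum>e\<in>?C. K e))" for K
    proof -
      have "bexp K (edges ?B) (\<lambda>A. of_bool (cl A ?B ?o = S) * of_bool (card (cl A ?B ?o) \<le> s))
        = bexp K (edges ?B) (\<lambda>A. of_bool (cl A S ?o = S) * of_bool (A \<inter> ?C = {}))"
      proof (intro bexp_cong)
        fix A
        show "of_bool (cl A ?B ?o = S) * of_bool (card (cl A ?B ?o) \<le> s)
            = (of_bool (cl A S ?o = S) * of_bool (A \<inter> ?C = {}) :: real)"
          using True iff[of A] by (cases "cl A ?B ?o = S") auto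
      qed
      also have "\<dots> = bexp K (edges ?B) (\<lambda>A. of_bool (cl A S ?o = S)) * bexp K (edges ?B) (\<lambda>A. of_bool (A \<inter> ?C = {}))"
        using C by (intro bexp_indep[of _ "edges S" ?C]) (auto simp: cl_local Int_assoc)
      finally show ?thesis using C by (simp add: bexp_no_open)
    qed
    have mono: "bexp J (edges ?B) (\<lambda>A. of_bool (cl A S ?o = S)) \<le> bexp J' (edges ?B) (\<lambda>A. of_bool (cl A S ?o = S))"
    proof (rule bexp_mono_weight)
      fix A B assume "A \<subseteq> (B :: hvert set set)"
      then have "cl A S ?o \<subseteq> cl B S ?o" by (intro cl_mono) auto
      moreover have "cl B S ?o \<subseteq> S" using True by (intro cl_subset) auto
      ultimately show "of_bool (cl A S ?o = S) \<le> (of_bool (cl B S ?o = S) :: real)" by auto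
    qed (use J_bl_nonneg J_le in auto)
    have "(\<Sum>e\<in>?C. J' e) \<le> (\<Sum>e\<in>?C. J e) + x"
    proof -
      have "(\<Sum>e\<in>?C. J e) = (\<Sum>u\<in>S. \<Sum>y\<in>?B - S. J {u, y})"
        using S by (intro sum_cut) auto
      also have "\<dots> \<le> (\<Sum>u\<in>S. tau 0)"
      proof (rule sum_mono)
        fix u assume u: "u \<in> S"
        have "(\<Sum>y\<in>?B - S. J {u, y}) \<le> (\<Sum>y\<in>?B - {u}. J {u, y})"
          using u S by (intro sum_mono2 J_bl_nonneg[of _ N]) auto
        also have "\<dots> \<le> tau 0" using u S by (intro sum_J_le_tau) auto
        finally show "(\<Sum>y\<in>?B - S. J {u, y}) \<le> tau 0" .
      qed
      also have "\<dots> \<le> s * tau 0" using True tau_nonneg[of 0] by (simp add: mult_right_mono)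
      finally have "\<eta> * (\<Sum>e\<in>?C. J e) \<le> x" using \<eta> unfolding x_def by (simp add: mult_left_mono mult.assoc)
      moreover have "(\<Sum>e\<in>?C. J' e) \<le> (\<Sum>e\<in>?C. J e) + \<eta> * (\<Sum>e\<in>?C. J e)"
        unfolding sum_distrib_left sum.distrib[symmetric]
        using C J_le by (intro sum_mono) (auto simp: distrib_right)
      ultimately show ?thesis by linarith
    qed
    then have "exp (- x) * exp (- (\<Sum>e\<in>?C. J e)) \<le> exp (- (\<Sum>e\<in>?C. J' e))"
      by (simp add: exp_add[symmetric])
    then have "bexp J (edges ?B) (\<lambda>A. of_bool (cl A S ?o = S)) * (exp (- x) * exp (- (\<Sum>e\<in>?C. J e)))
        \<le> bexp J' (edges ?B) (\<lambda>A. of_bool (cl A S ?o = S)) * exp (- (\<Sum>e\<in>?C. J' e))"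
      using J'0 by (intro mult_mono mono bexp_nonneg) auto
    then show ?thesis unfolding fact by (simp only: mult_ac)
  qed
  moreover have "?q K = (\<Sum>S\<in>Pow ?B. bexp K (edges ?B)
      (\<lambda>A. of_bool (cl A ?B ?o = S) * of_bool (card (cl A ?B ?o) \<le> s)))" for K
    by (rule bexp_cl_split) auto
  ultimately have "exp (- x) * ?q J \<le> ?q J'"
    by (simp only: sum_distrib_left sum_mono)
  moreover have "(1 - x) * ?q J \<le> exp (- x) * ?q J"
    using exp_ge_add_one_self[of "- x"] by (intro mult_right_mono bexp_nonneg J_bl_nonneg) auto
  moreover have "x * ?q J \<le> x * 1"
    using x by (intro mult_left_mono bexp_le_const J_bl_nonneg) auto
  ultimately have "?q J - x \<le> ?q J'" by (simp add: algebra_simps)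
  then show ?thesis unfolding compl x_def[symmetric] by simp
qed

end

section \<open>The phase transition\<close>

context hlattice
begin

section \<open>From asymptotic hypotheses on the family to bounds on kernels\<close>

lemma eventually_long_edges:
  "eventually P (long_edges d L) \<longleftrightarrow> (\<exists>m. \<forall>u\<in>H. \<forall>v\<in>H. u \<noteq> v \<longrightarrow> m \<le> hlev u v \<longrightarrow> P {u, v})"
proof
  assume "eventually P (long_edges d L)"
  then obtain m where m: "\<And>e. e \<in> hedges d L \<Longrightarrow> m \<le> elen L e \<Longrightarrow> P e"
    unfolding long_edges_def eventually_inf_principal eventually_filtercomap_at_top_linorder by auto
  have "P {u, v}" if "u \<in> H" "v \<in> H" "u \<noteq> v" "m \<le> hlev u v" for u v
  proof (rule m)
    have "hlev u v \<le> L ^ hlev u v" using L_ge by (intro less_imp_le power_gt_expt) auto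
    then show "m \<le> elen L {u, v}" using elen_eq that by simp
  qed (use that in \<open>simp add: hedges_edges\<close>)
  then show "\<exists>m. \<forall>u\<in>H. \<forall>v\<in>H. u \<noteq> v \<longrightarrow> m \<le> hlev u v \<longrightarrow> P {u, v}" by blast
next
  assume "\<exists>m. \<forall>u\<in>H. \<forall>v\<in>H. u \<noteq> v \<longrightarrow> m \<le> hlev u v \<longrightarrow> P {u, v}"
  then obtain m where m: "\<And>u v. u \<in> H \<Longrightarrow> v \<in> H \<Longrightarrow> u \<noteq> v \<Longrightarrow> m \<le> hlev u v \<Longrightarrow> P {u, v}" by blast
  have "P e" if e: "e \<in> hedges d L" and le: "L ^ m \<le> elen L e" for e
  proof -
    obtain u v where uv: "e = {u, v}" "u \<in> H" "v \<in> H" "u \<noteq> v" using e by (auto simp: hedges_def)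
    then have "m \<le> hlev u v" using le elen_eq[of u v] L_ge by simp
    then show ?thesis using m uv by blast
  qed
  then show "eventually P (long_edges d L)"
    unfolding long_edges_def eventually_inf_principal eventually_filtercomap_at_top_linorder
    by (intro exI[of _ "L ^ m"]) auto
qed

text \<open>At length \<open>L ^ m\<close> the function is
  \<open>ln (m * ln L) / q ^ (2 * m)\<close>; for \<open>m\<close> at least 4 and \<open>L\<close>
  the inner \<open>ln L\<close> costs no more than a factor 2 either way.\<close>

lemma crit_fun_bounds:
  assumes "max 4 L \<le> m"
  shows "ln m / 2 / (real (q ^ m))\<^sup>2 \<le> crit_fun d (real (L ^ m))"
    "crit_fun d (real (L ^ m)) \<le> 2 * ln m / (real (q ^ m))\<^sup>2" "0 < ln (real m)"
proof -
  have m: "4 \<le> m" "L \<le> m" using assms by auto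
  show "0 < ln (real m)" using m by simp
  have Q: "0 < real (q ^ m)" using q_ge by simp
  have "real (L ^ m) powr (- 2 * real d) = 1 / (real (q ^ m))\<^sup>2"
  proof -
    have "real (L ^ m) powr (2 * real d) = real (L ^ m) ^ (2 * d)"
      using L_ge by (subst powr_realpow[symmetric]) auto
    also have "\<dots> = (real (q ^ m))\<^sup>2"
      by (simp add: q_def power_mult[symmetric] mult_ac)
    finally show ?thesis by (simp add: powr_minus inverse_eq_divide)
  qed
  moreover have "ln (real (L ^ m)) = m * ln L" using L_ge by (simp add: ln_realpow)
  ultimately have crit: "crit_fun d (real (L ^ m)) = ln (m * ln L) / (real (q ^ m))\<^sup>2"
    by (simp add: crit_fun_def)
  have lnL: "1 / 2 \<le> ln (real L)" "ln (real L) \<le> m"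
  proof -
    have "2 / 3 \<le> ln (2 :: real)" by (rule ln2_ge_two_thirds)
    also have "\<dots> \<le> ln L" using L_ge by simp
    finally show "1 / 2 \<le> ln (real L)" by simp
    show "ln (real L) \<le> m" using ln_le_minus_one[of "real L"] L_ge m by simp
  qed
  have "ln m / 2 \<le> ln (m * ln L)"
  proof -
    have "sqrt m * 2 \<le> sqrt m * sqrt m"
      using m real_sqrt_le_mono[of 4 "real m"] by (intro mult_left_mono) auto
    then have "sqrt m \<le> m * (1 / 2)" by simp
    also have "\<dots> \<le> m * ln L" using lnL by (intro mult_left_mono) auto
    finally have "ln (sqrt m) \<le> ln (m * ln L)" using m by (intro ln_mono) auto
    then show ?thesis using m by (simp add: ln_sqrt)
  qed
  then show "ln m / 2 / (real (q ^ m))\<^sup>2 \<le> crit_fun d (real (L ^ m))"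
    unfolding crit by (rule divide_right_mono) simp
  have "ln (m * ln L) \<le> ln (real m * real m)"
    using lnL m by (intro ln_mono mult_left_mono mult_pos_pos) auto
  also have "\<dots> = 2 * ln m" using m by (simp add: ln_mult)
  finally show "crit_fun d (real (L ^ m)) \<le> 2 * ln m / (real (q ^ m))\<^sup>2"
    unfolding crit by (rule divide_right_mono) simp
qed

lemma fam_largeD:
  assumes "fam_large d L \<J> (crit_fun d)" "0 < t"
  shows "large_kernel (\<J> t)"
  unfolding large_kernel_def
proof
  fix K :: real
  have "\<infinity> \<le> Liminf (long_edges d L) (fam_ratio L \<J> (crit_fun d) t)"
    using assms unfolding fam_large_def by simp
  then have "eventually (\<lambda>e. ereal (2 * \<bar>K\<bar>) < fam_ratio L \<J> (crit_fun d) t e) (long_edges d L)"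
    unfolding le_Liminf_iff by simp
  then obtain m0 where m0: "\<And>u v. u \<in> H \<Longrightarrow> v \<in> H \<Longrightarrow> u \<noteq> v \<Longrightarrow> m0 \<le> hlev u v \<Longrightarrow>
      2 * \<bar>K\<bar> < \<J> t {u, v} / crit_fun d (real (elen L {u, v}))"
    unfolding eventually_long_edges fam_ratio_def less_ereal.simps by blast
  have "K * ln (hlev u v) / (real (q ^ hlev u v))\<^sup>2 \<le> \<J> t {u, v}"
    if uv: "u \<in> H" "v \<in> H" "u \<noteq> v" "max m0 (max 4 L) \<le> hlev u v" for u v
  proof -
    let ?m = "hlev u v"
    let ?f = "crit_fun d (real (L ^ ?m))"
    have b: "ln ?m / 2 / (real (q ^ ?m))\<^sup>2 \<le> ?f" "0 < ln (real ?m)"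
      using crit_fun_bounds[of ?m] uv(4) by auto
    have "0 < ln ?m / 2 / (real (q ^ ?m))\<^sup>2" using b(2) q_ge by simp
    then have f: "0 < ?f" using b(1) by linarith
    have "2 * \<bar>K\<bar> < \<J> t {u, v} / ?f" using m0[OF uv(1,2,3)] uv elen_eq by simp
    then have "2 * \<bar>K\<bar> * ?f \<le> \<J> t {u, v}" using f by (simp add: pos_less_divide_eq less_imp_le)
    moreover have "2 * \<bar>K\<bar> * (ln ?m / 2 / (real (q ^ ?m))\<^sup>2) \<le> 2 * \<bar>K\<bar> * ?f"
      using b(1) by (intro mult_left_mono) auto
    moreover have "K * (ln ?m / (real (q ^ ?m))\<^sup>2) \<le> \<bar>K\<bar> * (ln ?m / (real (q ^ ?m))\<^sup>2)"
      using b(2) by (intro mult_right_mono) auto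
    ultimately show ?thesis by simp
  qed
  then show "\<exists>m. \<forall>u\<in>H. \<forall>v\<in>H. u \<noteq> v \<longrightarrow> m \<le> hlev u v \<longrightarrow>
      K * ln (hlev u v) / (real (q ^ hlev u v))\<^sup>2 \<le> \<J> t {u, v}"
    by blast
qed

lemma ratio_upper:
  assumes "Limsup (long_edges d L) (fam_ratio L \<J> (crit_fun d) t) < ereal c" "0 \<le> c"
  shows "\<exists>m. \<forall>u\<in>H. \<forall>v\<in>H. u \<noteq> v \<longrightarrow> m \<le> hlev u v \<longrightarrow>
      \<J> t {u, v} \<le> 2 * c * ln (hlev u v) / (real (q ^ hlev u v))\<^sup>2"
proof -
  have "eventually (\<lambda>e. fam_ratio L \<J> (crit_fun d) t e < ereal c) (long_edges d L)"
    using Limsup_lessD[OF assms(1)] .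
  then obtain m0 where m0: "\<And>u v. u \<in> H \<Longrightarrow> v \<in> H \<Longrightarrow> u \<noteq> v \<Longrightarrow> m0 \<le> hlev u v \<Longrightarrow>
      \<J> t {u, v} / crit_fun d (real (elen L {u, v})) < c"
    unfolding eventually_long_edges fam_ratio_def less_ereal.simps by blast
  have "\<J> t {u, v} \<le> 2 * c * ln (hlev u v) / (real (q ^ hlev u v))\<^sup>2"
    if uv: "u \<in> H" "v \<in> H" "u \<noteq> v" "max m0 (max 4 L) \<le> hlev u v" for u v
  proof -
    let ?m = "hlev u v"
    let ?f = "crit_fun d (real (L ^ ?m))"
    have b: "ln ?m / 2 / (real (q ^ ?m))\<^sup>2 \<le> ?f" "?f \<le> 2 * ln ?m / (real (q ^ ?m))\<^sup>2" "0 < ln (real ?m)"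
      using crit_fun_bounds[of ?m] uv(4) by auto
    have "0 < ln ?m / 2 / (real (q ^ ?m))\<^sup>2" using b(3) q_ge by simp
    then have f: "0 < ?f" using b(1) by linarith
    have "\<J> t {u, v} / ?f < c" using m0[OF uv(1,2,3)] uv elen_eq by simp
    then have "\<J> t {u, v} \<le> c * ?f" using f by (simp add: pos_divide_less_eq less_imp_le)
    also have "\<dots> \<le> c * (2 * ln ?m / (real (q ^ ?m))\<^sup>2)" using b(2) assms(2) by (rule mult_left_mono)
    finally show ?thesis by (simp add: mult_ac)
  qed
  then show ?thesis by blast
qed

section \<open>Continuity in the parameter and the critical value\<close>

lemma proper_hkernel:
  assumes "proper_family d L \<J>" "0 < t"
  shows "hkernel d L (\<J> t)"
  using assms hlattice_axioms unfolding proper_family_def hkernel_def hkernel_axioms_def by simp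

lemma proper_mono:
  assumes "proper_family d L \<J>" "0 \<le> t" "t \<le> t'" "e \<in> hedges d L"
  shows "0 \<le> \<J> t e" "\<J> t e \<le> \<J> t' e"
  using assms unfolding proper_family_def fam_monotone_def by (auto dest!: bspec intro: mono_onD)

text \<open>The continuity assumption is uniform over the edges: the suprema of the ratios are
  continuous and at most 1 at \<open>tc\<close>, so nearby kernels agree up to a factor
  \<open>1 + \<eta>\<close>.\<close>

lemma proper_ratio:
  assumes J: "proper_family d L \<J>" and t: "0 < tc" and \<eta>: "0 < \<eta>"
  shows "\<forall>\<^sub>F t in at tc. \<forall>e\<in>hedges d L. \<J> t e \<le> (1 + \<eta>) * \<J> tc e \<and> \<J> tc e \<le> (1 + \<eta>) * \<J> t e"
proof -
  have le: "\<J> a e \<le> (1 + \<eta>) * \<J> b e"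
    if e: "e \<in> hedges d L" and ab: "0 < a" "0 < b" and fin: "\<bar>ratio_sup d L \<J> a b\<bar> \<noteq> \<infinity>"
      and r: "real_of_ereal (ratio_sup d L \<J> a b) < 1 + \<eta>" for a b e
  proof -
    have nn: "0 \<le> \<J> a e" "0 \<le> \<J> b e" using proper_mono(1)[OF J _ order_refl e] ab by auto
    have k: "kratio \<J> a b e \<le> ratio_sup d L \<J> a b"
      unfolding ratio_sup_def using e by (rule SUP_upper)
    show ?thesis
    proof (cases "\<J> b e = 0")
      case True
      then have "\<J> a e = 0" using k fin by (auto simp: kratio_def split: if_splits)
      then show ?thesis using True by simp
    next
      case False
      then have "ereal (\<J> a e / \<J> b e) \<le> ratio_sup d L \<J> a b" using k by (simp add: kratio_def)
      then have "\<J> a e / \<J> b e \<le> real_of_ereal (ratio_sup d L \<J> a b)"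
        using fin by (cases "ratio_sup d L \<J> a b") auto
      then have "\<J> a e / \<J> b e \<le> 1 + \<eta>" using r by linarith
      then show ?thesis using False nn by (simp add: pos_divide_le_eq)
    qed
  qed
  have "fam_continuous d L \<J>" using J by (simp add: proper_family_def)
  note cont = this[unfolded fam_continuous_def, THEN spec, THEN mp]
  have fin: "\<bar>ratio_sup d L \<J> a b\<bar> \<noteq> \<infinity>" if "0 < a" "0 < b" for a b
    using cont[OF that(2), THEN conjunct1] that(1) by simp
  have "ratio_sup d L \<J> tc tc \<le> 1"
    unfolding ratio_sup_def by (intro SUP_least) (auto simp: kratio_def one_ereal_def)
  then have one: "real_of_ereal (ratio_sup d L \<J> tc tc) < 1 + \<eta>"
    using \<eta> fin[OF t t] by (cases "ratio_sup d L \<J> tc tc") auto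
  have ev: "\<forall>\<^sub>F s in at tc. f s < 1 + \<eta>"
    if f: "continuous_on {0<..} f" "f tc < 1 + \<eta>" for f :: "real \<Rightarrow> real"
  proof -
    have "isCont f tc" using f(1) t by (simp add: continuous_on_eq_continuous_at)
    then have "(f \<longlongrightarrow> f tc) (at tc)" by (simp add: isCont_def)
    then show ?thesis using f(2) by (rule order_tendstoD(2))
  qed
  have "\<forall>\<^sub>F s in at tc. real_of_ereal (ratio_sup d L \<J> s tc) < 1 + \<eta>"
    "\<forall>\<^sub>F s in at tc. real_of_ereal (ratio_sup d L \<J> tc s) < 1 + \<eta>"
    using cont[OF t, THEN conjunct2] one by (auto intro!: ev)
  moreover have "\<forall>\<^sub>F s in at tc. 0 < s"
    using t eventually_at_in_open'[of "{0<..}" tc] by auto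
  ultimately show ?thesis
  proof eventually_elim
    case (elim s)
    show ?case
    proof (intro ballI conjI)
      fix e assume e: "e \<in> hedges d L"
      show "\<J> s e \<le> (1 + \<eta>) * \<J> tc e"
        by (rule le[OF e elim(3) t fin[OF elim(3) t] elim(1)])
      show "\<J> tc e \<le> (1 + \<eta>) * \<J> s e"
        by (rule le[OF e t elim(3) fin[OF t elim(3)] elim(2)])
    qed
  qed
qed

lemma proper_tendsto:
  assumes J: "proper_family d L \<J>" and t: "0 < tc" and e: "e \<in> hedges d L"
  shows "((\<lambda>t. \<J> t e) \<longlongrightarrow> \<J> tc e) (at tc)"
proof (rule tendstoI)
  fix \<epsilon> :: real assume \<epsilon>: "0 < \<epsilon>"
  have nn: "0 \<le> \<J> tc e" using proper_mono[OF J, of tc tc e] t e by simp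
  define \<eta> where "\<eta> = \<epsilon> / (\<J> tc e + 1)"
  have \<eta>: "0 < \<eta>" using \<epsilon> nn by (simp add: \<eta>_def)
  have \<eta>2: "\<eta> * \<J> tc e < \<epsilon>" using \<epsilon> nn by (simp add: \<eta>_def field_simps)
  show "\<forall>\<^sub>F t in at tc. dist (\<J> t e) (\<J> tc e) < \<epsilon>"
    using proper_ratio[OF J t \<eta>]
  proof eventually_elim
    case (elim s)
    then have s: "\<J> s e \<le> (1 + \<eta>) * \<J> tc e" "\<J> tc e \<le> (1 + \<eta>) * \<J> s e" using e by auto
    have up: "\<J> s e - \<J> tc e \<le> \<eta> * \<J> tc e" using s(1) by (simp add: algebra_simps)
    have "\<J> tc e - \<J> s e \<le> \<eta> * \<J> tc e"
    proof (cases "\<J> s e \<le> \<J> tc e")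
      case True
      then have "\<eta> * \<J> s e \<le> \<eta> * \<J> tc e" using \<eta> by simp
      then show ?thesis using s(2) by (simp add: algebra_simps)
    next
      case False
      have "0 \<le> \<eta> * \<J> tc e" using \<eta> nn by simp
      then show ?thesis using False by linarith
    qed
    then show ?case using up \<eta>2 by (simp add: dist_real_def)
  qed
qed

lemma nonperc0_theta:
  assumes J: "proper_family d L \<J>"
  obtains \<delta> where "0 < \<delta>" "\<And>t. 0 \<le> t \<Longrightarrow> t < \<delta> \<Longrightarrow> theta d L (\<J> t) = 0"
proof -
  obtain \<delta> where \<delta>: "0 < \<delta>" "\<And>t. 0 \<le> t \<Longrightarrow> t < \<delta> \<Longrightarrow> (\<Sum>\<^sub>\<infinity>e\<in>{e \<in> hedges d L. horigin \<in> e}. \<J> t e) < 1"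
    using J unfolding proper_family_def fam_nonperc0_def by blast
  have pos: "theta d L (\<J> t) = 0" if t: "0 < t" "t < \<delta>" for t
  proof -
    interpret hkernel d L "\<J> t" using proper_hkernel[OF J t(1)] .
    have inj: "inj_on (\<lambda>y. {horigin, y}) (H - bl 0)"
      using hball_0[OF origin_H] by (auto simp: inj_on_def doubleton_eq_iff)
    have "tau 0 = infsum (\<J> t \<circ> (\<lambda>y. {horigin, y})) (H - bl 0)"
      unfolding tau_def using hball_0[OF origin_H] by (intro infsum_cong) (auto simp: kpair_def)
    also have "\<dots> = infsum (\<J> t) ((\<lambda>y. {horigin, y}) ` (H - bl 0))"
      by (rule infsum_reindex[OF inj, symmetric])
    also have "(\<lambda>y. {horigin, y}) ` (H - bl 0) = {e \<in> hedges d L. horigin \<in> e}"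
      using star_image hball_0[OF origin_H] by simp
    finally have "tau 0 < 1" using \<delta>(2)[of t] t by simp
    then show ?thesis by (rule theta_zero_of_tau_less)
  qed
  \<comment> \<open>At parameter 0 neither invariance nor integrability is assumed, so it is
    compared with a positive parameter.\<close>
  have "theta d L (\<J> 0) \<le> theta d L (\<J> (\<delta> / 2))"
    using proper_mono[OF J] \<delta>(1) by (intro theta_mono) auto
  then have "theta d L (\<J> 0) = 0" using pos[of "\<delta> / 2"] \<delta>(1) theta_nonneg[of "\<J> 0"] by simp
  then have "theta d L (\<J> t) = 0" if "0 \<le> t" "t < \<delta>" for t
    using pos[of t] that by (cases "t = 0") auto
  then show thesis using \<delta>(1) that by blast
qed

lemma lambda_c_real:
  assumes J: "proper_family d L \<J>" and fin: "lambda_c d L \<J> < \<infinity>"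
  obtains tc where "0 < tc" "lambda_c d L \<J> = ereal tc"
    "\<And>t. 0 \<le> t \<Longrightarrow> t < tc \<Longrightarrow> theta d L (\<J> t) = 0"
    "\<And>\<epsilon>. 0 < \<epsilon> \<Longrightarrow> \<exists>t. tc \<le> t \<and> t < tc + \<epsilon> \<and> 0 < theta d L (\<J> t)"
proof -
  let ?T = "{t. 0 \<le> t \<and> theta d L (\<J> t) > 0}"
  obtain \<delta> where \<delta>: "0 < \<delta>" "\<And>t. 0 \<le> t \<Longrightarrow> t < \<delta> \<Longrightarrow> theta d L (\<J> t) = 0"
    using nonperc0_theta[OF J] by blast
  have "ereal \<delta> \<le> lambda_c d L \<J>"
    unfolding lambda_c_def using \<delta>(2) by (intro Inf_greatest) (force simp: not_less[symmetric])
  then obtain tc where tc: "lambda_c d L \<J> = ereal tc" "\<delta> \<le> tc"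
    using fin by (cases "lambda_c d L \<J>") auto
  show thesis
  proof (rule that[of tc])
    show "0 < tc" using \<delta> tc by simp
    show "theta d L (\<J> t) = 0" if "0 \<le> t" "t < tc" for t
    proof (rule ccontr)
      assume "theta d L (\<J> t) \<noteq> 0"
      then have "t \<in> ?T" using that theta_nonneg[of "\<J> t"] by simp
      then have "lambda_c d L \<J> \<le> ereal t" unfolding lambda_c_def by (intro Inf_lower) auto
      then show False using tc that by simp
    qed
    show "\<exists>t. tc \<le> t \<and> t < tc + \<epsilon> \<and> 0 < theta d L (\<J> t)" if "0 < \<epsilon>" for \<epsilon>
    proof -
      have "Inf (ereal ` ?T) < ereal (tc + \<epsilon>)" using tc that unfolding lambda_c_def by simp
      then obtain t where t: "t \<in> ?T" "t < tc + \<epsilon>" unfolding Inf_less_iff by auto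
      have "lambda_c d L \<J> \<le> ereal t" unfolding lambda_c_def using t by (intro Inf_lower) auto
      then show ?thesis using tc t by auto
    qed
  qed (rule tc)
qed

text \<open>The start of the recursion involves only the edges of \<open>bl n1\<close>, so its
  potential is continuous in the parameter, and the lower bound on long edges drops by at most a
  factor 2. The margins of \<open>scheme_start\<close> absorb both, and percolation would persist
  below \<open>tc\<close>.\<close>

lemma continuous_transition:
  assumes J: "proper_family d L \<J>" and large: "fam_large d L \<J> (crit_fun d)"
    and tc: "0 < tc" "\<And>t. 0 \<le> t \<Longrightarrow> t < tc \<Longrightarrow> theta d L (\<J> t) = 0"
  shows "theta d L (\<J> tc) = 0"
proof (rule ccontr)
  assume "theta d L (\<J> tc) \<noteq> 0"
  then have pos: "0 < theta d L (\<J> tc)" using theta_nonneg[of "\<J> tc"] by simp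
  interpret tc: hkernel d L "\<J> tc" using proper_hkernel[OF J tc(1)] .
  have reg: "kregular d L (\<J> tc)" using J tc(1) unfolding proper_family_def by blast
  obtain a :: real and n1 D where a: "0 < a" and D: "scheme n1 D" and potential: "12 * a \<le> potential (\<J> tc) a n1 D"
    and n1: "1 \<le> n1" "(real q)\<^sup>2 * (1 + 1 / (2 * a)) \<le> a * n1"
    and big: "\<And>u v. u \<in> H \<Longrightarrow> v \<in> H \<Longrightarrow> u \<noteq> v \<Longrightarrow> n1 < hlev u v \<Longrightarrow>
      4 * (real q)\<^sup>2 / a\<^sup>2 * ln (hlev u v) / (real (q ^ hlev u v))\<^sup>2 \<le> \<J> tc {u, v}"
    by (rule tc.scheme_start[OF pos reg fam_largeD[OF large tc(1)]]) (rule that)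
  have lim: "((\<lambda>t. bexp (\<J> t) (edges (bl n1)) F) \<longlongrightarrow> bexp (\<J> tc) (edges (bl n1)) F) (at tc)" for F
    using edges_bl_subset by (intro tendsto_bexp proper_tendsto[OF J tc(1)]) auto
  have potential_eq: "potential K a n1 D = bexp K (edges (bl n1)) D - 2 / (27 * a) *
      (bexp K (edges (bl n1)) (\<lambda>A. (D A)\<^sup>2) - (bexp K (edges (bl n1)) D)\<^sup>2)" for K
  proof -
    let ?e = "bexp K (edges (bl n1))"
    have "?e (\<lambda>A. (D A - ?e D)\<^sup>2) = ?e (\<lambda>A. (D A)\<^sup>2 + (?e D)\<^sup>2 - 2 * ?e D * D A)"
      by (intro bexp_cong) (simp add: power2_diff)
    also have "\<dots> = ?e (\<lambda>A. (D A)\<^sup>2) - (?e D)\<^sup>2"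
      by (simp add: bexp_diff bexp_add bexp_cmult power2_eq_square)
    finally show ?thesis by (simp add: potential_def)
  qed
  have "((\<lambda>t. potential (\<J> t) a n1 D) \<longlongrightarrow> potential (\<J> tc) a n1 D) (at tc)"
    unfolding potential_eq by (intro tendsto_intros lim)
  then have "\<forall>\<^sub>F t in at tc. 11 * a < potential (\<J> t) a n1 D"
    using potential a by (intro order_tendstoD) auto
  with proper_ratio[OF J tc(1), of 1] have "\<forall>\<^sub>F t in at tc. 11 * a < potential (\<J> t) a n1 D \<and>
      (\<forall>e\<in>hedges d L. \<J> tc e \<le> 2 * \<J> t e)"
    by (auto elim: eventually_elim2)
  then have "\<forall>\<^sub>F t in at_left tc. 11 * a < potential (\<J> t) a n1 D \<and> (\<forall>e\<in>hedges d L. \<J> tc e \<le> 2 * \<J> t e)"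
    by (rule filter_leD[OF at_le, rotated]) auto
  moreover have "\<forall>\<^sub>F t in at_left tc. t \<in> {0<..<tc}"
    using tc(1) by (rule eventually_at_left_real)
  ultimately have "\<forall>\<^sub>F t in at_left tc. (11 * a < potential (\<J> t) a n1 D \<and>
      (\<forall>e\<in>hedges d L. \<J> tc e \<le> 2 * \<J> t e)) \<and> t \<in> {0<..<tc}"
    by (rule eventually_conj)
  then obtain t where t: "11 * a < potential (\<J> t) a n1 D" "\<And>e. e \<in> hedges d L \<Longrightarrow> \<J> tc e \<le> 2 * \<J> t e" "0 < t" "t < tc"
    using eventually_happens trivial_limit_at_left_real by fastforce
  interpret t: hkernel d L "\<J> t" using proper_hkernel[OF J t(3)] .
  have "0 < theta d L (\<J> t)"
  proof (rule t.theta_pos_of_scheme[OF D a _ n1])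
    show "11 * a \<le> potential (\<J> t) a n1 D" using t(1) by simp
    fix u v assume uv: "u \<in> H" "v \<in> H" "u \<noteq> v" "n1 < hlev u v"
    have "4 * (real q)\<^sup>2 / a\<^sup>2 * ln (hlev u v) / (real (q ^ hlev u v))\<^sup>2 \<le> 2 * \<J> t {u, v}"
      using big[OF uv] t(2)[of "{u, v}"] uv by (simp add: hedges_edges)
    then show "2 * (real q)\<^sup>2 / a\<^sup>2 * ln (hlev u v) / (real (q ^ hlev u v))\<^sup>2 \<le> \<J> t {u, v}"
      by simp
  qed
  then show False using tc(2)[of t] t by simp
qed

lemma no_transition:
  assumes J: "proper_family d L \<J>" and small: "fam_small d L \<J> (crit_fun d)" and t: "0 \<le> t"
  shows "theta d L (\<J> t) = 0"
proof -
  have pos: "theta d L (\<J> s) = 0" if s: "0 < s" for s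
  proof -
    interpret hkernel d L "\<J> s" using proper_hkernel[OF J s] .
    \<comment> \<open>\<open>ratio_upper\<close> doubles 1/16 to \<open>C = 1 / 8\<close>, for which
      \<open>8 * C * \<delta>\<^sup>2\<close> is exactly 1 at \<open>\<delta> = 1\<close>.\<close>
    have "Limsup (long_edges d L) (fam_ratio L \<J> (crit_fun d) s) < ereal (1 / 16)"
      using small s unfolding fam_small_def by simp
    then have dom: "dominated (1 / 8)"
      using ratio_upper[of \<J> s "1 / 16"] unfolding dominated_def by simp
    have "cluster_tail (\<J> s) N (Suc 0) \<le> 1" for N
      unfolding cluster_tail_def by (intro bexp_le_const J_bl_nonneg) auto
    then show ?thesis by (intro theta_zero_of_dominated[OF dom, of 0 1]) auto
  qed
  have "theta d L (\<J> t) \<le> theta d L (\<J> (t + 1))"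
    using proper_mono[OF J] t by (intro theta_mono) auto
  then show ?thesis using pos[of "t + 1"] t theta_nonneg[of "\<J> t"] by simp
qed

text \<open>If \<open>theta\<close> vanished at \<open>tc\<close>, large clusters would be rare
  there and, by \<open>cluster_tail_perturb\<close>, still rare at a slightly larger parameter that
  percolates; \<open>theta_zero_of_dominated\<close> forbids this.\<close>

lemma discontinuous_transition:
  assumes J: "proper_family d L \<J>" and asymp: "fam_asymp d L \<J> (crit_fun d)"
    and tc: "0 < tc" "\<And>\<epsilon>. 0 < \<epsilon> \<Longrightarrow> \<exists>t. tc \<le> t \<and> t < tc + \<epsilon> \<and> 0 < theta d L (\<J> t)"
  shows "0 < theta d L (\<J> tc)"
proof (rule ccontr)
  assume "\<not> 0 < theta d L (\<J> tc)"
  then have zero: "theta d L (\<J> tc) = 0" using theta_nonneg[of "\<J> tc"] by simp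
  interpret tc: hkernel d L "\<J> tc" using proper_hkernel[OF J tc(1)] .
  \<comment> \<open>By monotonicity a bound at \<open>tc + 1\<close> serves all parameters in
    between, so \<open>\<delta>\<close> and \<open>s\<close> can be fixed before the percolating
    parameter is chosen.\<close>
  have "Limsup (long_edges d L) (fam_ratio L \<J> (crit_fun d) (tc + 1)) < \<infinity>"
    using asymp tc(1) unfolding fam_asymp_def by simp
  then obtain c0 where c0: "Limsup (long_edges d L) (fam_ratio L \<J> (crit_fun d) (tc + 1)) < ereal c0"
    using less_PInf_Ex_of_nat by (metis ereal_dense2 ereal_less_PInfty less_ereal.simps)
  define c where "c = max c0 0"
  have c: "0 \<le> c" "Limsup (long_edges d L) (fam_ratio L \<J> (crit_fun d) (tc + 1)) < ereal c"
    using less_le_trans[OF c0, of "ereal c"] by (auto simp: c_def)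
  obtain m where m: "\<And>u v. u \<in> H \<Longrightarrow> v \<in> H \<Longrightarrow> u \<noteq> v \<Longrightarrow> m \<le> hlev u v \<Longrightarrow>
      \<J> (tc + 1) {u, v} \<le> 2 * c * ln (hlev u v) / (real (q ^ hlev u v))\<^sup>2"
    using ratio_upper[OF c(2,1)] by blast
  define \<delta> where "\<delta> = 1 / (16 * c + 1)"
  have \<delta>: "0 < \<delta>" "8 * (2 * c) * \<delta>\<^sup>2 \<le> 1"
  proof -
    show "0 < \<delta>" using c by (simp add: \<delta>_def)
    have "16 * c * 1 \<le> (16 * c + 1) * (16 * c + 1)" using c by (intro mult_mono) auto
    then show "8 * (2 * c) * \<delta>\<^sup>2 \<le> 1" using c by (simp add: \<delta>_def power2_eq_square divide_le_eq)
  qed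
  obtain s where s: "\<And>N. cluster_tail (\<J> tc) N s < \<delta> / 2"
    using cluster_tail_le_theta[of "\<J> tc" "\<delta> / 2"] tc.J_nonneg zero \<delta>(1) by auto
  have s': "cluster_tail (\<J> tc) N (Suc s) \<le> \<delta> / 2" for N
  proof -
    have "cluster_tail (\<J> tc) N (Suc s) \<le> cluster_tail (\<J> tc) N s"
      unfolding cluster_tail_def by (intro bexp_mono tc.J_bl_nonneg) auto
    then show ?thesis using s[of N] by linarith
  qed
  define \<eta> where "\<eta> = \<delta> / 2 / (s * tc.tau 0 + 1)"
  have st: "0 \<le> s * tc.tau 0" using tc.tau_nonneg[of 0] by simp
  have \<eta>: "0 < \<eta>" using \<delta> st by (simp add: \<eta>_def)
  have \<eta>s: "\<eta> * s * tc.tau 0 \<le> \<delta> / 2"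
  proof -
    have "\<eta> * (s * tc.tau 0) \<le> \<eta> * (s * tc.tau 0 + 1)" using \<eta> by (intro mult_left_mono) auto
    also have "\<dots> = \<delta> / 2"
      using st nonzero_divide_eq_eq[of "s * tc.tau 0 + 1" "\<delta> / 2" \<eta>] by (simp add: \<eta>_def)
    finally show ?thesis by (simp add: mult.assoc)
  qed
  obtain \<epsilon> where \<epsilon>: "0 < \<epsilon>" "\<And>t e. t \<noteq> tc \<Longrightarrow> dist t tc < \<epsilon> \<Longrightarrow> e \<in> hedges d L \<Longrightarrow> \<J> t e \<le> (1 + \<eta>) * \<J> tc e"
    using proper_ratio[OF J tc(1) \<eta>] unfolding eventually_at by blast
  obtain t where t: "tc \<le> t" "t < tc + min \<epsilon> 1" "0 < theta d L (\<J> t)"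
    using tc(2)[of "min \<epsilon> 1"] \<epsilon>(1) by auto
  have "t \<noteq> tc" using t zero by auto
  interpret t: hkernel d L "\<J> t" using proper_hkernel[OF J, of t] t tc(1) by simp
  have dom: "t.dominated (2 * c)"
    unfolding t.dominated_def
  proof (intro exI[of _ m] ballI impI)
    fix u v assume uv: "u \<in> H" "v \<in> H" "u \<noteq> v" "m \<le> hlev u v"
    have "\<J> t {u, v} \<le> \<J> (tc + 1) {u, v}"
      using proper_mono(2)[OF J, of t "tc + 1" "{u, v}"] t tc(1) uv by (simp add: hedges_edges)
    then show "\<J> t {u, v} \<le> 2 * c * ln (hlev u v) / (real (q ^ hlev u v))\<^sup>2" using m[OF uv] by linarith
  qed
  have "cluster_tail (\<J> t) N (Suc s) \<le> \<delta>" for N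
  proof -
    have "cluster_tail (\<J> t) N (Suc s) \<le> cluster_tail (\<J> tc) N (Suc s) + \<eta> * s * tc.tau 0"
    proof (rule tc.cluster_tail_perturb)
      show "\<J> tc e \<le> \<J> t e" if "e \<in> hedges d L" for e
        using proper_mono(2)[OF J _ t(1) that] tc(1) by simp
      show "\<J> t e \<le> (1 + \<eta>) * \<J> tc e" if "e \<in> hedges d L" for e
        using \<epsilon>(2)[OF \<open>t \<noteq> tc\<close> _ that] t by (simp add: dist_real_def)
    qed (use \<eta> in simp)
    then show ?thesis using s'[of N] \<eta>s by linarith
  qed
  then have "theta d L (\<J> t) = 0"
    using c \<delta>(2) by (intro t.theta_zero_of_dominated[OF dom, of s \<delta>]) auto
  then show False using t(3) by simp
qed

end

theorem theorem1p1:
  fixes d L :: nat and \<J> :: kfamily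
  assumes "d \<ge> 1" and "L \<ge> 2"
    and "proper_family d L \<J>"
  shows "(fam_large d L \<J> (crit_fun d) \<and> lambda_c d L \<J> < \<infinity>
            \<longrightarrow> theta d L (\<J> (real_of_ereal (lambda_c d L \<J>))) = 0)
       \<and> (fam_small d L \<J> (crit_fun d) \<longrightarrow> lambda_c d L \<J> = \<infinity>)
       \<and> (fam_asymp d L \<J> (crit_fun d) \<and> lambda_c d L \<J> < \<infinity>
            \<longrightarrow> theta d L (\<J> (real_of_ereal (lambda_c d L \<J>))) > 0)"
proof -
  interpret hlattice d L by (rule hlattice.intro[OF assms(1,2)])
  note J = assms(3)
  show ?thesis
  proof (intro conjI impI)
    assume *: "fam_large d L \<J> (crit_fun d) \<and> lambda_c d L \<J> < \<infinity>"
    obtain tc where tc: "0 < tc" "lambda_c d L \<J> = ereal tc" "\<And>t. 0 \<le> t \<Longrightarrow> t < tc \<Longrightarrow> theta d L (\<J> t) = 0"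
      by (rule lambda_c_real[OF J conjunct2[OF *]]) (rule that)
    show "theta d L (\<J> (real_of_ereal (lambda_c d L \<J>))) = 0"
      using continuous_transition[OF J conjunct1[OF *] tc(1,3)] by (simp add: tc(2))
  next
    assume "fam_small d L \<J> (crit_fun d)"
    then have "{t. 0 \<le> t \<and> theta d L (\<J> t) > 0} = {}" using no_transition[OF J] by force
    then show "lambda_c d L \<J> = \<infinity>" by (simp only: lambda_c_def) (simp add: top_ereal_def)
  next
    assume *: "fam_asymp d L \<J> (crit_fun d) \<and> lambda_c d L \<J> < \<infinity>"
    obtain tc where tc: "0 < tc" "lambda_c d L \<J> = ereal tc"
      "\<And>\<epsilon>. 0 < \<epsilon> \<Longrightarrow> \<exists>t. tc \<le> t \<and> t < tc + \<epsilon> \<and> 0 < theta d L (\<J> t)"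
      by (rule lambda_c_real[OF J conjunct2[OF *]]) (rule that)
    show "0 < theta d L (\<J> (real_of_ereal (lambda_c d L \<J>)))"
      using discontinuous_transition[OF J conjunct1[OF *] tc(1,3)] by (simp add: tc(2))
  qed
qed

end
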